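(* The characteristic functions of ergodic $\mathrm{GL}(\infty,\mathcal{O}_F)\times\mathrm{GL}(\infty,\mathcal{O}_F)$-invariant probability measures on $\mathrm{Mat}(\mathbb{N},F)$ are exactly the functions of the form $$\varphi(A)=\prod_{\ell\in\mathrm{Sing}(A)}\exp\Big(-\log q\cdot\sum_{j=1}^\infty(k_j+\ell)\mathbf{1}_{\{k_j+\ell\ge 1\}}\Big),\qquad A\in\mathrm{Mat}(\infty,F),$$ where $\mathbb{k}=(k_j)_{j\in\mathbb{N}}$ ranges over $\Delta$.
   Context: $F$ is a non-discrete locally compact non-Archimedean field with absolute value $|\cdot|$; $\mathcal{O}_F=\{|x|\le 1\}$; $\varpi$ is a fixed generator of the maximal ideal $\{|x|<1\}$; $q=\#(\mathcal{O}_F/\varpi\mathcal{O}_F)$, $|\varpi|=q^{-1}$. Conventions: $\varpi^\infty=0$, $\exp(-\infty)=0$; a term with $k_j=-\infty$ or $\ell=-\infty$ contributes $0$ to the sum. $\mathrm{GL}(\infty,\mathcal{O}_F)=\varinjlim\mathrm{GL}(n,\mathcal{O}_F)$ is the group of infinite invertible matrices $g$ over $\mathcal{O}_F$ with $g_{ij}=\delta_{ij}$ for $i+j$ large. $\mathrm{Mat}(\mathbb{N},F)$ is the space of all infinite matrices over $F$ indexed by $\mathbb{N}\times\mathbb{N}$ (product topology); $\mathrm{Mat}(\infty,F)$ is the subspace of matrices with only finitely many non-zero entries. The action is $((g_1,g_2),M)\mapsto g_1Mg_2^{-1}$; an invariant Borel probability measure is ergodic if every invariant Borel set has measure $0$ or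 $1$. $\chi$ is a fixed character of the additive group $F$ with $\chi|_{\mathcal{O}_F}\equiv1$ and $\chi$ not constant on $\varpi^{-1}\mathcal{O}_F$. The characteristic function of a Borel probability measure $\mu$ on $\mathrm{Mat}(\mathbb{N},F)$ is $\widehat\mu(A)=\int\chi(\mathrm{tr}(AM))\,\mu(dM)$, $A\in\mathrm{Mat}(\infty,F)$. Every $A\in\mathrm{Mat}(n,F)$ can be written $A=a\cdot\mathrm{diag}(\varpi^{-k_1},\dots,\varpi^{-k_n})\cdot b$ with $a,b\in\mathrm{GL}(n,\mathcal{O}_F)$, $k_i\in\mathbb{Z}\cup\{-\infty\}$; the numbers $k_1,\dots,k_n$, with multiplicities, are uniquely determined by $A$ and form the multiset $\mathrm{Sing}(A)$ of singular numbers of $A$. (For $A\in\mathrm{Mat}(\infty,F)$ view $A$ as an $n\times n$ matrix for $n$ large; additional singular numbers $-\infty$ contribute factors $1$.) $\Delta=\{(k_j)_{j=1}^\infty: k_j\in\mathbb{Z}\cup\{-\infty\},\ k_1\ge k_2\ge\cdots\}$. *)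

theory Defs
  imports "HOL-Probability.Probability" "HOL-Library.Option_ord" "HOL-Library.Multiset"
begin

text \<open>
  The topology is that of the metric \<open>absv (x - y)\<close>; in particular \<open>absv x = dist x 0\<close> is
  non-negative and vanishes only at \<open>0\<close>.
\<close>

class nonarch_local_field = field + metric_space +
  fixes absv :: "'a \<Rightarrow> real"
  assumes dist_absv: "dist x y = absv (x - y)"
    and absv_mult: "absv (x * y) = absv x * absv y"
    and absv_ultrametric: "absv (x + y) \<le> max (absv x) (absv y)"
    and nondiscrete: "\<not> open {0}"
    and locally_compact: "\<exists>U K. open U \<and> compact K \<and> x \<in> U \<and> U \<subseteq> K"

definition integer_ring :: "'a::nonarch_local_field set"
  where "integer_ring = {x. absv x \<le> 1}"

definition uniformizer :: "'a::nonarch_local_field \<Rightarrow> bool"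
  where "uniformizer \<pi> \<longleftrightarrow> {x. absv x < 1} = (\<lambda>y. \<pi> * y) ` integer_ring"

definition residue_card :: "'a::nonarch_local_field \<Rightarrow> nat"
  where "residue_card \<pi> =
    card (integer_ring // {(x, y). x \<in> integer_ring \<and> y \<in> integer_ring \<and>
                                   x - y \<in> (\<lambda>z. \<pi> * z) ` integer_ring})"

definition additive_character :: "('a::nonarch_local_field \<Rightarrow> complex) \<Rightarrow> bool"
  where "additive_character \<psi> \<longleftrightarrow>
    continuous_on UNIV \<psi> \<and> (\<forall>x. norm (\<psi> x) = 1) \<and> (\<forall>x y. \<psi> (x + y) = \<psi> x * \<psi> y)"


section \<open>Infinite matrices\<close>

text \<open>
  The type of infinite matrices, with rows and columns numbered from \<open>0\<close>, carries the
  product topology (the library instance for functions) and the corresponding Borel sets.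
\<close>

type_synonym 'a inf_mat = "nat \<Rightarrow> nat \<Rightarrow> 'a"

text \<open>
  Sums run over the indices of the non-zero summands. In every product used below there are
  finitely many of these: the rows of the left factor or the columns of the right factor are
  finitely supported.
\<close>

definition mat_prod :: "'a::nonarch_local_field inf_mat \<Rightarrow> 'a inf_mat \<Rightarrow> 'a inf_mat"
    (infixl \<open>\<odot>\<close> 70)
  where "A \<odot> B = (\<lambda>i j. \<Sum>k\<in>{k. A i k * B k j \<noteq> 0}. A i k * B k j)"

definition mat_one :: "'a::nonarch_local_field inf_mat"
  where "mat_one = (\<lambda>i j. if i = j then 1 else 0)"

definition mat_trace :: "'a::nonarch_local_field inf_mat \<Rightarrow> 'a"
  where "mat_trace A = (\<Sum>i\<in>{i. A i i \<noteq> 0}. A i i)"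

definition Mat_inf :: "'a::nonarch_local_field inf_mat set"
  where "Mat_inf = {A. finite {(i, j). A i j \<noteq> 0}}"

text \<open>\<open>Mat(n, F)\<close> is embedded by padding with zeros.\<close>

definition Mat_fin :: "nat \<Rightarrow> 'a::nonarch_local_field inf_mat set"
  where "Mat_fin n = {A. \<forall>i j. n \<le> i \<or> n \<le> j \<longrightarrow> A i j = 0}"

text \<open>\<open>GL(n, O)\<close> is embedded by padding with the identity; the direct limit is then a union.\<close>

definition int_block :: "nat \<Rightarrow> 'a::nonarch_local_field inf_mat set"
  where "int_block n =
    {g. (\<forall>i j. g i j \<in> integer_ring) \<and> (\<forall>i j. n \<le> i \<or> n \<le> j \<longrightarrow> g i j = mat_one i j)}"

definition GL_fin :: "nat \<Rightarrow> 'a::nonarch_local_field inf_mat set"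
  where "GL_fin n =
    {g \<in> int_block n. \<exists>h\<in>int_block n. g \<odot> h = mat_one \<and> h \<odot> g = mat_one}"

definition GL_inf :: "'a::nonarch_local_field inf_mat set"
  where "GL_inf = (\<Union>n. GL_fin n)"

definition GL_inverse :: "'a::nonarch_local_field inf_mat \<Rightarrow> 'a inf_mat"
  where "GL_inverse g = (THE h. h \<in> GL_inf \<and> g \<odot> h = mat_one \<and> h \<odot> g = mat_one)"

definition GL_action ::
    "'a::nonarch_local_field inf_mat \<Rightarrow> 'a inf_mat \<Rightarrow> 'a inf_mat \<Rightarrow> 'a inf_mat"
  where "GL_action g1 g2 M = g1 \<odot> M \<odot> GL_inverse g2"


section \<open>Ergodic measures and characteristic functions\<close>

definition invariant_prob :: "'a::nonarch_local_field inf_mat measure \<Rightarrow> bool"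
  where "invariant_prob \<mu> \<longleftrightarrow> sets \<mu> = sets borel \<and> prob_space \<mu> \<and>
    (\<forall>g1\<in>GL_inf. \<forall>g2\<in>GL_inf. distr \<mu> borel (GL_action g1 g2) = \<mu>)"

definition invariant_set :: "'a::nonarch_local_field inf_mat set \<Rightarrow> bool"
  where "invariant_set B \<longleftrightarrow> (\<forall>g1\<in>GL_inf. \<forall>g2\<in>GL_inf. GL_action g1 g2 ` B = B)"

definition ergodic_measures :: "'a::nonarch_local_field inf_mat measure set"
  where "ergodic_measures =
    {\<mu>. invariant_prob \<mu> \<and>
        (\<forall>B\<in>sets borel. invariant_set B \<longrightarrow> measure \<mu> B = 0 \<or> measure \<mu> B = 1)}"

definition char_fun ::
    "('a::nonarch_local_field \<Rightarrow> complex) \<Rightarrow> 'a inf_mat measure \<Rightarrow> 'a inf_mat \<Rightarrow> complex"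
  where "char_fun \<psi> \<mu> A = (LINT M|\<mu>. \<psi> (mat_trace (A \<odot> M)))"


section \<open>Singular numbers\<close>

text \<open>
  The set of integers together with \<open>-\<infinity>\<close> is \<^typ>\<open>int option\<close>, with \<^const>\<open>None\<close> for
  \<open>-\<infinity>\<close>: in the order of \<^theory>\<open>HOL-Library.Option_ord\<close>, \<^const>\<open>None\<close> is the least element.
\<close>

text \<open>\<open>\<pi>\<close> to the power \<open>-k\<close>, where \<open>\<pi>\<close> to the power \<open>\<infinity>\<close> is \<open>0\<close>.\<close>

fun neg_power :: "'a::nonarch_local_field \<Rightarrow> int option \<Rightarrow> 'a"
  where
    "neg_power \<pi> None = 0"
  | "neg_power \<pi> (Some k) = \<pi> powi (- k)"

definition diag_mat :: "'a::nonarch_local_field \<Rightarrow> int option list \<Rightarrow> 'a inf_mat"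
  where "diag_mat \<pi> ks =
    (\<lambda>i j. if i = j \<and> i < length ks then neg_power \<pi> (ks ! i) else 0)"

text \<open>For \<open>A\<close> in \<^term>\<open>Mat_fin n\<close>, the multiset of its \<open>n\<close> singular numbers.\<close>

definition Sing_fin ::
    "'a::nonarch_local_field \<Rightarrow> nat \<Rightarrow> 'a inf_mat \<Rightarrow> int option multiset"
  where "Sing_fin \<pi> n A =
    (THE S. \<exists>a\<in>GL_fin n. \<exists>b\<in>GL_fin n. \<exists>ks.
       length ks = n \<and> A = a \<odot> diag_mat \<pi> ks \<odot> b \<and> S = mset ks)"

text \<open>
  For \<open>A\<close> in \<^term>\<open>Mat_inf\<close> the smallest admissible size is taken; a larger one only adds
  singular numbers \<open>-\<infinity>\<close>, whose factors in the product below are \<open>1\<close>.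
\<close>

definition Sing :: "'a::nonarch_local_field \<Rightarrow> 'a inf_mat \<Rightarrow> int option multiset"
  where "Sing \<pi> A = Sing_fin \<pi> (LEAST n. A \<in> Mat_fin n) A"

definition Delta :: "(nat \<Rightarrow> int option) set"
  where "Delta = {k. antimono k}"

text \<open>The summand \<open>(k + l)\<close> times the indicator of \<open>k + l \<ge> 1\<close>.\<close>

fun trunc_add :: "int option \<Rightarrow> int option \<Rightarrow> int"
  where
    "trunc_add (Some k) (Some l) = (if k + l \<ge> 1 then k + l else 0)"
  | "trunc_add _ _ = 0"

definition exp_ereal :: "ereal \<Rightarrow> real"
  where "exp_ereal x = (if x = - \<infinity> then 0 else exp (real_of_ereal x))"

text \<open>The series is a sum of non-negative extended reals and may be \<open>\<infinity>\<close>.\<close>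

definition sing_factor :: "nat \<Rightarrow> (nat \<Rightarrow> int option) \<Rightarrow> int option \<Rightarrow> real"
  where "sing_factor q k l =
    exp_ereal (- ereal (ln (real q)) * (\<Sum>j. ereal (real_of_int (trunc_add (k j) l))))"

definition phi ::
    "'a::nonarch_local_field \<Rightarrow> (nat \<Rightarrow> int option) \<Rightarrow> 'a inf_mat \<Rightarrow> complex"
  where "phi \<pi> k A =
    complex_of_real (\<Prod>l\<in>#Sing \<pi> A. sing_factor (residue_card \<pi>) k l)"

end

theory Submission
  imports Defs "HOL-Library.Diagonal_Subsequence"
begin

text \<open>
  For a matrix \<open>B\<close> let \<open>W n B = corner_prob n n B\<close> be the probability that the \<open>n\<close>-corner of \<open>B\<close>
  maps a uniform integral vector to an integral vector. Writing the indicator of integrality as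
  the integral of a character against a second uniform vector makes \<open>W\<close> symmetric in rows and
  columns. Hence \<open>W n\<close> is invariant under multiplication by integral invertible matrices on both
  sides, it is the product of the \<open>1 / q ^ max 0 k\<close> over the singular numbers \<open>k\<close> of the corner
  (which are thereby unique), and it decreases in \<open>n\<close>.

  For an invariant measure \<open>\<mu>\<close>, the limit \<open>X\<close> of \<open>M \<mapsto> W n (c M)\<close> is therefore an invariant function,
  and the integral of \<open>\<psi> (tr (B M)) * X M\<close> is the characteristic function at the block sum of \<open>B\<close>
  and \<open>c\<close>: a finite matrix \<open>B\<close> perturbed by a random rank one matrix of size \<open>n\<close> lies in the orbit
  of that block sum with probability tending to 1. If \<open>\<mu>\<close> is ergodic, then \<open>X\<close> is constant, so the
  characteristic function is a product over the singular numbers whose factors are limits of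
  \<open>W n (c M)\<close> for a single matrix \<open>M\<close>. Compactness of the space of weakly decreasing sequences
  puts these limits into the required form.

  Conversely, the product attached to a sequence \<open>k\<close> is the characteristic function of
  the sum of the \<open>\<pi> powi (- k j) * X j \<otimes> Y j\<close> with independent uniform integral vectors \<open>X j\<close>, \<open>Y j\<close>,
  plus a uniform matrix if \<open>k\<close> stabilises. Since it is multiplicative, \<open>X\<close> has second moment equal
  to the square of its mean and is constant; so conditioning on an invariant event changes
  neither the characteristic function nor the measure.
\<close>

section \<open>Local fields\<close>

text \<open>The normalisation of \<open>\<psi>\<close> makes the uniform measure on the ring of
  integers self-dual: averaging \<open>\<psi> (t * x)\<close> over integral \<open>x\<close> yields
  the indicator of integrality of \<open>t\<close>. Besides the symmetry of the corner
  probabilities, this identity expresses them as averages of characters of \<open>M\<close> and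
  inverts characteristic functions on small boxes. The rank one matrices come from these averages:
  two uniform vectors \<open>u\<close>, \<open>v\<close> enter through \<open>\<psi>\<close> of
  \<open>u\<^sup>T (c M) v\<close>, which is the trace of \<open>c v u\<^sup>T\<close> times
  \<open>M\<close>, so weighting by \<open>W n (c M)\<close> shifts the argument of the
  characteristic function by \<open>c v u\<^sup>T\<close>. Since \<open>W n\<close> decreases at
  every single \<open>M\<close>, the limit exists everywhere and is invariant in the strict sense,
  as the definition of ergodicity demands of its sublevel sets. In the converse direction the series
  of rank one terms diverges when the sequence stabilises at a finite value \<open>x\<close>;
  infinitely many independent terms at scale \<open>x\<close> would have the effect of one uniform
  matrix at that scale, which therefore replaces them.\<close>

lemma absv_eq_dist: "absv x = dist x (0::'a::nonarch_local_field)"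
  by (simp add: dist_absv)

lemma absv_nonneg [simp]: "0 \<le> absv (x::'a::nonarch_local_field)"
  by (simp add: absv_eq_dist)

lemma absv_eq_0_iff [simp]: "absv (x::'a::nonarch_local_field) = 0 \<longleftrightarrow> x = 0"
  by (simp add: absv_eq_dist)

lemma absv_0 [simp]: "absv (0::'a::nonarch_local_field) = 0"
  by simp

lemma absv_pos_iff [simp]: "0 < absv (x::'a::nonarch_local_field) \<longleftrightarrow> x \<noteq> 0"
  by (simp add: absv_eq_dist)

lemma absv_1 [simp]: "absv (1::'a::nonarch_local_field) = 1"
  using absv_mult[of "1::'a" 1] by (metis absv_eq_0_iff mult_cancel_right1 mult_1 zero_neq_one)

lemma absv_minus [simp]: "absv (- x) = absv (x::'a::nonarch_local_field)"
  using dist_commute[of x 0] by (simp add: dist_absv)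

lemma absv_diff_ultrametric: "absv (x - y) \<le> max (absv x) (absv (y::'a::nonarch_local_field))"
  using absv_ultrametric[of x "- y"] by simp

lemma absv_inverse: "absv (inverse x) = inverse (absv (x::'a::nonarch_local_field))"
proof (cases "x = 0")
  case False
  then have "absv x * absv (inverse x) = 1"
    by (simp flip: absv_mult)
  then show ?thesis
    by (simp add: inverse_unique)
qed simp

lemma absv_divide: "absv (x / y) = absv x / absv (y::'a::nonarch_local_field)"
  by (simp add: divide_inverse absv_mult absv_inverse)

lemma absv_power: "absv (x ^ n) = absv (x::'a::nonarch_local_field) ^ n"
  by (induction n) (simp_all add: absv_mult)

lemma absv_power_int: "absv (x powi k) = absv (x::'a::nonarch_local_field) powi k"
  by (simp add: power_int_def absv_power absv_inverse)

lemma absv_sum_le: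
  fixes f :: "'b \<Rightarrow> 'a::nonarch_local_field"
  assumes "\<And>i. i \<in> I \<Longrightarrow> absv (f i) \<le> r" and "0 \<le> r"
  shows "absv (sum f I) \<le> r"
  using assms
proof (induction I rule: infinite_finite_induct)
  case (insert i I)
  then show ?case
    using absv_ultrametric[of "f i" "sum f I"] by force
qed auto

section \<open>Topology of a local field: continuous operations, compact balls, countable
  base\<close>

instance nonarch_local_field \<subseteq> topological_ab_group_add
proof
  fix a b :: 'a
  show "((\<lambda>x. fst x + snd x) \<longlongrightarrow> a + b) (nhds a \<times>\<^sub>F nhds b)"
  proof (rule tendstoI)
    fix e :: real assume "0 < e"
    have "\<forall>\<^sub>F x in nhds a \<times>\<^sub>F nhds b. dist (fst x) a < e \<and> dist (snd x) b < e"
      unfolding eventually_prod_filter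
      using \<open>0 < e\<close> by (intro exI[of _ "\<lambda>x. dist x a < e"] exI[of _ "\<lambda>x. dist x b < e"])
        (auto simp: eventually_nhds_metric)
    then show "\<forall>\<^sub>F x in nhds a \<times>\<^sub>F nhds b. dist (fst x + snd x) (a + b) < e"
    proof eventually_elim
      case (elim x)
      then show ?case
        using absv_ultrametric[of "fst x - a" "snd x - b"]
        by (auto simp: dist_absv add_diff_add intro: le_less_trans)
    qed
  qed
  show "(uminus \<longlongrightarrow> - a) (nhds a)"
  proof (rule tendstoI)
    fix e :: real assume "0 < e"
    then have "\<forall>\<^sub>F x in nhds a. dist x a < e"
      by (auto simp: eventually_nhds_metric)
    moreover have "dist (- x) (- a) = dist x a" for x
      using absv_minus[of "x - a"] by (simp add: dist_absv)
    ultimately show "\<forall>\<^sub>F x in nhds a. dist (- x) (- a) < e"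
      by simp
  qed
qed

instance nonarch_local_field \<subseteq> topological_semigroup_mult
proof
  fix a b :: 'a
  show "((\<lambda>x. fst x * snd x) \<longlongrightarrow> a * b) (nhds a \<times>\<^sub>F nhds b)"
  proof (rule tendstoI)
    fix e :: real assume "0 < e"
    \<comment> \<open>The bound \<open>1\<close> on \<open>d\<close> makes the product of the two
      errors at most \<open>d\<close>; the three error terms then add up to at most
      \<open>d * (1 + absv a + absv b)\<close>.\<close>
    define d where "d = min 1 (e / (1 + absv a + absv b))"
    have d: "0 < d" "d \<le> 1" "d * (1 + absv a + absv b) \<le> e"
      using \<open>0 < e\<close> by (auto simp: d_def min_def field_simps add_pos_nonneg not_le)
    have "\<forall>\<^sub>F x in nhds a \<times>\<^sub>F nhds b. dist (fst x) a < d \<and> dist (snd x) b < d"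
      unfolding eventually_prod_filter
      using \<open>0 < d\<close> by (intro exI[of _ "\<lambda>x. dist x a < d"] exI[of _ "\<lambda>x. dist x b < d"])
        (auto simp: eventually_nhds_metric)
    then show "\<forall>\<^sub>F x in nhds a \<times>\<^sub>F nhds b. dist (fst x * snd x) (a * b) < e"
    proof eventually_elim
      case (elim x)
      let ?y = "fst x - a" and ?z = "snd x - b"
      have yz: "absv ?y < d" "absv ?z < d"
        using elim by (auto simp: dist_absv)
      have "fst x * snd x - a * b = ?y * ?z + (?y * b + a * ?z)"
        by (simp add: algebra_simps)
      moreover have "absv (?y * ?z + (?y * b + a * ?z))
          \<le> max (absv (?y * ?z)) (max (absv (?y * b)) (absv (a * ?z)))"
        by (intro order_trans[OF absv_ultrametric] max.mono order_refl absv_ultrametric)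
      ultimately have "absv (fst x * snd x - a * b)
          \<le> max (absv ?y * absv ?z) (max (absv ?y * absv b) (absv a * absv ?z))"
        by (simp add: absv_mult)
      also have "\<dots> \<le> absv ?y * absv ?z + (absv ?y * absv b + absv a * absv ?z)"
        by simp
      also have "\<dots> < d * 1 + (d * absv b + d * absv a)"
      proof (intro add_less_le_mono add_mono)
        show "absv ?y * absv ?z < d * 1"
          using yz d by (intro mult_strict_mono) auto
        show "absv ?y * absv b \<le> d * absv b" "absv a * absv ?z \<le> d * absv a"
          using yz by (auto simp: mult.commute[of d] mult.commute[of _
              "absv b"] intro!: mult_left_mono)
      qed
      also have "\<dots> \<le> e"
        using d(3) by (simp add: algebra_simps)
      finally show ?case
        by (simp add: dist_absv)
    qed
  qed
qed

lemma nontrivial_absv: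
  obtains x :: "'a::nonarch_local_field" where "x \<noteq> 0" "absv x < 1"
proof -
  have "\<not> (\<exists>e>0. \<forall>y::'a. dist y 0 < e \<longrightarrow> y = 0)"
    using nondiscrete[where 'a='a] by (auto simp: open_dist)
  then show ?thesis
    using that by (auto simp: absv_eq_dist not_less dest: spec[of _ 1])
qed

text \<open>Local compactness gives one compact ball around \<open>0\<close>; division by a high
  power of an element of absolute value below 1 expands it until it covers any prescribed
  ball.\<close>

lemma compact_cball_0: "compact (cball (0::'a::nonarch_local_field) R)"
proof -
  obtain U K :: "'a set" where UK: "open U" "compact K" "0 \<in> U" "U \<subseteq> K"
    using locally_compact by blast
  then obtain r where r: "0 < r" "cball 0 r \<subseteq> U"
    by (meson open_contains_cball)
  have comp: "compact (cball (0::'a) r)"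
    using compact_Int_closed[OF UK(2) closed_cball[of 0 r]] order_trans[OF r(2) UK(4)]
    by (simp add: Int_absorb1)
  obtain x :: 'a where x: "x \<noteq> 0" "absv x < 1"
    by (rule nontrivial_absv)
  obtain n where n: "absv x ^ n < r / (1 + \<bar>R\<bar>)"
    using real_arch_pow_inv[of "r / (1 + \<bar>R\<bar>)" "absv x"] x r by (auto simp: add_pos_nonneg)
  have "compact ((\<lambda>z. inverse (x ^ n) * z) ` cball 0 r)"
    by (intro compact_continuous_image comp continuous_intros)
  moreover have "cball 0 R \<subseteq> (\<lambda>z. inverse (x ^ n) * z) ` cball 0 r"
  proof
    fix y :: 'a assume "y \<in> cball 0 R"
    then have "absv y \<le> 1 + \<bar>R\<bar>"
      by (auto simp: dist_absv)
    then have "absv (x ^ n * y) \<le> r / (1 + \<bar>R\<bar>) * (1 + \<bar>R\<bar>)"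
      unfolding absv_mult absv_power using n r by (intro mult_mono) auto
    then have "x ^ n * y \<in> cball 0 r"
      by (simp add: dist_absv)
    then show "y \<in> (\<lambda>z. inverse (x ^ n) * z) ` cball 0 r"
      using x by (intro image_eqI[of _ _ "x ^ n * y"]) auto
  qed
  ultimately show ?thesis
    using compact_Int_closed[OF _ closed_cball[of 0 R]] by (metis Int_absorb1)
qed

instance nonarch_local_field \<subseteq> heine_borel
proof
  fix f :: "nat \<Rightarrow> 'a"
  assume "bounded (range f)"
  then obtain R where "range f \<subseteq> cball 0 R"
    unfolding bounded_any_center[where a=0] by (auto simp: dist_commute image_subset_iff)
  then have "\<forall>n. f n \<in> cball 0 R"
    by (simp add: image_subset_iff)
  then show "\<exists>l r. strict_mono r \<and> (f \<circ> r) \<longlonglongrightarrow> l"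
    using compact_cball_0[of R] unfolding compact_eq_seq_compact_metric seq_compact_def by blast
qed

text \<open>A countable base allows Borel measurability to be checked through components, for pairs
  as well as for infinite matrices; it also supplies the Lindelof property behind the uniqueness of
  measures.\<close>

instance nonarch_local_field \<subseteq> second_countable_topology
proof
  have "\<exists>k. finite k \<and> cball (0::'a) (real n) \<subseteq> (\<Union>x\<in>k. ball x (inverse (real (Suc m))))" for n m
    using compact_cball_0[of "real n"] unfolding compact_eq_totally_bounded
    by (metis inverse_positive_iff_positive of_nat_0_less_iff zero_less_Suc)
  then obtain k where k: "\<And>n m. finite (k n m)"
    "\<And>n m. cball (0::'a) (real n) \<subseteq> (\<Union>x\<in>k n m. ball x (inverse (real (Suc m))))"
    by metis
  define B where "B = (\<Union>n. \<Union>m. (\<lambda>x. ball x (inverse (real (Suc m)))) ` k n m)"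
  have "countable B"
    unfolding B_def using k(1) by (intro countable_UN countable_image) (auto intro:
        countable_finite)
  moreover have "topological_basis B"
  proof (rule topological_basisI)
    fix U :: "'a set" and x :: 'a assume U: "open U" "x \<in> U"
    then obtain e where e: "0 < e" "ball x e \<subseteq> U"
      by (meson open_contains_ball)
    obtain m where m: "inverse (real (Suc m)) < e / 2"
      using reals_Archimedean[of "e / 2"] e by auto
    obtain n where "absv x \<le> real n"
      using real_arch_simple by blast
    then have "x \<in> cball 0 (real n)"
      by (simp add: absv_eq_dist dist_commute)
    then obtain y where y: "y \<in> k n m" "x \<in> ball y (inverse (real (Suc m)))"
      using k(2) by blast
    have "ball y (inverse (real (Suc m))) \<subseteq> U"
    proof
      fix z assume "z \<in> ball y (inverse (real (Suc m)))"
      then have "dist x z < e"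
        using m y dist_triangle[of x z y] by (simp add: dist_commute)
      then show "z \<in> U" using e by auto
    qed
    then show "\<exists>B'\<in>B. x \<in> B' \<and> B' \<subseteq> U"
      using y unfolding B_def by blast
  qed (auto simp: B_def)
  ultimately show "\<exists>B::'a set set. countable B \<and> open = generate_topology B"
    by (metis topological_basis_imp_subbasis)
qed


section \<open>The ring of integers, the uniformizer and the character\<close>

lemma integer_ring_iff: "x \<in> integer_ring \<longleftrightarrow> absv (x::'a::nonarch_local_field) \<le> 1"
  by (simp add: integer_ring_def)

lemma integer_ring_0 [simp]: "0 \<in> integer_ring"
  and integer_ring_1 [simp]: "1 \<in> integer_ring"
  by (simp_all add: integer_ring_iff)

lemma integer_ring_add [intro]: "x \<in> integer_ring \<Longrightarrow> y \<in> integer_ring \<Longrightarrow> x + y \<in> integer_ring"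
  using absv_ultrametric[of x y] by (simp add: integer_ring_iff)

lemma integer_ring_diff [intro]: "x \<in> integer_ring \<Longrightarrow> y \<in> integer_ring \<Longrightarrow> x - y \<in> integer_ring"
  using absv_diff_ultrametric[of x y] by (simp add: integer_ring_iff)

lemma integer_ring_mult [intro]: "x \<in> integer_ring \<Longrightarrow> y \<in> integer_ring \<Longrightarrow> x * y \<in> integer_ring"
  by (simp add: integer_ring_iff absv_mult mult_le_one)

lemma integer_ring_sum: "(\<And>i. i \<in> I \<Longrightarrow> f i \<in> integer_ring) \<Longrightarrow> sum f I \<in> integer_ring"
  by (simp add: integer_ring_iff absv_sum_le)

lemma closed_integer_ring: "closed (integer_ring :: 'a::nonarch_local_field set)"
proof -
  have "integer_ring = cball (0::'a) 1"
    by (auto simp: integer_ring_iff absv_eq_dist dist_commute)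
  then show ?thesis
    using closed_cball by (rule ssubst)
qed

lemma integer_ring_in_borel [measurable]: "(integer_ring :: 'a::nonarch_local_field set)
    \<in> sets borel"
  by (intro borel_closed closed_integer_ring)

lemma borel_measurable_mult_field [measurable (raw)]:
  fixes f g :: "'b \<Rightarrow> 'a::nonarch_local_field"
  assumes "f \<in> borel_measurable M" "g \<in> borel_measurable M"
  shows "(\<lambda>x. f x * g x) \<in> borel_measurable M"
  using assms by (rule borel_measurable_continuous_Pair) (intro continuous_intros)

text \<open>The last two assumptions say that the ring of integers is the largest ball around
  \<open>0\<close> on which \<open>\<psi>\<close> is trivial; this is what makes the uniform measure
  on it self-dual.\<close>

locale normalized_character =
  fixes \<pi> :: "'a::nonarch_local_field" and \<psi> :: "'a \<Rightarrow> complex"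
  assumes uniformizer: "uniformizer \<pi>"
    and absv_uniformizer: "absv \<pi> = inverse (real (residue_card \<pi>))"
    and character: "additive_character \<psi>"
    and character_trivial: "\<forall>x\<in>integer_ring. \<psi> x = 1"
    and character_nontrivial: "\<not> \<psi> constant_on ((\<lambda>x. inverse \<pi> * x) ` integer_ring)"
begin

abbreviation q :: nat where "q \<equiv> residue_card \<pi>"

lemma absv_uniformizer_less_1: "absv \<pi> < 1"
proof -
  have "\<pi> * 1 \<in> (\<lambda>y. \<pi> * y) ` integer_ring"
    by (rule imageI) simp
  then show ?thesis
    using uniformizer[unfolded uniformizer_def, symmetric] by simp
qed

lemma uniformizer_nonzero [simp]: "\<pi> \<noteq> 0"
proof -
  obtain x :: 'a where x: "x \<noteq> 0" "absv x < 1"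
    by (rule nontrivial_absv)
  then have "x \<in> (\<lambda>y. \<pi> * y) ` integer_ring"
    using uniformizer by (auto simp: uniformizer_def)
  then show ?thesis using x by auto
qed

text \<open>An infinite residue ring would have \<open>card\<close> equal to \<open>0\<close>, and
  then \<open>absv \<pi>\<close> would be \<open>0\<close>. The normalisation of the absolute value
  thus carries the finiteness of the residue ring.\<close>

lemma q_gt_1: "1 < q"
proof -
  have "0 < inverse (real q)" "inverse (real q) < 1"
    using absv_uniformizer_less_1 absv_pos_iff[of \<pi>]
        by (simp_all add: absv_uniformizer del: absv_pos_iff)
  then show ?thesis
    by (simp add: inverse_less_1_iff)
qed

lemma q_real_gt_1: "1 < real q"
  using q_gt_1 by simp

lemma absv_less_1_iff: "absv x < 1 \<longleftrightarrow> inverse \<pi> * x \<in> integer_ring"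
proof -
  have "absv x < 1 \<longleftrightarrow> x \<in> (\<lambda>y. \<pi> * y) ` integer_ring"
    using uniformizer by (auto simp: uniformizer_def)
  also have "\<dots> \<longleftrightarrow> inverse \<pi> * x \<in> integer_ring"
    by (auto intro!: image_eqI[of _ _ "inverse \<pi> * x"] simp flip: mult.assoc)
  finally show ?thesis .
qed

lemma absv_uniformizer_power_int: "absv (\<pi> powi k) = real q powi (- k)"
  by (simp add: absv_power_int absv_uniformizer power_int_minus power_int_inverse)

lemma uniformizer_power_int_in_integer_ring_iff: "\<pi> powi k \<in> integer_ring \<longleftrightarrow> 0 \<le> k"
proof -
  have "real q powi (- k) \<le> real q powi 0 \<longleftrightarrow> - k \<le> 0"
    using power_int_increasing[of "- k" 0 "real q"] power_int_strict_increasing[of 0 "- k" "real q"]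
      q_real_gt_1 by linarith
  then show ?thesis
    by (simp add: integer_ring_iff absv_uniformizer_power_int)
qed

text \<open>The absolute value is discrete: scaling by the power of \<open>\<pi>\<close> given by
  the integer part of the logarithm leaves \<open>u\<close> with absolute value at least 1 and below
  \<open>q\<close>, so \<open>absv (\<pi> * u) < 1\<close>, and this already forces \<open>u\<close>
  to be integral.\<close>

lemma uniformizer_decomposition:
  assumes "x \<noteq> 0"
  obtains k u where "absv u = 1" "x = u * \<pi> powi (- k)"
proof -
  define k where "k = \<lfloor>log (real q) (absv x)\<rfloor>"
  define u where "u = x * \<pi> powi k"
  have x: "absv x = real q powr log (real q) (absv x)"
    using q_real_gt_1 assms by simp
  have absu: "absv u = real q powr (log (real q) (absv x) - k)"
    using q_real_gt_1 by (simp add: u_def absv_mult absv_uniformizer_power_int powr_diff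
        powr_real_of_int'
        power_int_minus divide_inverse flip: x)
  have "real q powr 0 \<le> absv u"
    unfolding absu k_def using q_real_gt_1 by (intro powr_mono) auto
  moreover have "absv u < real q powr 1"
    unfolding absu k_def using q_real_gt_1 by (intro powr_less_mono) linarith+
  then have "absv (\<pi> * u) < 1"
    using q_real_gt_1 by (simp add: absv_mult absv_uniformizer divide_simps)
  then have "u \<in> integer_ring"
    unfolding absv_less_1_iff by (simp flip: mult.assoc)
  ultimately have "absv u = 1"
    using q_real_gt_1 by (simp add: integer_ring_iff)
  moreover have "x = u * \<pi> powi (- k)"
    by (simp add: u_def power_int_minus)
  ultimately show ?thesis by (rule that)
qed

lemma character_add: "\<psi> (x + y) = \<psi> x * \<psi> y"
  and norm_character [simp]: "norm (\<psi> x) = 1"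
  and continuous_character: "continuous_on UNIV \<psi>"
  using character by (auto simp: additive_character_def)

lemma character_0 [simp]: "\<psi> 0 = 1"
  using character_trivial by simp

lemma character_sum: "\<psi> (sum f I) = (\<Prod>i\<in>I. \<psi> (f i))"
  by (induction I rule: infinite_finite_induct) (simp_all add: character_add)

lemma character_measurable [measurable]: "\<psi> \<in> borel_measurable borel"
  by (intro borel_measurable_continuous_onI continuous_character)

text \<open>The hypotheses make \<open>t * \<pi>\<close> a unit, so dividing by it carries the
  nontriviality on \<open>inverse \<pi>\<close> times the integers over to \<open>t\<close> times
  the integers.\<close>

lemma character_mult_nontrivial:
  assumes "t * \<pi> \<in> integer_ring" "t \<notin> integer_ring"
  obtains x where "x \<in> integer_ring" "\<psi> (t * x) \<noteq> 1"
proof -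
  have "absv (t * \<pi>) = 1"
    using assms absv_less_1_iff[of "t * \<pi>"] by (auto simp: integer_ring_iff mult.left_commute)
  have "\<exists>x\<in>integer_ring. \<psi> (inverse \<pi> * x) \<noteq> 1"
    using character_nontrivial by (auto simp: constant_on_def)
  then obtain x where x: "x \<in> integer_ring" "\<psi> (inverse \<pi> * x) \<noteq> 1" by blast
  have "t \<noteq> 0" using assms by auto
  then have "t * (inverse (t * \<pi>) * x) = inverse \<pi> * x"
    by (simp add: field_simps)
  moreover have "inverse (t * \<pi>) * x \<in> integer_ring"
    using x(1) \<open>absv (t * \<pi>) = 1\<close> by (simp add: integer_ring_iff absv_mult absv_inverse del:
        mult_eq_0_iff inverse_mult_distrib)
  ultimately show ?thesis
    using x(2) by (metis that)
qed

lemma residue_representatives: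
  obtains R :: "'a set" where "finite R" "card R = q" "0 \<in> R" "R \<subseteq> integer_ring"
    "\<forall>x\<in>integer_ring. \<exists>!d. d \<in> R \<and> absv (x - d) < 1"
proof -
  define r where
    "r = {(x, y). x \<in> integer_ring \<and> y \<in> integer_ring \<and> x - y \<in> (\<lambda>z. \<pi> * z) ` integer_ring}"
  have r: "(x, y) \<in> r \<longleftrightarrow> x \<in> integer_ring \<and> y \<in> integer_ring \<and> absv (x - y) < 1" for x y
    using uniformizer by (auto simp: r_def uniformizer_def)
  have equiv: "equiv integer_ring r"
  proof (rule equivI)
    show "refl_on integer_ring r" "r \<subseteq> integer_ring \<times> integer_ring"
      by (auto simp: refl_on_def r)
    show "sym r"
      by (auto simp: sym_def r) (metis absv_minus minus_diff_eq)
    show "trans r"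
    proof (rule transI)
      fix x y z assume "(x, y) \<in> r" "(y, z) \<in> r"
      then show "(x, z) \<in> r"
        using absv_ultrametric[of "x - y" "y - z"] by (auto simp: r)
    qed
  qed
  \<comment> \<open>The class of \<open>0\<close> is represented by \<open>0\<close> itself, so that
    divisibility by \<open>\<pi>\<close> can be recognised from a vanishing digit.\<close>
  define rep where "rep C = (if 0 \<in> C then 0 else SOME x. x \<in> C)" for C :: "'a set"
  have rep: "rep C \<in> C" if "C \<in> integer_ring // r" for C
    using that in_quotient_imp_non_empty[OF equiv that] by (auto simp: rep_def some_in_eq)
  define R where "R = rep ` (integer_ring // r)"
  have inj: "inj_on rep (integer_ring // r)"
  proof (rule inj_onI)
    fix C D assume CD: "C \<in> integer_ring // r" "D \<in> integer_ring // r" "rep C = rep D"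
    then show "C = D"
      using quotient_disj[OF equiv CD(1,2)] rep[OF CD(1)] rep[OF CD(2)] by auto
  qed
  have card: "card R = q"
    unfolding R_def card_image[OF inj] by (simp add: residue_card_def r_def)
  have "finite R"
    using card q_gt_1 by (intro card_ge_0_finite) simp
  have "r `` {0} \<in> integer_ring // r" "0 \<in> r `` {0}"
    by (auto intro!: quotientI simp: r)
  then have "0 \<in> R"
    unfolding R_def by (intro image_eqI[of _ _ "r `` {0}"]) (auto simp: rep_def)
  have "R \<subseteq> integer_ring"
    unfolding R_def using rep in_quotient_imp_subset[OF equiv] by blast
  have "\<exists>!d. d \<in> R \<and> absv (x - d) < 1" if x: "x \<in> integer_ring" for x
  proof (rule ex1I)
    have C: "r `` {x} \<in> integer_ring // r"
      using x by (rule quotientI)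
    show "rep (r `` {x}) \<in> R \<and> absv (x - rep (r `` {x})) < 1"
      using rep[OF C] C by (auto simp: R_def r)
    fix d assume d: "d \<in> R \<and> absv (x - d) < 1"
    then obtain D where D: "D \<in> integer_ring // r" "d = rep D"
      by (auto simp: R_def)
    then have "d \<in> D" "d \<in> r `` {x}"
      using rep[OF D(1)] d x \<open>R \<subseteq> integer_ring\<close> by (auto simp: r)
    then show "d = rep (r `` {x})"
      using quotient_disj[OF equiv C D(1)] D(2) by auto
  qed
  then show ?thesis
    using that[OF \<open>finite R\<close> card \<open>0 \<in> R\<close> \<open>R \<subseteq> integer_ring\<close>] by blast
qed

end


section \<open>Integrals of characters\<close>

lemma (in prob_space) integrable_bounded:
  fixes f :: "'a \<Rightarrow> 'b::{banach, second_countable_topology}"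
  assumes "f \<in> borel_measurable M" "\<And>x. x \<in> space M \<Longrightarrow> norm (f x) \<le> B"
  shows "integrable M f"
  using assms by (intro integrable_const_bound[of _ B]) auto

text \<open>The integrands below are bounded functions on probability spaces, so the integrability
  conditions of Fubini's theorem are settled once here.\<close>

lemma
  fixes f :: "'a \<Rightarrow> 'b \<Rightarrow> 'c::{banach, second_countable_topology}"
  assumes M: "prob_space M" and N: "prob_space N"
    and f: "(\<lambda>(x, y). f x y) \<in> borel_measurable (M \<Otimes>\<^sub>M N)"
    and bound: "\<And>x y. x \<in> space M \<Longrightarrow> y \<in> space N \<Longrightarrow> norm (f x y) \<le> B"
  shows bounded_integral_fst: "(\<integral>x. (\<integral>y. f x y \<partial>N) \<partial>M) = (\<integral>z. f (fst z) (snd z) \<partial>(M \<Otimes>\<^sub>M N))"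
    and bounded_Fubini: "(\<integral>x. (\<integral>y. f x y \<partial>N) \<partial>M) = (\<integral>y. (\<integral>x. f x y \<partial>M) \<partial>N)"
    and bounded_integral_measurable: "(\<lambda>x. \<integral>y. f x y \<partial>N) \<in> borel_measurable M"
proof -
  interpret pair_sigma_finite M N
    using M N by (simp add: pair_sigma_finite_def prob_space_imp_sigma_finite)
  interpret P: prob_space "M \<Otimes>\<^sub>M N"
    by (rule prob_space_pair[OF M N])
  have int: "integrable (M \<Otimes>\<^sub>M N) (\<lambda>(x, y). f x y)"
    using f by (rule P.integrable_bounded[where B = B]) (auto simp: space_pair_measure bound)
  show "(\<integral>x. (\<integral>y. f x y \<partial>N) \<partial>M) = (\<integral>z. f (fst z) (snd z) \<partial>(M \<Otimes>\<^sub>M N))"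
    using integral_fst[OF int] by (simp add: case_prod_unfold)
  show "(\<integral>x. (\<integral>y. f x y \<partial>N) \<partial>M) = (\<integral>y. (\<integral>x. f x y \<partial>M) \<partial>N)"
    using integral_fst[OF int] integral_snd[OF int] by (simp add: case_prod_unfold)
  show "(\<lambda>x. \<integral>y. f x y \<partial>N) \<in> borel_measurable M"
    by (rule M2.borel_measurable_lebesgue_integral[OF f])
qed

lemma (in prob_space) norm_integral_le:
  fixes f :: "'a \<Rightarrow> 'b::{banach, second_countable_topology}"
  assumes "\<And>x. x \<in> space M \<Longrightarrow> norm (f x) \<le> B" "0 \<le> B"
  shows "norm (\<integral>x. f x \<partial>M) \<le> B"
proof (cases "integrable M f")
  case True
  have "norm (\<integral>x. f x \<partial>M) \<le> (\<integral>x. norm (f x) \<partial>M)"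
    by (rule integral_norm_bound)
  also have "\<dots> \<le> (\<integral>x. B \<partial>M)"
    using True assms by (intro integral_mono) auto
  finally show ?thesis
    by (simp add: prob_space)
qed (simp add: assms(2) not_integrable_integral_eq)

text \<open>Only finitely many coordinates occur, so the measure may be projected to
  \<open>PiM J\<close>, where the integral of a finite product factors.\<close>

lemma integral_PiM_prod:
  fixes f :: "'i \<Rightarrow> 'a \<Rightarrow> complex"
  assumes N: "prob_space N" and "finite J"
    and f: "\<And>j. j \<in> J \<Longrightarrow> f j \<in> borel_measurable N"
    and bound: "\<And>j x. j \<in> J \<Longrightarrow> x \<in> space N \<Longrightarrow> norm (f j x) \<le> B"
  shows "(\<integral>\<omega>. (\<Prod>j\<in>J. f j (\<omega> j)) \<partial>PiM UNIV (\<lambda>_. N)) = (\<Prod>j\<in>J. \<integral>x. f j x \<partial>N)"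
proof -
  interpret N: prob_space N by (rule N)
  interpret product_prob_space "\<lambda>_. N" UNIV ..
  have [measurable]: "(\<lambda>\<omega>. \<Prod>j\<in>J. f j (\<omega> j)) \<in> borel_measurable (PiM J (\<lambda>_. N))"
    using f by (intro borel_measurable_prod) (auto intro: measurable_compose[OF
        measurable_component_singleton])
  have "(\<integral>\<omega>. (\<Prod>j\<in>J. f j (\<omega> j)) \<partial>PiM J (\<lambda>_. N))
      = (\<integral>\<omega>. (\<Prod>j\<in>J. f j (\<omega> j)) \<partial>distr (PiM UNIV (\<lambda>_. N)) (PiM J (\<lambda>_. N)) (\<lambda>\<omega>. restrict \<omega> J))"
    using distr_PiM_restrict_finite[OF \<open>finite J\<close>] by simp
  also have "\<dots> = (\<integral>\<omega>. (\<Prod>j\<in>J. f j (\<omega> j)) \<partial>PiM UNIV (\<lambda>_. N))"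
    by (subst integral_distr) (auto intro!: Bochner_Integration.integral_cong prod.cong)
  finally have "(\<integral>\<omega>. (\<Prod>j\<in>J. f j (\<omega> j)) \<partial>PiM UNIV (\<lambda>_. N)) = (\<integral>\<omega>. (\<Prod>j\<in>J. f j (\<omega> j)) \<partial>PiM J (\<lambda>_. N))"
    by simp
  also have "\<dots> = (\<Prod>j\<in>J. \<integral>x. f j x \<partial>N)"
    using \<open>finite J\<close> N.integrable_bounded[OF f bound] by (intro product_integral_prod) auto
  finally show ?thesis .
qed

text \<open>By the ultrametric inequality a block of terms is no larger than its largest term, so
  late blocks are small however long they are; completeness comes from the Heine-Borel
  property.\<close>

lemma summable_of_tendsto_0:
  fixes a :: "nat \<Rightarrow> 'a::nonarch_local_field"
  assumes "a \<longlonglongrightarrow> 0"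
  shows "summable a"
proof -
  have "Cauchy (\<lambda>n. sum a {..<n})"
  proof (rule metric_CauchyI)
    fix e :: real assume e: "0 < e"
    then obtain K where K: "\<And>i. K \<le> i \<Longrightarrow> absv (a i) < e / 2"
      using assms half_gt_zero[OF e] unfolding LIMSEQ_def absv_eq_dist by meson
    have aux: "dist (sum a {..<n}) (sum a {..<m}) < e" if "K \<le> m" "m \<le> n" for m n
    proof -
      have "{..<n} = {..<m} \<union> {m..<n}"
        using that by auto
      then have "sum a {..<n} = sum a {..<m} + sum a {m..<n}"
        by (simp add: sum.union_disjoint ivl_disj_int)
      moreover have "absv (sum a {m..<n}) \<le> e / 2"
        using K that e by (intro absv_sum_le) (auto intro: less_imp_le)
      ultimately show ?thesis
        using e by (simp add: dist_absv)
    qed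
    show "\<exists>K. \<forall>m\<ge>K. \<forall>n\<ge>K. dist (sum a {..<m}) (sum a {..<n}) < e"
      by (intro exI[of _ K]) (metis aux dist_commute linear)
  qed
  then show ?thesis
    by (simp add: summable_iff_convergent Cauchy_convergent_iff)
qed

context normalized_character
begin

text \<open>Translation by \<open>x\<close> permutes the residue classes, and because
  \<open>t * \<pi>\<close> is integral, \<open>\<psi> (t * d)\<close> depends only on the class of
  the integral element \<open>d\<close>. The sum therefore equals itself times
  \<open>\<psi> (t * x)\<close>, which differs from 1.\<close>

lemma character_sum_eq_0:
  assumes R: "finite R" "R \<subseteq> integer_ring"
    "\<And>x. x \<in> integer_ring \<Longrightarrow> \<exists>!d. d \<in> R \<and> absv (x - d) < 1"
    and t: "t * \<pi> \<in> integer_ring" "t \<notin> integer_ring"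
  shows "(\<Sum>d\<in>R. \<psi> (t * d)) = 0"
proof -
  obtain x where x: "x \<in> integer_ring" "\<psi> (t * x) \<noteq> 1"
    using t by (rule character_mult_nontrivial)
  define s where "s d = (THE d'. d' \<in> R \<and> absv (d + x - d') < 1)" for d
  have s: "s d \<in> R" "absv (d + x - s d) < 1" if "d \<in> R" for d
    using theI'[OF R(3)[of "d + x"]] x that R(2) unfolding s_def by auto
  have "inj_on s R"
  proof (rule inj_onI)
    fix d e assume de: "d \<in> R" "e \<in> R" "s d = s e"
    then have "absv ((d + x - s d) - (e + x - s e)) < 1"
      using s[OF de(1)] s[OF de(2)] by (intro le_less_trans[OF absv_diff_ultrametric]) simp
    then have "absv (d - e) < 1" using de(3) by simp
    then show "d = e"
      using R(3)[of d] R(2) de by (metis absv_0 diff_self less_numeral_extra(1) subsetD)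
  qed
  then have bij: "bij_betw s R R"
    using s(1) R(1) by (simp add: bij_betw_def endo_inj_surj image_subset_iff)
  have "\<psi> (t * s d) = \<psi> (t * x) * \<psi> (t * d)" if "d \<in> R" for d
  proof -
    have "t * (d + x - s d) = (t * \<pi>) * (inverse \<pi> * (d + x - s d))"
      by simp
    then have "\<psi> (t * (d + x - s d)) = 1"
      using s(2)[OF that] t(1) character_trivial unfolding absv_less_1_iff
      by (metis integer_ring_mult)
    moreover have "t * x + t * d = t * (d + x - s d) + t * s d"
      by (simp add: algebra_simps)
    ultimately show ?thesis
      by (metis character_add mult_1)
  qed
  then have "(\<Sum>d\<in>R. \<psi> (t * d)) = \<psi> (t * x) * (\<Sum>d\<in>R. \<psi> (t * d))"
    by (subst sum.reindex_bij_betw[OF bij, symmetric]) (simp add: sum_distrib_left)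
  then show ?thesis
    using x(2) by (simp add: mult_cancel_right2)
qed

text \<open>Haar probability measure on the integers, built as the law of
  \<open>\<Sum>i. \<pi> ^ i * \<omega> i\<close> with independent uniform digits
  \<open>\<omega> i\<close> from a set of residue representatives. Its Fourier transform and the
  probabilities of divisibility by powers of \<open>\<pi>\<close> are what the later arguments draw
  on.\<close>

lemma haar_exists:
  "\<exists>L. prob_space L \<and> sets L = sets borel \<and> (AE x in L. x \<in> integer_ring) \<and>
    (\<forall>t. (\<integral>x. \<psi> (t * x) \<partial>L) = (if t \<in> integer_ring then 1 else 0)) \<and>
    (\<forall>k. measure L {x. inverse \<pi> ^ k * x \<in> integer_ring} = inverse (real q ^ k))"
proof -
  obtain R :: "'a set" where R: "finite R" "card R = q" "0 \<in> R" "R \<subseteq> integer_ring"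
    and "\<forall>x\<in>integer_ring. \<exists>!d. d \<in> R \<and> absv (x - d) < 1"
    by (rule residue_representatives)
  then have R': "\<And>x. x \<in> integer_ring \<Longrightarrow> \<exists>!d. d \<in> R \<and> absv (x - d) < 1"
    by blast
  define D where "D = uniform_count_measure R"
  interpret D: prob_space D
    unfolding D_def using R by (intro prob_space_uniform_count_measure) auto
  interpret sequence_space D ..
  have space_D: "space D = R" and sets_D: "sets D = Pow R"
    by (simp_all add: D_def space_uniform_count_measure sets_uniform_count_measure)
  have id_D: "(\<lambda>x. x) \<in> borel_measurable D"
    by (simp add: measurable_def space_D sets_D)
  have int_D: "(\<integral>x. f x \<partial>D) = (\<Sum>d\<in>R. f d) / complex_of_real q" for f :: "'a \<Rightarrow> complex"
    unfolding D_def uniform_count_measure_def using R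
    by (subst lebesgue_integral_point_measure_finite) (auto simp: scaleR_conv_of_real
        sum_divide_distrib)
  define X where "X \<omega> = (\<Sum>i. \<pi> ^ i * \<omega> i)" for \<omega>
  have sums: "(\<lambda>i. \<pi> ^ i * \<omega> i) sums X \<omega>" if "\<And>i. \<omega> i \<in> R" for \<omega>
  proof -
    have "(\<lambda>i. absv \<pi> ^ i) \<longlonglongrightarrow> 0"
      using absv_uniformizer_less_1 by (intro LIMSEQ_power_zero) simp
    moreover have "absv (\<pi> ^ i * \<omega> i) \<le> absv \<pi> ^ i" for i
      using that R(4) by (auto simp: absv_mult absv_power integer_ring_iff mult_left_le subset_iff)
    ultimately have "(\<lambda>i. absv (\<pi> ^ i * \<omega> i)) \<longlonglongrightarrow> 0"
      using tendsto_sandwich[of "\<lambda>_. 0" "\<lambda>i. absv (\<pi> ^ i * \<omega> i)" sequentially "\<lambda>i. absv \<pi> ^ i" 0]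
          by simp
    then have "(\<lambda>i. \<pi> ^ i * \<omega> i) \<longlonglongrightarrow> 0"
      unfolding absv_eq_dist by (rule tendsto_dist_iff[THEN iffD2])
    then show ?thesis
      unfolding X_def by (intro summable_sums summable_of_tendsto_0)
  qed
  have space_S: "\<omega> \<in> space S \<Longrightarrow> \<omega> i \<in> R" for \<omega> i
    by (auto simp: space_PiM space_D)
  have digit: "(\<lambda>\<omega>. \<omega> i) \<in> borel_measurable S" for i
    using measurable_compose[OF measurable_component_singleton[of i UNIV "\<lambda>_. D"] id_D] by simp
  have fst: "(\<lambda>z. fst z) \<in> borel_measurable (D \<Otimes>\<^sub>M S)"
    by (rule measurable_compose[OF measurable_fst id_D])
  have [measurable]: "X \<in> borel_measurable S"
  proof (rule borel_measurable_LIMSEQ_metric)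
    show "(\<lambda>n. \<Sum>i<n. \<pi> ^ i * \<omega> i) \<longlonglongrightarrow> X \<omega>" if "\<omega> \<in> space S" for \<omega>
      using sums[of \<omega>] space_S[OF that] by (simp add: sums_def)
    note digit[measurable]
    show "(\<lambda>\<omega>. \<Sum>i<n. \<pi> ^ i * \<omega> i) \<in> borel_measurable S" for n
      by measurable
  qed
  have X_in: "X \<omega> \<in> integer_ring" if "\<omega> \<in> space S" for \<omega>
  proof -
    have "(\<Sum>i<n. \<pi> ^ i * \<omega> i) \<in> integer_ring" for n
      using space_S[OF that] R(4) absv_uniformizer_less_1
      by (intro integer_ring_sum integer_ring_mult) (auto simp: integer_ring_iff absv_power
          subset_iff intro: power_le_one)
    then show ?thesis
      using closed_sequentially[OF closed_integer_ring, of "\<lambda>n. \<Sum>i<n. \<pi> ^ i * \<omega> i"]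
        sums[of \<omega>] space_S[OF that] by (simp add: sums_def)
  qed
  have X_case: "X (case_nat d \<omega>) = d + \<pi> * X \<omega>" if "d \<in> R" "\<omega> \<in> space S" for d \<omega>
  proof -
    have "(\<lambda>n. \<Sum>i<Suc n. \<pi> ^ i * case_nat d \<omega> i) \<longlonglongrightarrow> X (case_nat d \<omega>)"
      using sums[of "case_nat d \<omega>"] space_S[OF that(2)] that(1)
      by (intro LIMSEQ_Suc) (auto simp: sums_def split: nat.split)
    moreover have "(\<Sum>i<Suc n. \<pi> ^ i * case_nat d \<omega> i) = d + \<pi> * (\<Sum>i<n. \<pi> ^ i * \<omega> i)" for n
      by (subst sum.lessThan_Suc_shift) (simp add: sum_distrib_left mult.assoc)
    moreover have "(\<lambda>n. d + \<pi> * (\<Sum>i<n. \<pi> ^ i * \<omega> i)) \<longlonglongrightarrow> d + \<pi> * X \<omega>"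
      using sums[of \<omega>] space_S[OF that(2)] unfolding sums_def by (intro tendsto_intros) auto
    ultimately show ?thesis
      by (simp add: LIMSEQ_unique)
  qed
  define L where "L = distr S borel X"
  interpret L: prob_space L
    unfolding L_def by (intro prob_space_distr) measurable
  have sets_L [measurable_cong]: "sets L = sets borel" by (simp add: L_def)
  \<comment> \<open>Self-similarity: the first digit is independent of the others, and removing it
    leaves \<open>\<pi>\<close> times a copy of \<open>X\<close>.\<close>
  have L_int: "(\<integral>x. f x \<partial>L) = (\<integral>d. (\<integral>x. f (d + \<pi> * x) \<partial>L) \<partial>D)"
    if [measurable]: "f \<in> borel_measurable borel" and "\<And>x. norm (f x) \<le> 1" for f :: "'a \<Rightarrow> complex"
  proof -
    have "(\<integral>x. f x \<partial>L) = (\<integral>\<omega>. f (X \<omega>) \<partial>distr (D \<Otimes>\<^sub>M S) S (\<lambda>(s, \<omega>). case_nat s \<omega>))"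
      unfolding PiM_iter by (simp add: L_def integral_distr)
    also have "\<dots> = (\<integral>z. f (X (case_nat (fst z) (snd z))) \<partial>(D \<Otimes>\<^sub>M S))"
      by (subst integral_distr) (auto simp: case_prod_unfold)
    also have "\<dots> = (\<integral>z. f (fst z + \<pi> * X (snd z)) \<partial>(D \<Otimes>\<^sub>M S))"
      by (intro Bochner_Integration.integral_cong refl) (auto simp: space_pair_measure X_case
          space_D)
    also have "\<dots> = (\<integral>d. (\<integral>\<omega>. f (d + \<pi> * X \<omega>) \<partial>S) \<partial>D)"
      using that fst by (intro bounded_integral_fst[symmetric, where B=1] D.prob_space_axioms
          P.prob_space_axioms) auto
    also have "\<dots> = (\<integral>d. (\<integral>x. f (d + \<pi> * x) \<partial>L) \<partial>D)"
      by (simp add: L_def integral_distr)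
    finally show ?thesis .
  qed
  have L_O: "AE x in L. x \<in> integer_ring"
    unfolding L_def by (subst AE_distr_iff) (auto intro!: AE_I2 X_in)
  have trivial: "(\<integral>x. \<psi> (t * x) \<partial>L) = 1" if "t \<in> integer_ring" for t
  proof -
    have "(\<integral>x. \<psi> (t * x) \<partial>L) = (\<integral>x. 1 \<partial>L)"
    proof (rule integral_cong_AE)
      show "AE x in L. \<psi> (t * x) = 1"
        using L_O by eventually_elim (simp add: character_trivial integer_ring_mult that)
    qed measurable
    then show ?thesis by (simp add: L.prob_space)
  qed
  have step: "(\<integral>x. \<psi> (t * x) \<partial>L) = (\<Sum>d\<in>R. \<psi> (t * d)) / q * (\<integral>x. \<psi> ((t * \<pi>) * x) \<partial>L)" for t
    by (subst L_int) (simp_all add: distrib_left character_add int_D mult.assoc)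
  \<comment> \<open>Each digit replaces \<open>t\<close> by \<open>t * \<pi>\<close>; the last step
    before integrality is reached contributes a vanishing character sum.\<close>
  have nontrivial: "(\<integral>x. \<psi> (t * x) \<partial>L) = 0" if "t * \<pi> ^ n \<in> integer_ring" "t \<notin> integer_ring" for t n
    using that
  proof (induction n arbitrary: t)
    case (Suc n)
    show ?case
    proof (cases "t * \<pi> \<in> integer_ring")
      case True
      then show ?thesis
        using step[of t] character_sum_eq_0[OF R(1,4) R' True Suc.prems(2)] by simp
    next
      case False
      then show ?thesis
        using step[of t] Suc.IH[of "t * \<pi>"] Suc.prems(1) by (simp add: mult.assoc)
    qed
  qed simp
  have int_char: "(\<integral>x. \<psi> (t * x) \<partial>L) = (if t \<in> integer_ring then 1 else 0)" for t
  proof -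
    obtain n where n: "absv \<pi> ^ n < inverse (1 + absv t)"
      using real_arch_pow_inv[of "inverse (1 + absv t)" "absv \<pi>"] absv_uniformizer_less_1
      by (auto simp: add_pos_nonneg)
    have "absv t * absv \<pi> ^ n \<le> (1 + absv t) * inverse (1 + absv t)"
      using n by (intro mult_mono) auto
    then have "t * \<pi> ^ n \<in> integer_ring"
      by (simp add: integer_ring_iff absv_mult absv_power add_pos_nonneg
          order.strict_implies_not_eq[symmetric])
    then show ?thesis
      using trivial nontrivial by auto
  qed
  \<comment> \<open>Divisibility by \<open>\<pi> ^ Suc k\<close> forces the first digit to be
    \<open>0\<close>, which has probability \<open>1 / q\<close>, and leaves divisibility of the
    remaining series by \<open>\<pi> ^ k\<close>.\<close>
  have meas: "measure L {x. inverse \<pi> ^ k * x \<in> integer_ring} = inverse (real q ^ k)" for k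
  proof (induction k)
    case 0
    then show ?case
      using L_O by (simp add: L.prob_eq_1 sets_L)
  next
    case (Suc k)
    define g where "g k x = (if inverse \<pi> ^ k * x \<in> integer_ring then 1 else 0 :: complex)" for k x
    have g_measurable [measurable]: "g k \<in> borel_measurable borel" for k
      unfolding g_def by measurable
    have measure_g:
      "(\<integral>x. g k x \<partial>L) = complex_of_real (measure L {x. inverse \<pi> ^ k * x \<in> integer_ring})" for k
    proof -
      have "(\<integral>x. g k x \<partial>L)
          = (\<integral>x. complex_of_real (indicator {x. inverse \<pi> ^ k * x \<in> integer_ring} x) \<partial>L)"
        by (intro Bochner_Integration.integral_cong) (auto simp: g_def)
      also have "\<dots> = complex_of_real (measure L {x. inverse \<pi> ^ k * x \<in> integer_ring})"
        by (simp add: L.emeasure_eq_measure sets_L)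
      finally show ?thesis .
    qed
    have key: "g (Suc k) (d + \<pi> * x) = (if d = 0 then g k x else 0)"
      if "d \<in> R" "x \<in> integer_ring" for d x
    proof (cases "d = 0")
      case True
      have "inverse \<pi> ^ Suc k * (\<pi> * x) = inverse \<pi> ^ k * x"
        by (simp add: field_simps)
      then show ?thesis
        unfolding True g_def by (simp only: add_0_left if_True simp_thms)
    next
      case False
      have "inverse \<pi> ^ Suc k * (d + \<pi> * x) \<notin> integer_ring"
      proof
        assume A: "inverse \<pi> ^ Suc k * (d + \<pi> * x) \<in> integer_ring"
        have "\<pi> ^ k \<in> integer_ring"
          using absv_uniformizer_less_1 by (simp add: integer_ring_iff absv_power power_le_one)
        then have "\<pi> ^ k * (inverse \<pi> ^ Suc k * (d + \<pi> * x)) \<in> integer_ring"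
          using A by (rule integer_ring_mult)
        moreover have "\<pi> ^ k * (inverse \<pi> ^ Suc k * (d + \<pi> * x)) = inverse \<pi> * d + x"
          by (simp add: field_simps)
        ultimately have "inverse \<pi> * d + x - x \<in> integer_ring"
          using \<open>x \<in> integer_ring\<close> by (metis integer_ring_diff)
        then have "absv (0 - d) < 1"
          by (simp add: absv_less_1_iff)
        then show False
          using R'[of 0] R(3) \<open>d \<in> R\<close> False by (metis absv_0 diff_self integer_ring_0 zero_less_one)
      qed
      then show ?thesis
        using False by (simp add: g_def)
    qed
    have "(\<integral>x. g (Suc k) x \<partial>L) = (\<integral>d. (\<integral>x. g (Suc k) (d + \<pi> * x) \<partial>L) \<partial>D)"
      by (rule L_int) (auto simp: g_def[of "Suc k"])
    also have "\<dots> = (\<integral>d. (if d = 0 then (\<integral>x. g k x \<partial>L) else 0) \<partial>D)"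
    proof (rule Bochner_Integration.integral_cong[OF refl])
      fix d assume d: "d \<in> space D"
      have "(\<integral>x. g (Suc k) (d + \<pi> * x) \<partial>L) = (\<integral>x. (if d = 0 then g k x else 0) \<partial>L)"
      proof (rule integral_cong_AE)
        show "AE x in L. g (Suc k) (d + \<pi> * x) = (if d = 0 then g k x else 0)"
          using L_O by eventually_elim (use d in \<open>simp add: key space_D\<close>)
      qed measurable
      then show "(\<integral>x. g (Suc k) (d + \<pi> * x) \<partial>L) = (if d = 0 then (\<integral>x. g k x \<partial>L) else 0)"
        by simp
    qed
    also have "\<dots> = (\<integral>x. g k x \<partial>L) / q"
      using R by (simp add: int_D)
    finally have "complex_of_real (measure L {x. inverse \<pi> ^ Suc k * x \<in> integer_ring})
        = complex_of_real (inverse (real q ^ Suc k))"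
      unfolding measure_g Suc by (simp add: field_simps)
    then show ?case
      unfolding of_real_eq_iff .
  qed
  show ?thesis
    using L.prob_space_axioms sets_L L_O int_char meas by blast
qed

end


section \<open>Matrices over the ring of integers\<close>

lemma mat_prod_eq_sum:
  assumes "\<And>k. n \<le> k \<Longrightarrow> A i k * B k j = 0"
  shows "(A \<odot> B) i j = (\<Sum>k<n. A i k * B k j)"
  unfolding mat_prod_def using assms
  by (intro sum.mono_neutral_left) (auto simp: not_less[symmetric])

lemma mat_one_simps [simp]: "mat_one i i = 1" "i \<noteq> j \<Longrightarrow> mat_one i j = 0"
  by (simp_all add: mat_one_def)

lemma int_blockD:
  assumes "g \<in> int_block n"
  shows "g i j \<in> integer_ring" "n \<le> i \<Longrightarrow> g i j = mat_one i j" "n \<le> j \<Longrightarrow> g i j = mat_one i j"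
  using assms by (auto simp: int_block_def)

text \<open>The second factor is arbitrary: a block reduces the product to a finite sum whatever the
  support of \<open>M\<close>. Most later computations with \<open>\<odot>\<close> go through this
  formula and its mirror image.\<close>

lemma int_block_mult_left:
  assumes g: "g \<in> int_block n"
  shows "(g \<odot> M) i j = (if i < n then \<Sum>k<n. g i k * M k j else M i j)"
proof (cases "i < n")
  case True
  then show ?thesis
    using int_blockD(3)[OF g] by (simp add: mat_prod_eq_sum[of n])
next
  case False
  then have "(g \<odot> M) i j = (\<Sum>k<Suc i. mat_one i k * M k j)"
    using int_blockD(2)[OF g] by (simp add: mat_prod_eq_sum[of "Suc i"])
  also have "\<dots> = (\<Sum>k<Suc i. if k = i then M i j else 0)"
    by (intro sum.cong) (auto simp: mat_one_def)
  finally show ?thesis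
    using False by simp
qed

text \<open>Transposition serves to derive facts about right multiplication and column operations
  from their left-handed versions.\<close>

definition mat_transpose :: "'a inf_mat \<Rightarrow> 'a inf_mat"
  where "mat_transpose A = (\<lambda>i j. A j i)"

lemma mat_transpose_apply [simp]: "mat_transpose A i j = A j i"
  by (simp add: mat_transpose_def)

lemma mat_transpose_transpose [simp]: "mat_transpose (mat_transpose A) = A"
  by (simp add: mat_transpose_def)

lemma mat_transpose_mult: "mat_transpose (A \<odot> B) = mat_transpose B \<odot> mat_transpose A"
  by (simp add: mat_transpose_def mat_prod_def mult.commute)

lemma mat_transpose_one [simp]: "mat_transpose mat_one = mat_one"
  by (auto simp: mat_transpose_def mat_one_def fun_eq_iff)

lemma int_block_transpose: "g \<in> int_block n \<Longrightarrow> mat_transpose g \<in> int_block n"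
  by (auto simp: int_block_def mat_one_def)

lemma int_block_mult_right:
  assumes g: "g \<in> int_block n"
  shows "(M \<odot> g) i j = (if j < n then \<Sum>k<n. M i k * g k j else M i j)"
proof -
  have "(M \<odot> g) i j = (mat_transpose g \<odot> mat_transpose M) j i"
    by (simp flip: mat_transpose_mult)
  then show ?thesis
    by (simp add: int_block_mult_left[OF int_block_transpose[OF g]] mult.commute)
qed

lemma mat_one_mult [simp]:
  fixes M :: "'a::nonarch_local_field inf_mat"
  shows "mat_one \<odot> M = M" "M \<odot> mat_one = M"
proof -
  have one: "(mat_one :: 'a inf_mat) \<in> int_block 0"
    by (auto simp: int_block_def mat_one_def)
  show "mat_one \<odot> M = M" "M \<odot> mat_one = M"
    by (simp_all add: fun_eq_iff int_block_mult_left[OF one] int_block_mult_right[OF one])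
qed

lemma int_block_mono: "m \<le> n \<Longrightarrow> int_block m \<subseteq> int_block n"
  by (auto simp: int_block_def mat_one_def)

lemma int_block_mult:
  assumes "g \<in> int_block n" "h \<in> int_block n"
  shows "g \<odot> h \<in> int_block n"
  using int_blockD[OF assms(1)] int_blockD[OF assms(2)]
  by (auto simp: int_block_def int_block_mult_left[OF assms(1)] mat_one_def
      intro!: integer_ring_sum integer_ring_mult sum.neutral)

text \<open>On arbitrary infinite matrices \<open>\<odot>\<close> is not associative. It is
  associative when two of the factors are blocks, because then only finite sums are interchanged;
  the three positions of the remaining factor are treated separately.\<close>

lemma int_block_assoc_left:
  assumes "g \<in> int_block n" "h \<in> int_block n"
  shows "(g \<odot> h) \<odot> M = g \<odot> (h \<odot> M)"
proof (intro ext)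
  fix i j
  have "(\<Sum>k<n. (\<Sum>l<n. g i l * h l k) * M k j) = (\<Sum>k<n. g i k * (\<Sum>l<n. h k l * M l j))"
    by (simp add: sum_distrib_left sum_distrib_right mult.assoc) (rule sum.swap)
  then show "((g \<odot> h) \<odot> M) i j = (g \<odot> (h \<odot> M)) i j"
    by (simp add: int_block_mult_left[OF int_block_mult[OF assms]] int_block_mult_left[OF assms(1)]
        int_block_mult_left[OF assms(2)])
qed

lemma int_block_assoc_right:
  assumes "g \<in> int_block n" "h \<in> int_block n"
  shows "M \<odot> (g \<odot> h) = (M \<odot> g) \<odot> h"
proof -
  have "mat_transpose (M \<odot> (g \<odot> h)) = mat_transpose ((M \<odot> g) \<odot> h)"
    by (simp add: mat_transpose_mult int_block_assoc_left[OF int_block_transpose[OF assms(2)]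
        int_block_transpose[OF assms(1)]])
  then show ?thesis
    by (metis mat_transpose_transpose)
qed

lemma int_block_assoc_middle:
  assumes "g \<in> int_block n" "h \<in> int_block n"
  shows "(g \<odot> M) \<odot> h = g \<odot> (M \<odot> h)"
proof (intro ext)
  fix i j
  have "(\<Sum>k<n. (\<Sum>l<n. g i l * M l k) * h k j) = (\<Sum>k<n. g i k * (\<Sum>l<n. M k l * h l j))"
    by (simp add: sum_distrib_left sum_distrib_right mult.assoc) (rule sum.swap)
  then show "((g \<odot> M) \<odot> h) i j = (g \<odot> (M \<odot> h)) i j"
    by (simp add: int_block_mult_left[OF assms(1)] int_block_mult_right[OF assms(2)])
qed

lemma GL_fin_int_block: "g \<in> GL_fin n \<Longrightarrow> g \<in> int_block n"
  by (simp add: GL_fin_def)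

lemma GL_fin_inverse:
  assumes "g \<in> GL_fin n"
  obtains h where "h \<in> GL_fin n" "g \<odot> h = mat_one" "h \<odot> g = mat_one"
  using assms by (auto simp: GL_fin_def)

lemma GL_fin_mono: "m \<le> n \<Longrightarrow> GL_fin m \<subseteq> GL_fin n"
  using int_block_mono[of m n] by (auto simp: GL_fin_def)

lemma GL_inverse_eq:
  assumes "g \<in> GL_fin n" "h \<in> GL_fin n" "g \<odot> h = mat_one" "h \<odot> g = mat_one"
  shows "GL_inverse g = h"
  unfolding GL_inverse_def
proof (rule the_equality)
  show "h \<in> GL_inf \<and> g \<odot> h = mat_one \<and> h \<odot> g = mat_one"
    using assms by (auto simp: GL_inf_def)
  fix h' assume h': "h' \<in> GL_inf \<and> g \<odot> h' = mat_one \<and> h' \<odot> g = mat_one"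
  then obtain m where "h' \<in> GL_fin m"
    by (auto simp: GL_inf_def)
  then have "h' \<in> int_block (max m n)" "g \<in> int_block (max m n)" "h \<in> int_block (max m n)"
    using GL_fin_mono[of m "max m n"] GL_fin_mono[of n "max m n"] assms(1,2)
        by (auto intro: GL_fin_int_block)
  then have "h' \<odot> (g \<odot> h) = (h' \<odot> g) \<odot> h"
    by (simp add: int_block_assoc_left)
  then show "h' = h"
    using h' assms(3) by simp
qed

lemma GL_inverse_GL_fin:
  assumes "g \<in> GL_fin n"
  shows "GL_inverse g \<in> GL_fin n" "g \<odot> GL_inverse g = mat_one" "GL_inverse g \<odot> g = mat_one"
  using GL_fin_inverse[OF assms] GL_inverse_eq[OF assms] by metis+

lemma GL_fin_mult:
  assumes "g \<in> GL_fin n" "h \<in> GL_fin n"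
  shows "g \<odot> h \<in> GL_fin n"
proof -
  obtain g' h' where inv: "g' \<in> GL_fin n" "g \<odot> g' = mat_one" "g' \<odot> g = mat_one"
    "h' \<in> GL_fin n" "h \<odot> h' = mat_one" "h' \<odot> h = mat_one"
    using assms by (metis GL_fin_inverse)
  note blocks = this(1,4)[THEN GL_fin_int_block] assms[THEN GL_fin_int_block]
  have "(g \<odot> h) \<odot> (h' \<odot> g') = g \<odot> ((h \<odot> h') \<odot> g')"
    by (simp only: int_block_assoc_left[OF blocks(3,4)] int_block_assoc_left[OF blocks(4,2)])
  moreover have "(h' \<odot> g') \<odot> (g \<odot> h) = h' \<odot> ((g' \<odot> g) \<odot> h)"
    by (simp only: int_block_assoc_left[OF blocks(2,1)] int_block_assoc_left[OF blocks(1,3)])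
  ultimately show ?thesis
    using inv by (auto simp: GL_fin_def int_block_mult blocks)
qed

lemma GL_fin_transpose:
  assumes "g \<in> GL_fin n"
  shows "mat_transpose g \<in> GL_fin n"
proof -
  obtain h where h: "h \<in> GL_fin n" "g \<odot> h = mat_one" "h \<odot> g = mat_one"
    by (rule GL_fin_inverse[OF assms])
  then have "mat_transpose g \<odot> mat_transpose h = mat_one"
      "mat_transpose h \<odot> mat_transpose g = mat_one"
    by (simp_all flip: mat_transpose_mult)
  then show ?thesis
    using int_block_transpose GL_fin_int_block assms h(1) by (auto simp: GL_fin_def)
qed

lemma mat_one_GL_fin [simp]: "mat_one \<in> GL_fin n"
proof -
  have "mat_one \<in> int_block n"
    by (auto simp: int_block_def mat_one_def)
  then show ?thesis
    by (auto simp: GL_fin_def)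
qed

lemma GL_fin_cancel:
  assumes "a \<in> GL_fin n" "b \<in> GL_fin n" "a \<odot> A \<odot> b = B"
  shows "A = GL_inverse a \<odot> B \<odot> GL_inverse b"
proof -
  note inv = GL_inverse_GL_fin[OF assms(1)] GL_inverse_GL_fin[OF assms(2)]
  note blocks = inv(1,4)[THEN GL_fin_int_block] assms(1,2)[THEN GL_fin_int_block]
  have "GL_inverse a \<odot> (a \<odot> A \<odot> b) \<odot> GL_inverse b = GL_inverse a \<odot> ((a \<odot> A) \<odot> (b \<odot> GL_inverse b))"
    by (simp only: int_block_assoc_right[OF blocks(4,2)] int_block_assoc_middle[OF blocks(1,2)])
  also have "\<dots> = (GL_inverse a \<odot> a) \<odot> A"
    by (simp only: inv(5) int_block_assoc_left[OF blocks(1,3)] mat_one_mult)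
  finally show ?thesis
    using assms(3) inv by simp
qed

lemma Mat_fin_mult:
  assumes "A \<in> Mat_fin n" "g \<in> int_block n"
  shows "g \<odot> A \<in> Mat_fin n" "A \<odot> g \<in> Mat_fin n"
  using assms(1) int_blockD[OF assms(2)]
  by (auto simp: Mat_fin_def int_block_mult_left[OF assms(2)] int_block_mult_right[OF assms(2)])

lemma Mat_fin_mono: "m \<le> n \<Longrightarrow> Mat_fin m \<subseteq> Mat_fin n"
  by (auto simp: Mat_fin_def)

lemma Mat_inf_eq: "Mat_inf = (\<Union>n. Mat_fin n)"
proof (intro set_eqI iffI)
  fix A :: "'a inf_mat" assume "A \<in> Mat_inf"
  then have fin: "finite {(i, j). A i j \<noteq> 0}"
    by (simp add: Mat_inf_def)
  obtain n where n: "\<And>k. k \<in> fst ` {(i, j). A i j \<noteq> 0} \<union> snd ` {(i, j). A i j \<noteq> 0} \<Longrightarrow> k < n"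
    using finite_nat_set_iff_bounded[of "fst ` {(i, j). A i j \<noteq> 0} \<union> snd ` {(i, j). A i j \<noteq> 0}"]
        fin by auto
  have "A i j = 0" if "n \<le> i \<or> n \<le> j" for i j
  proof (rule ccontr)
    assume "A i j \<noteq> 0"
    then have "i \<in> fst ` {(i, j). A i j \<noteq> 0}" "j \<in> snd ` {(i, j). A i j \<noteq> 0}"
      by (auto intro!: image_eqI[of _ _ "(i, j)"])
    then show False
      using n[of i] n[of j] that by auto
  qed
  then show "A \<in> (\<Union>n. Mat_fin n)"
    by (auto simp: Mat_fin_def)
next
  fix A :: "'a inf_mat" assume "A \<in> (\<Union>n. Mat_fin n)"
  then obtain n where "A \<in> Mat_fin n" by blast
  then have "{(i, j). A i j \<noteq> 0} \<subseteq> {..<n} \<times> {..<n}"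
    by (auto simp: Mat_fin_def not_le[symmetric])
  then show "A \<in> Mat_inf"
    unfolding Mat_inf_def by (auto intro: finite_subset)
qed

section \<open>The trace pairing\<close>

definition mat_pairing :: "nat \<Rightarrow> 'a::nonarch_local_field inf_mat \<Rightarrow> 'a inf_mat \<Rightarrow> 'a"
  where "mat_pairing n A M = (\<Sum>i<n. \<Sum>k<n. A i k * M k i)"

lemma mat_trace_eq_pairing:
  assumes "A \<in> Mat_fin n"
  shows "mat_trace (A \<odot> M) = mat_pairing n A M"
proof -
  have prod: "(A \<odot> M) i j = (\<Sum>k<n. A i k * M k j)" for i j
    using assms by (intro mat_prod_eq_sum) (auto simp: Mat_fin_def)
  have "mat_trace (A \<odot> M) = (\<Sum>i<n. (A \<odot> M) i i)"
    unfolding mat_trace_def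
  proof (rule sum.mono_neutral_left)
    show "{i. (A \<odot> M) i i \<noteq> 0} \<subseteq> {..<n}"
      using assms by (auto simp: prod Mat_fin_def not_le[symmetric])
  qed auto
  then show ?thesis
    by (simp add: prod mat_pairing_def)
qed

lemma mat_pairing_mono:
  assumes "A \<in> Mat_fin m" "m \<le> n"
  shows "mat_pairing n A M = mat_pairing m A M"
  using mat_trace_eq_pairing[OF assms(1)] mat_trace_eq_pairing[of A n] Mat_fin_mono[OF assms(2)]
      assms(1)
  by (metis subsetD)

text \<open>Cyclicity of the trace; it transfers the group action from the random matrix to the
  argument of its characteristic function.\<close>

lemma mat_pairing_shift:
  assumes "g \<in> int_block n" "h \<in> int_block n"
  shows "mat_pairing n A (g \<odot> M \<odot> h) = mat_pairing n (h \<odot> A \<odot> g) M"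
proof -
  have "mat_pairing n A (g \<odot> M \<odot> h)
      = (\<Sum>i<n. \<Sum>k<n. \<Sum>b<n. \<Sum>a<n. A i k * g k a * M a b * h b i)"
    by (simp add: mat_pairing_def int_block_mult_left[OF assms(1)] int_block_mult_right[OF assms(2)]
        sum_distrib_left sum_distrib_right mult.assoc)
  also have "\<dots> = (\<Sum>i<n. \<Sum>b<n. \<Sum>k<n. \<Sum>a<n. A i k * g k a * M a b * h b i)"
    by (rule sum.cong[OF refl], rule sum.swap)
  also have "\<dots> = (\<Sum>b<n. \<Sum>i<n. \<Sum>a<n. \<Sum>k<n. A i k * g k a * M a b * h b i)"
    by (subst sum.swap) (rule sum.cong[OF refl], rule sum.cong[OF refl], rule sum.swap)
  also have "\<dots> = (\<Sum>b<n. \<Sum>a<n. \<Sum>k<n. \<Sum>i<n. A i k * g k a * M a b * h b i)"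
    by (rule sum.cong[OF refl], subst sum.swap, rule sum.cong[OF refl], rule sum.swap)
  also have "\<dots> = mat_pairing n (h \<odot> A \<odot> g) M"
    by (simp add: mat_pairing_def int_block_mult_left[OF assms(2)] int_block_mult_right[OF assms(1)]
        sum_distrib_left sum_distrib_right mult_ac)
  finally show ?thesis .
qed

text \<open>Left multiplication by it scales row \<open>s\<close> by \<open>w s\<close> and adds
  \<open>w i\<close> times row \<open>s\<close> to every other row \<open>i\<close>, so this one
  family provides all eliminations against a pivot row.\<close>

definition column_mat :: "nat \<Rightarrow> (nat \<Rightarrow> 'a) \<Rightarrow> 'a::nonarch_local_field inf_mat"
  where "column_mat s w = (\<lambda>i j. if j = s then w i else mat_one i j)"

lemma column_mat_block:
  assumes "s < n" "\<And>i. w i \<in> integer_ring" "\<And>i. n \<le> i \<Longrightarrow> w i = 0"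
  shows "column_mat s w \<in> int_block n"
  using assms by (auto simp: int_block_def column_mat_def mat_one_def)

lemma column_mat_mult:
  assumes "s < n" "\<And>i. w i \<in> integer_ring" "\<And>i. n \<le> i \<Longrightarrow> w i = 0"
  shows "(column_mat s w \<odot> M) i j = (if i = s then 0 else M i j) + w i * M s j"
proof (cases "i < n")
  case True
  have "(\<Sum>k<n. column_mat s w i k * M k j)
      = (\<Sum>k<n. (if k = i then if i = s then 0 else M i j else 0) + (if k = s then w i * M s j else
          0))"
    by (intro sum.cong) (auto simp: column_mat_def mat_one_def)
  also have "\<dots> = (if i = s then 0 else M i j) + w i * M s j"
    using True assms(1) by (simp add: sum.distrib)
  finally show ?thesis
    using True by (simp add: int_block_mult_left[OF column_mat_block[OF assms]])
next
  case False
  then show ?thesis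
    using assms by (auto simp: int_block_mult_left[OF column_mat_block[OF assms]])
qed

lemma column_mat_GL_fin:
  assumes "s < n" "\<And>i. w i \<in> integer_ring" "\<And>i. n \<le> i \<Longrightarrow> w i = 0" "absv (w s) = 1"
  shows "column_mat s w \<in> GL_fin n"
proof -
  have w: "w s \<noteq> 0" using assms(4) by auto
  \<comment> \<open>The inverse has the same shape, and its entries stay integral because
    \<open>w s\<close> is a unit.\<close>
  define w' where "w' i = (if i = s then inverse (w s) else - w i / w s)" for i
  have w': "\<And>i. w' i \<in> integer_ring" "\<And>i. n \<le> i \<Longrightarrow> w' i = 0"
    using assms by (auto simp: w'_def integer_ring_iff absv_inverse absv_divide)
  have "column_mat s w \<odot> column_mat s w' = mat_one" "column_mat s w' \<odot> column_mat s w = mat_one"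
    using w by (simp_all add: fun_eq_iff column_mat_mult[OF assms(1-3)] column_mat_mult[OF
        assms(1) w'])
      (auto simp: column_mat_def w'_def mat_one_def divide_inverse)
  then show ?thesis
    using column_mat_block[OF assms(1-3)] column_mat_block[OF assms(1) w']
        by (auto simp: GL_fin_def)
qed

definition swap_mat :: "nat \<Rightarrow> nat \<Rightarrow> 'a::nonarch_local_field inf_mat"
  where "swap_mat s p = (\<lambda>i j. mat_one (Transposition.transpose s p i) j)"

lemma swap_mat_block: "s < n \<Longrightarrow> p < n \<Longrightarrow> swap_mat s p \<in> int_block n"
  by (auto simp: int_block_def swap_mat_def mat_one_def Transposition.transpose_def)

lemma swap_mat_mult: "s < n \<Longrightarrow> p < n \<Longrightarrow> (swap_mat s p \<odot> M) i j = M (Transposition.transpose s p i) j"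
proof (cases "i < n")
  case True
  assume sp: "s < n" "p < n"
  have "(\<Sum>k<n. swap_mat s p i k * M k j) = (\<Sum>k<n. if k
      = Transposition.transpose s p i then M k j else 0)"
    by (intro sum.cong) (auto simp: swap_mat_def mat_one_def)
  moreover have "Transposition.transpose s p i < n"
    using True sp by (auto simp: Transposition.transpose_def)
  ultimately show ?thesis
    using True by (simp add: int_block_mult_left[OF swap_mat_block[OF sp]])
next
  case False
  assume sp: "s < n" "p < n"
  then show ?thesis
    using False by (auto simp: int_block_mult_left[OF swap_mat_block[OF sp]]
        Transposition.transpose_def)
qed

lemma swap_mat_GL_fin: "s < n \<Longrightarrow> p < n \<Longrightarrow> swap_mat s p \<in> GL_fin n"
proof -
  assume sp: "s < n" "p < n"
  have "swap_mat s p \<odot> swap_mat s p = mat_one"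
    by (simp add: fun_eq_iff swap_mat_mult[OF sp]) (simp add: swap_mat_def)
  then show ?thesis
    using swap_mat_block[OF sp] by (auto simp: GL_fin_def)
qed

text \<open>Rather than reducing \<open>v\<close> to a unit vector by row operations, one writes
  down an invertible matrix whose column \<open>m\<close> is \<open>v\<close> and takes its inverse.
  The columns before \<open>m\<close> remain those of the identity, so that left multiplication by
  \<open>a\<close> does not disturb a matrix supported in the first \<open>m\<close> rows.\<close>

lemma GL_fin_pivot:
  assumes "\<And>i. i < n \<Longrightarrow> v i \<in> integer_ring" "m \<le> p" "p < n" "absv (v p) = 1"
  obtains a where "a \<in> GL_fin n" "\<And>i j. j < m \<Longrightarrow> a i j = mat_one i j"
    "\<And>i. i < n \<Longrightarrow> (\<Sum>k<n. a i k * v k) = mat_one i m"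
proof -
  have m: "m < n" using assms by simp
  define w where "w i = (if i < n then v (Transposition.transpose m p i) else 0)" for i
  have w: "\<And>i. w i \<in> integer_ring" "\<And>i. n \<le> i \<Longrightarrow> w i = 0" "absv (w m) = 1"
    using assms m by (auto simp: w_def Transposition.transpose_def)
  define g where "g = swap_mat m p \<odot> column_mat m w"
  have g: "g \<in> GL_fin n"
    unfolding g_def using assms m by (intro GL_fin_mult swap_mat_GL_fin column_mat_GL_fin w) auto
  have g_entry: "g i j = column_mat m w (Transposition.transpose m p i) j" for i j
    unfolding g_def by (rule swap_mat_mult[OF m assms(3)])
  have g_low: "g i j = mat_one i j" if "j < m" for i j
    using that assms(2) by (auto simp: g_entry column_mat_def mat_one_def
        Transposition.transpose_def)
  have g_m: "g k m = v k" if "k < n" for k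
    using that assms(3) m by (auto simp: g_entry column_mat_def w_def Transposition.transpose_def)
  obtain a where a: "a \<in> GL_fin n" "a \<odot> g = mat_one"
    using GL_fin_inverse[OF g] by metis
  note a_mult = int_block_mult_left[OF GL_fin_int_block[OF a(1)]]
  have "a i j = mat_one i j" if "j < m" for i j
  proof (cases "i < n")
    case True
    have "mat_one i j = (a \<odot> g) i j"
      using a(2) by simp
    also have "\<dots> = (\<Sum>k<n. if k = j then a i j else 0)"
      using True that by (auto simp: a_mult g_low mat_one_def if_distrib cong: if_cong intro!:
          sum.cong)
    also have "\<dots> = a i j"
      using that m by simp
    finally show ?thesis by simp
  next
    case False
    then show ?thesis
      using int_blockD(2)[OF GL_fin_int_block[OF a(1)]] by simp
  qed
  moreover have "(\<Sum>k<n. a i k * v k) = mat_one i m" if "i < n" for i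
  proof -
    have "mat_one i m = (a \<odot> g) i m"
      using a(2) by simp
    also have "\<dots> = (\<Sum>k<n. a i k * v k)"
      using that by (simp add: a_mult g_m)
    finally show ?thesis by simp
  qed
  ultimately show ?thesis
    using a(1) that by blast
qed

definition diagonal_upto :: "nat \<Rightarrow> 'a::nonarch_local_field inf_mat \<Rightarrow> bool"
  where "diagonal_upto s B \<longleftrightarrow> (\<forall>i j. (i < s \<or> j < s) \<and> i \<noteq> j \<longrightarrow> B i j = 0)"

text \<open>One step of the Smith normal form: an entry of largest absolute value in the remaining
  block becomes the pivot, so all quotients by it are integral and the eliminations lie in
  \<open>GL_fin n\<close>.\<close>

lemma GL_fin_diagonal_step:
  assumes B: "B \<in> Mat_fin n" "diagonal_upto s B" and s: "s < n"
  shows "\<exists>a\<in>GL_fin n. \<exists>b\<in>GL_fin n. diagonal_upto (Suc s) (a \<odot> B \<odot> b)"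
proof (cases "\<forall>i\<in>{s..<n}. \<forall>j\<in>{s..<n}. B i j = 0")
  case True
  then have "B i j = 0" if "i < Suc s \<or> j < Suc s" "i \<noteq> j" for i j
    using B(1) B(2)[unfolded diagonal_upto_def, rule_format, of i j] that
    by (cases "i < s \<or> j < s"; cases "n \<le> i \<or> n \<le> j") (auto simp: Mat_fin_def)
  then have "diagonal_upto (Suc s) (mat_one \<odot> B \<odot> mat_one)"
    by (simp add: diagonal_upto_def)
  then show ?thesis
    using mat_one_GL_fin by blast
next
  case False
  define S where "S = {s..<n} \<times> {s..<n}"
  have "finite S" "S \<noteq> {}"
    using s by (auto simp: S_def)
  let ?f = "\<lambda>x. absv (B (fst x) (snd x))"
  have "Max (?f ` S) \<in> ?f ` S"
    using \<open>finite S\<close> \<open>S \<noteq> {}\<close> by (intro Max_in) auto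
  then obtain x where x: "x \<in> S" "Max (?f ` S) = ?f x"
    by auto
  have x_max: "?f y \<le> ?f x" if "y \<in> S" for y
    unfolding x(2)[symmetric] using \<open>finite S\<close> that by (intro Max_ge) auto
  obtain p r where xpr: "x = (p, r)" by fastforce
  then have pr: "s \<le> p" "p < n" "s \<le> r" "r < n"
    using x(1) by (auto simp: S_def)
  define d where "d = B p r"
  have max: "absv (B i j) \<le> absv d" if "s \<le> i" "s \<le> j" for i j
  proof (cases "i < n \<and> j < n")
    case True
    then show ?thesis using x_max[of "(i, j)"] that by (simp add: xpr d_def S_def)
  next
    case False
    then show ?thesis using B(1) by (auto simp: Mat_fin_def)
  qed
  have "d \<noteq> 0"
    using False max by (metis absv_0 absv_pos_iff atLeastLessThan_iff linorder_not_less)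
  define a1 where "a1 = (swap_mat s p :: 'a inf_mat)"
  define b1 where "b1 = (mat_transpose (swap_mat s r) :: 'a inf_mat)"
  have 1: "a1 \<in> GL_fin n" "b1 \<in> GL_fin n"
    using s pr by (auto simp: a1_def b1_def intro!: GL_fin_transpose swap_mat_GL_fin)
  define B1 where "B1 = a1 \<odot> B \<odot> b1"
  have "B1 = mat_transpose (swap_mat s r \<odot> mat_transpose (a1 \<odot> B))"
    by (simp add: B1_def mat_transpose_mult b1_def)
  then have B1: "B1 i j = B (Transposition.transpose s p i) (Transposition.transpose s r j)" for i j
    by (simp add: swap_mat_mult[OF s pr(2)] swap_mat_mult[OF s pr(4)] a1_def)
  have B1_max: "absv (B1 i j) \<le> absv d" if "s \<le> i" "s \<le> j" for i j
    unfolding B1 using that pr by (intro max) (auto simp: Transposition.transpose_def)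
  have B1_s: "B1 s s = d"
    by (simp add: B1 d_def)
  have B1_diag: "B1 i j = 0" if "i < s \<or> j < s" "i \<noteq> j" for i j
  proof -
    have "Transposition.transpose s p i < s \<or> Transposition.transpose s r j < s"
        "Transposition.transpose s p i \<noteq> Transposition.transpose s r j"
      using that pr by (auto simp: Transposition.transpose_def split: if_splits)
    then show ?thesis
      using B(2) by (simp add: B1 diagonal_upto_def)
  qed
  have B1_fin: "B1 i j = 0" if "n \<le> i \<or> n \<le> j" for i j
    using that pr s B(1) by (auto simp: B1 Mat_fin_def Transposition.transpose_def)
  define w where "w i = (if i \<le> s then mat_one i s else - B1 i s / d)" for i
  have w: "\<And>i. w i \<in> integer_ring" "\<And>i. n \<le> i \<Longrightarrow> w i = 0" "w s = 1"
    using s \<open>d \<noteq> 0\<close> B1_max[of _ s] B1_fin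
    by (auto simp: w_def integer_ring_iff absv_divide mat_one_def divide_le_eq_1)
  define a2 where "a2 = column_mat s w"
  have a2: "a2 \<in> GL_fin n"
    unfolding a2_def using s w by (intro column_mat_GL_fin) auto
  define B2 where "B2 = a2 \<odot> B1"
  have B2: "B2 i j = (if i \<le> s then B1 i j else B1 i j - B1 i s / d * B1 s j)" for i j
    by (auto simp: B2_def a2_def column_mat_mult[OF s w(1,2)] w(3)) (auto simp: w_def mat_one_def)
  define u where "u j = (if j \<le> s then mat_one j s else - B2 s j / d)" for j
  have u: "\<And>i. u i \<in> integer_ring" "\<And>i. n \<le> i \<Longrightarrow> u i = 0" "u s = 1"
    using s \<open>d \<noteq> 0\<close> B1_max[of s] B1_fin
    by (auto simp: u_def B2 integer_ring_iff absv_divide mat_one_def divide_le_eq_1)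
  define b2 where "b2 = mat_transpose (column_mat s u)"
  have b2: "b2 \<in> GL_fin n"
    unfolding b2_def using s u by (intro GL_fin_transpose column_mat_GL_fin) auto
  have "B2 \<odot> b2 = mat_transpose (column_mat s u \<odot> mat_transpose B2)"
    by (simp add: b2_def mat_transpose_mult)
  then have B3: "(B2 \<odot> b2) i j = (if j \<le> s then B2 i j else B2 i j - B2 s j / d * B2 i s)" for i j
    by (auto simp: column_mat_mult[OF s u(1,2)] u_def mat_one_def)
  have "diagonal_upto (Suc s) (B2 \<odot> b2)"
    unfolding diagonal_upto_def B3 B2 using B1_s \<open>d \<noteq> 0\<close> B1_diag
    by (auto simp: less_Suc_eq not_le)
  moreover have "B2 \<odot> b2 = (a2 \<odot> a1) \<odot> B \<odot> (b1 \<odot> b2)"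
  proof -
    note blocks = 1[THEN GL_fin_int_block] a2[THEN GL_fin_int_block] b2[THEN GL_fin_int_block]
    have "B2 \<odot> b2 = ((a2 \<odot> (a1 \<odot> B)) \<odot> b1) \<odot> b2"
      by (simp only: B2_def B1_def int_block_assoc_middle[OF blocks(3,2)])
    also have "\<dots> = (a2 \<odot> a1) \<odot> B \<odot> (b1 \<odot> b2)"
      by (simp only: int_block_assoc_right[OF blocks(2,4)] int_block_assoc_left[OF blocks(3,1)])
    finally show ?thesis .
  qed
  ultimately show ?thesis
    using GL_fin_mult[OF a2 1(1)] GL_fin_mult[OF 1(2) b2] by metis
qed

lemma GL_fin_diagonalize:
  assumes "B \<in> Mat_fin n" "s \<le> n"
  shows "\<exists>a\<in>GL_fin n. \<exists>b\<in>GL_fin n. diagonal_upto s (a \<odot> B \<odot> b)"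
  using assms(2)
proof (induction s)
  case 0
  show ?case
    by (intro bexI[OF _ mat_one_GL_fin]) (simp add: diagonal_upto_def)
next
  case (Suc s)
  then obtain a b where ab: "a \<in> GL_fin n" "b \<in> GL_fin n" "diagonal_upto s (a \<odot> B \<odot> b)"
    by auto
  note blocks = ab(1,2)[THEN GL_fin_int_block]
  have "a \<odot> B \<odot> b \<in> Mat_fin n"
    using assms(1) blocks by (intro Mat_fin_mult)
  then obtain c d where cd: "c \<in> GL_fin n" "d \<in> GL_fin n"
      "diagonal_upto (Suc s) (c \<odot> (a \<odot> B \<odot> b) \<odot> d)"
    using GL_fin_diagonal_step ab(3) Suc.prems by (metis Suc_le_eq)
  note blocks' = cd(1,2)[THEN GL_fin_int_block]
  have "c \<odot> (a \<odot> B \<odot> b) \<odot> d = (c \<odot> a) \<odot> B \<odot> (b \<odot> d)"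
    by (simp only: int_block_assoc_middle[OF blocks'(1) blocks(2), symmetric]
        int_block_assoc_right[OF blocks(2) blocks'(2)] int_block_assoc_left[OF blocks'(1)
            blocks(1)])
  then show ?case
    using cd ab GL_fin_mult by metis
qed

context normalized_character
begin

text \<open>Each diagonal entry is a unit times a power of \<open>\<pi>\<close>, with
  \<open>0\<close> read as the unit \<open>1\<close> times the power for \<open>None\<close>; the
  units form an invertible diagonal matrix that is absorbed into the left factor.\<close>

lemma singular_number_decomposition:
  assumes "A \<in> Mat_fin n"
  obtains a b ks where "a \<in> GL_fin n" "b \<in> GL_fin n" "length ks = n" "A = a \<odot> diag_mat \<pi> ks \<odot> b"
proof -
  obtain a b where ab: "a \<in> GL_fin n" "b \<in> GL_fin n" "diagonal_upto n (a \<odot> A \<odot> b)"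
    using GL_fin_diagonalize[OF assms] by blast
  define B where "B = a \<odot> A \<odot> b"
  have "B \<in> Mat_fin n"
    unfolding B_def using assms ab by (intro Mat_fin_mult GL_fin_int_block)
  then have B: "B i j = 0" if "i \<noteq> j \<or> n \<le> i" for i j
    using that ab(3) by (cases "i < n") (auto simp: Mat_fin_def diagonal_upto_def B_def[symmetric])
  have "\<exists>u k. absv u = 1 \<and> x = u * neg_power \<pi> k" for x
  proof (cases "x = 0")
    case True
    then show ?thesis
      by (intro exI[of _ 1] exI[of _ None]) simp
  next
    case False
    then show ?thesis
      by (metis uniformizer_decomposition neg_power.simps(2))
  qed
  then obtain u k where uk: "\<And>x. absv (u x) = 1" "\<And>x. x = u x * neg_power \<pi> (k x)"
    by metis
  define ks where "ks = map (\<lambda>i. k (B i i)) [0..<n]"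
  define U where "U = (\<lambda>i j. if i = j then if i < n then u (B i i) else 1 else 0)"
  define U' where "U' = (\<lambda>i j. if i = j then if i < n then inverse (u (B i i)) else 1 else 0)"
  have u_nz: "u x \<noteq> 0" for x
    using uk(1)[of x] by auto
  have blocks: "U \<in> int_block n" "U' \<in> int_block n"
    using uk(1) by (auto simp: U_def U'_def int_block_def mat_one_def integer_ring_iff absv_inverse)
  have U_mult: "(U \<odot> M) i j = U i i * M i j" and U'_mult: "(U' \<odot> M) i j = U' i i * M i j" for M i j
    unfolding int_block_mult_left[OF blocks(1)] int_block_mult_left[OF blocks(2)]
    by (auto simp: U_def U'_def if_distrib[of "\<lambda>x. x * _"] cong: if_cong)
  have "U \<odot> U' = mat_one" "U' \<odot> U = mat_one"
    using u_nz by (auto simp: fun_eq_iff U_mult U'_mult) (auto simp: U_def U'_def mat_one_def)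
  then have U: "U \<in> GL_fin n"
    using blocks by (auto simp: GL_fin_def)
  have "(U \<odot> diag_mat \<pi> ks) i j = B i j" for i j
    using uk(2)[of "B i i"] B[of i j] unfolding U_mult
        by (cases "i = j \<and> i < n") (auto simp: U_def diag_mat_def ks_def)
  then have "a \<odot> A \<odot> b = U \<odot> diag_mat \<pi> ks"
    unfolding B_def[symmetric] by (simp add: fun_eq_iff)
  then have "A = GL_inverse a \<odot> (U \<odot> diag_mat \<pi> ks) \<odot> GL_inverse b"
    by (rule GL_fin_cancel[OF ab(1,2)])
  also have "\<dots> = (GL_inverse a \<odot> U) \<odot> diag_mat \<pi> ks \<odot> GL_inverse b"
    using GL_fin_int_block[OF GL_inverse_GL_fin(1)[OF ab(1)]] blocks(1)
        by (simp add: int_block_assoc_left)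
  finally have A: "A = (GL_inverse a \<odot> U) \<odot> diag_mat \<pi> ks \<odot> GL_inverse b" .
  show ?thesis
    by (rule that[OF _ _ _ A]) (simp_all add: ks_def ab U GL_inverse_GL_fin(1) GL_fin_mult)
qed

end


section \<open>Integrality probabilities and singular numbers\<close>

definition mat_scale :: "'a::nonarch_local_field \<Rightarrow> 'a inf_mat \<Rightarrow> 'a inf_mat"
  where "mat_scale c A = (\<lambda>i j. c * A i j)"

lemma mat_scale_apply [simp]: "mat_scale c A i j = c * A i j"
  by (simp add: mat_scale_def)

lemma mat_scale_mult:
  assumes "g \<in> int_block n"
  shows "mat_scale c (g \<odot> A) = g \<odot> mat_scale c A" "mat_scale c (A \<odot> g) = mat_scale c A \<odot> g"
  by (auto simp: fun_eq_iff int_block_mult_left[OF assms] int_block_mult_right[OF assms]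
      sum_distrib_left mult_ac)

lemma mset_eqI_trunc_add:
  fixes M N :: "int option multiset"
  assumes "size M = size N"
    and "\<And>l. (\<Sum>k\<in>#M. nat (trunc_add k (Some l))) = (\<Sum>k\<in>#N. nat (trunc_add k (Some l)))"
  shows "M = N"
proof -
  \<comment> \<open>the second difference of the hinge function \<open>max 0\<close> is the indicator of \<open>0\<close>\<close>
  have count: "int (count M (Some t)) + 2 * int (\<Sum>k\<in>#M. nat (trunc_add k (Some (- t))))
      = int (\<Sum>k\<in>#M. nat (trunc_add k (Some (1 - t)))) + int (\<Sum>k\<in>#M. nat (trunc_add k (Some (- 1 -
          t))))"
    for M :: "int option multiset" and t
  proof (induction M)
    case (add x M)
    then show ?case by (cases x) auto
  qed simp
  have Some: "count M (Some t) = count N (Some t)" for t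
    using count[of M t] count[of N t] assms(2) by simp
  have filter: "filter_mset (\<lambda>k. k \<noteq> None) M = filter_mset (\<lambda>k. k \<noteq> None) N"
  proof (rule multiset_eqI)
    fix k show "count (filter_mset (\<lambda>k. k \<noteq> None) M) k = count (filter_mset (\<lambda>k. k \<noteq> None) N) k"
      using Some by (cases k) auto
  qed
  \<comment> \<open>The hinge sums do not see \<open>None\<close>; its multiplicity is recovered
    from the total size.\<close>
  have size: "size M = size (filter_mset (\<lambda>k. k \<noteq> None) M) + count M None"
      for M :: "int option multiset"
    by (induction M) auto
  show ?thesis
  proof (rule multiset_eqI)
    fix k show "count M k = count N k"
      using Some size[of M] size[of N] assms(1) filter by (cases k) auto
  qed
qed

definition bilinear_form :: "nat \<Rightarrow> nat \<Rightarrow> 'a::nonarch_local_field inf_mat \<Rightarrow> (nat \<Rightarrow> 'a) \<Rightarrow> (nat \<Rightarrow> 'a)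
    \<Rightarrow> 'a"
  where "bilinear_form n p B u v = (\<Sum>i<n. \<Sum>j<p. u i * B i j * v j)"

lemma measurable_inf_mat:
  fixes f :: "'b \<Rightarrow> 'a::nonarch_local_field inf_mat"
  assumes "\<And>i j. (\<lambda>x. f x i j) \<in> borel_measurable N"
  shows "f \<in> borel_measurable N"
  using assms by (intro measurable_coordinatewise_then_product)

lemma measurable_inf_mat_entry:
  fixes f :: "'b \<Rightarrow> 'a::nonarch_local_field inf_mat"
  assumes "f \<in> borel_measurable N"
  shows "(\<lambda>x. f x i j) \<in> borel_measurable N"
  by (rule measurable_product_then_coordinatewise[OF measurable_product_then_coordinatewise[OF
      assms]])

lemma measurable_mat_scale [measurable]: "(\<lambda>M. mat_scale c M) \<in> borel_measurable borel"
proof (rule measurable_inf_mat)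
  show "(\<lambda>M. mat_scale c M i j) \<in> borel_measurable borel" for i j
    unfolding mat_scale_apply
    by (intro borel_measurable_mult_field measurable_inf_mat_entry) simp_all
qed

lemma measurable_bilinear_form [measurable (raw)]:
  fixes B :: "'b \<Rightarrow> 'a::nonarch_local_field inf_mat"
  assumes B: "B \<in> borel_measurable N"
    and u: "u \<in> measurable N (PiM UNIV (\<lambda>_. borel))"
        and v: "v \<in> measurable N (PiM UNIV (\<lambda>_. borel))"
  shows "(\<lambda>x. bilinear_form n p (B x) (u x) (v x)) \<in> borel_measurable N"
proof -
  note [measurable] = measurable_inf_mat_entry[OF B] measurable_compose[OF u
      measurable_component_singleton]
    measurable_compose[OF v measurable_component_singleton]
  show ?thesis
    unfolding bilinear_form_def by measurable
qed

section \<open>Uniform integral vectors and corner probabilities\<close>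

context normalized_character
begin

definition haar :: "'a measure" where
  "haar = (SOME L. prob_space L \<and> sets L = sets borel \<and> (AE x in L. x \<in> integer_ring) \<and>
    (\<forall>t. (\<integral>x. \<psi> (t * x) \<partial>L) = (if t \<in> integer_ring then 1 else 0)) \<and>
    (\<forall>k. measure L {x. inverse \<pi> ^ k * x \<in> integer_ring} = inverse (real q ^ k)))"

lemma prob_space_haar: "prob_space haar"
  and sets_haar [measurable_cong, simp]: "sets haar = sets borel"
  and AE_haar: "AE x in haar. x \<in> integer_ring"
  and integral_character_haar: "(\<integral>x. \<psi> (t * x) \<partial>haar) = (if t \<in> integer_ring then 1 else 0)"
  and measure_haar_power: "measure haar {x. inverse \<pi> ^ k * x \<in> integer_ring}
      = inverse (real q ^ k)"
  using someI_ex[OF haar_exists] unfolding haar_def[symmetric] by auto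

lemma space_haar [simp]: "space haar = UNIV"
  using sets_eq_imp_space_eq[OF sets_haar] by simp

definition haar_seq :: "(nat \<Rightarrow> 'a) measure" where
  "haar_seq = PiM UNIV (\<lambda>_. haar)"

lemma space_haar_seq [simp]: "space haar_seq = UNIV"
  by (simp add: haar_seq_def space_PiM)

lemma prob_space_haar_seq: "prob_space haar_seq"
  unfolding haar_seq_def by (intro prob_space_PiM prob_space_haar)

lemma sets_haar_seq [measurable_cong, simp]: "sets haar_seq = sets (PiM UNIV (\<lambda>_. borel))"
  unfolding haar_seq_def by (intro sets_PiM_cong) auto

lemma AE_haar_seq: "AE u in haar_seq. \<forall>i. u i \<in> integer_ring"
  unfolding AE_all_countable haar_seq_def
  by (intro allI AE_PiM_component prob_space_haar AE_haar) auto

lemma integral_character_haar_seq: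
  assumes "finite J"
  shows "(\<integral>u. \<psi> (\<Sum>i\<in>J. w i * u i) \<partial>haar_seq) = (if \<forall>i\<in>J. w i \<in> integer_ring then 1 else 0)"
proof -
  have "(\<integral>u. \<psi> (\<Sum>i\<in>J. w i * u i) \<partial>haar_seq) = (\<integral>u. (\<Prod>i\<in>J. \<psi> (w i * u i)) \<partial>PiM UNIV (\<lambda>_. haar))"
    by (simp add: haar_seq_def character_sum)
  also have "\<dots> = (\<Prod>i\<in>J. \<integral>x. \<psi> (w i * x) \<partial>haar)"
    using assms by (intro integral_PiM_prod[where B = 1] prob_space_haar) simp_all
  also have "\<dots> = (if \<forall>i\<in>J. w i \<in> integer_ring then 1 else 0)"
    using assms by (auto simp: integral_character_haar)
  finally show ?thesis .
qed

lemma measure_haar_seq_Ball: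
  assumes "finite J" "\<And>i. i \<in> J \<Longrightarrow> {x. P i x} \<in> sets borel"
  shows "measure haar_seq {u. \<forall>i\<in>J. P i (u i)} = (\<Prod>i\<in>J. measure haar {x. P i x})"
proof -
  interpret prob_space haar by (rule prob_space_haar)
  interpret product_prob_space "\<lambda>_. haar" UNIV ..
  have "{u. \<forall>i\<in>J. P i (u i)} = prod_emb UNIV (\<lambda>_. haar) J (\<Pi>\<^sub>E i\<in>J. {x. P i x})"
    by (auto simp: prod_emb_def space_PiM)
  then show ?thesis
    using measure_PiM_emb[of J "\<lambda>i. {x. P i x}"] assms by (simp add: haar_seq_def)
qed

text \<open>This is the origin of the truncation in \<open>trunc_add\<close>: a total exponent
  \<open>k + l\<close> that is at most \<open>0\<close> leaves integral numbers integral, while a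
  positive one requires divisibility by that power of \<open>\<pi>\<close>.\<close>

lemma measure_haar_neg_power:
  "measure haar {x. neg_power \<pi> k * neg_power \<pi> l * x \<in> integer_ring}
      = inverse (real q ^ nat (trunc_add k l))"
proof -
  interpret prob_space haar by (rule prob_space_haar)
  show ?thesis
  proof (cases "k = None \<or> l = None")
    case True
    then show ?thesis
      using prob_space by (cases k; cases l) auto
  next
    case False
    then obtain a b where ab: "k = Some a" "l = Some b" by auto
    have eq: "neg_power \<pi> k * neg_power \<pi> l = \<pi> powi (- (a + b))"
      by (simp add: ab flip: power_int_add)
    show ?thesis
    proof (cases "a + b \<ge> 1")
      case True
      then have "\<pi> powi (- (a + b)) = inverse \<pi> ^ nat (a + b)"
        by (simp add: power_int_def power_inverse add.commute)
      then show ?thesis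
        unfolding eq using True measure_haar_power by (simp add: ab)
    next
      case False
      then have "\<pi> powi (- (a + b)) \<in> integer_ring"
        unfolding uniformizer_power_int_in_integer_ring_iff by simp
      then have "AE x in haar. \<pi> powi (- (a + b)) * x \<in> integer_ring"
        using AE_haar by (auto simp: integer_ring_mult elim!: eventually_mono)
      then have "measure haar {x. \<pi> powi (- (a + b)) * x \<in> integer_ring} = 1"
        by (subst prob_eq_1) auto
      then show ?thesis
        unfolding eq using False by (simp add: ab)
    qed
  qed
qed

lemma measure_nonunits: "finite J \<Longrightarrow> measure haar_seq {u. \<forall>i\<in>J. absv (u i) < 1}
    = inverse (real q ^ card J)"
proof -
  assume "finite J"
  then have "measure haar_seq {u. \<forall>i\<in>J. inverse \<pi> * u i \<in> integer_ring}
      = (\<Prod>i\<in>J. measure haar {x. inverse \<pi> * x \<in> integer_ring})"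
    by (intro measure_haar_seq_Ball) auto
  then show ?thesis
    using measure_haar_power[of 1] by (simp add: absv_less_1_iff power_inverse)
qed

definition corner_prob :: "nat \<Rightarrow> nat \<Rightarrow> 'a inf_mat \<Rightarrow> real" where
  "corner_prob n p B = measure haar_seq {v. \<forall>i<n. (\<Sum>j<p. B i j * v j) \<in> integer_ring}"

lemma corner_event [measurable]:
  fixes B :: "'a inf_mat"
  shows "{v. \<forall>i<n. (\<Sum>j<p. B i j * v j) \<in> integer_ring} \<in> sets haar_seq"
proof -
  have "{v \<in> space haar_seq. \<forall>i<n. (\<Sum>j<p. B i j * v j) \<in> integer_ring} \<in> sets haar_seq"
    by measurable
  then show ?thesis by simp
qed

lemma corner_prob_bounds: "0 \<le> corner_prob n p B" "corner_prob n p B \<le> 1"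
  using prob_space.prob_le_1[OF prob_space_haar_seq] by (simp_all add: corner_prob_def)

lemma corner_prob_eq_integral:
  "complex_of_real (corner_prob n p B) = (\<integral>v. (\<integral>u. \<psi> (bilinear_form n p B u v) \<partial>haar_seq)
      \<partial>haar_seq)"
proof -
  interpret prob_space haar_seq by (rule prob_space_haar_seq)
  have "(\<integral>u. \<psi> (bilinear_form n p B u v) \<partial>haar_seq)
      = complex_of_real (indicator {v. \<forall>i<n. (\<Sum>j<p. B i j * v j) \<in> integer_ring} v)" for v
  proof -
    have "bilinear_form n p B u v = (\<Sum>i<n. (\<Sum>j<p. B i j * v j) * u i)" for u
      by (simp add: bilinear_form_def sum_distrib_right sum_distrib_left mult_ac)
    then show ?thesis
      by (auto simp: integral_character_haar_seq indicator_def)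
  qed
  then show ?thesis
    by (simp add: corner_prob_def emeasure_eq_measure)
qed

lemma corner_prob_transpose: "corner_prob n p B = corner_prob p n (mat_transpose B)"
proof -
  have "complex_of_real (corner_prob n p B)
      = (\<integral>u. (\<integral>v. \<psi> (bilinear_form n p B u v) \<partial>haar_seq) \<partial>haar_seq)"
    unfolding corner_prob_eq_integral
    by (rule bounded_Fubini[where B = 1]) (auto simp: prob_space_haar_seq)
  also have "\<dots> = complex_of_real (corner_prob p n (mat_transpose B))"
  proof -
    have "bilinear_form n p B u v = bilinear_form p n (mat_transpose B) v u" for u v
      unfolding bilinear_form_def by (subst sum.swap) (simp add: mult_ac)
    then show ?thesis
      by (simp add: corner_prob_eq_integral)
  qed
  finally show ?thesis
    using of_real_eq_iff by blast
qed

text \<open>Dropping rows removes conditions from the event; dropping columns becomes dropping rows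
  after transposition.\<close>

lemma corner_prob_antimono:
  assumes "m \<le> n"
  shows "corner_prob n n B \<le> corner_prob m m B"
proof -
  interpret prob_space haar_seq by (rule prob_space_haar_seq)
  have mono: "corner_prob n p B \<le> corner_prob m p B" for p B
    unfolding corner_prob_def using assms by (intro finite_measure_mono corner_event) auto
  have "corner_prob n n B \<le> corner_prob m n B" by (rule mono)
  also have "\<dots> = corner_prob n m (mat_transpose B)" by (rule corner_prob_transpose)
  also have "\<dots> \<le> corner_prob m m (mat_transpose B)" by (rule mono)
  also have "\<dots> = corner_prob m m B" by (rule corner_prob_transpose[symmetric])
  finally show ?thesis .
qed

lemma corner_prob_cong:
  "(\<And>i j. i < n \<Longrightarrow> j < p \<Longrightarrow> B i j = C i j) \<Longrightarrow> corner_prob n p B = corner_prob n p C"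
  by (simp add: corner_prob_def)

text \<open>Integral combinations of integral numbers are integral, so left multiplication by an
  integral matrix can only enlarge the event. For an invertible matrix the same bound for the
  inverse gives equality.\<close>

lemma corner_prob_mult_le:
  assumes a: "a \<in> int_block n"
  shows "corner_prob n p B \<le> corner_prob n p (a \<odot> B)"
proof -
  interpret prob_space haar_seq by (rule prob_space_haar_seq)
  show ?thesis
    unfolding corner_prob_def
  proof (rule finite_measure_mono)
    have eq: "(\<Sum>j<p. (a \<odot> B) i j * v j) = (\<Sum>k<n. a i k * (\<Sum>j<p. B k j * v j))" if "i < n" for i v
      using that by (simp add: int_block_mult_left[OF a] sum_distrib_left sum_distrib_right
          mult.assoc)
        (rule sum.swap)
    show "{v. \<forall>i<n. (\<Sum>j<p. B i j * v j) \<in> integer_ring} \<subseteq> {v. \<forall>i<n. (\<Sum>j<p. (a \<odot> B) i j * v j)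
        \<in> integer_ring}"
    proof safe
      fix v i assume v: "\<forall>i<n. (\<Sum>j<p. B i j * v j) \<in> integer_ring" and "i < n"
      then show "(\<Sum>j<p. (a \<odot> B) i j * v j) \<in> integer_ring"
        unfolding eq[OF \<open>i < n\<close>] using int_blockD(1)[OF a]
        by (intro integer_ring_sum, intro integer_ring_mult) auto
    qed
  qed (rule corner_event)
qed

lemma corner_prob_GL_left:
  assumes a: "a \<in> GL_fin n"
  shows "corner_prob n p (a \<odot> B) = corner_prob n p B"
proof (rule antisym)
  obtain h where h: "h \<in> GL_fin n" "h \<odot> a = mat_one"
    using GL_fin_inverse[OF a] by metis
  note blocks = h(1)[THEN GL_fin_int_block] a[THEN GL_fin_int_block]
  have "corner_prob n p (a \<odot> B) \<le> corner_prob n p (h \<odot> (a \<odot> B))"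
    by (rule corner_prob_mult_le[OF blocks(1)])
  then show "corner_prob n p (a \<odot> B) \<le> corner_prob n p B"
    by (simp add: int_block_assoc_left[OF blocks, symmetric] h)
  show "corner_prob n p B \<le> corner_prob n p (a \<odot> B)"
    by (rule corner_prob_mult_le[OF blocks(2)])
qed

lemma corner_prob_GL_right:
  assumes b: "b \<in> GL_fin p"
  shows "corner_prob n p (B \<odot> b) = corner_prob n p B"
  by (subst (1 2) corner_prob_transpose)
    (simp add: mat_transpose_mult corner_prob_GL_left GL_fin_transpose b)

lemma corner_prob_diagonal:
  assumes "\<And>i j. i \<noteq> j \<Longrightarrow> D i j = 0"
  shows "corner_prob n n D = (\<Prod>i<n. measure haar {x. D i i * x \<in> integer_ring})"
proof -
  have "(\<Sum>j<n. D i j * v j) = (\<Sum>j<n. if j = i then D i i * v i else 0)" for i v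
    using assms by (intro sum.cong) auto
  then have "corner_prob n n D = measure haar_seq {v. \<forall>i\<in>{..<n}. D i i * v i \<in> integer_ring}"
    unfolding corner_prob_def by (intro arg_cong[where f = "measure haar_seq"]) auto
  then show ?thesis
    using measure_haar_seq_Ball[of "{..<n}" "\<lambda>i x. D i i * x \<in> integer_ring"] by simp
qed

lemma corner_prob_singular_numbers:
  assumes "a \<in> GL_fin n" "b \<in> GL_fin n" "length ks = n"
  shows "corner_prob n n (mat_scale (neg_power \<pi> l) (a \<odot> diag_mat \<pi> ks \<odot> b))
    = inverse (real q ^ (\<Sum>k\<in>#mset ks. nat (trunc_add k l)))"
proof -
  note blocks = assms(1,2)[THEN GL_fin_int_block]
  have "corner_prob n n (mat_scale (neg_power \<pi> l) (a \<odot> diag_mat \<pi> ks \<odot> b))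
      = corner_prob n n (mat_scale (neg_power \<pi> l) (diag_mat \<pi> ks))"
    by (simp add: mat_scale_mult(2)[OF blocks(2)] mat_scale_mult(1)[OF blocks(1)]
        corner_prob_GL_left corner_prob_GL_right assms)
  also have "\<dots> = (\<Prod>i<n. measure haar {x. neg_power \<pi> (ks ! i) * neg_power \<pi> l * x \<in> integer_ring})"
    using assms(3) by (subst corner_prob_diagonal) (auto simp: diag_mat_def mult_ac)
  also have "\<dots> = inverse (real q ^ (\<Sum>i<n. nat (trunc_add (ks ! i) l)))"
    by (simp add: measure_haar_neg_power power_sum prod_inversef[symmetric])
  also have "(\<Sum>i<n. nat (trunc_add (ks ! i) l)) = (\<Sum>k\<in>#mset ks. nat (trunc_add k l))"
    by (simp add: sum_mset_sum_list sum_list_sum_nth atLeast0LessThan assms(3) flip: mset_map)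
  finally show ?thesis .
qed

text \<open>Scaling by \<open>neg_power \<pi> l\<close> shifts every finite singular number by
  \<open>l\<close>. The corner probabilities of all these scalings depend only on the matrix, yield
  all hinge sums of the exponents, and thereby determine the multiset.\<close>

lemma Sing_fin_eq:
  assumes "a \<in> GL_fin n" "b \<in> GL_fin n" "length ks = n" "A = a \<odot> diag_mat \<pi> ks \<odot> b"
  shows "Sing_fin \<pi> n A = mset ks"
  unfolding Sing_fin_def
proof (rule the_equality)
  show "\<exists>a\<in>GL_fin n. \<exists>b\<in>GL_fin n. \<exists>js. length js = n \<and> A = a \<odot> diag_mat \<pi> js \<odot> b \<and> mset ks
      = mset js"
    using assms by blast
  fix S assume "\<exists>a\<in>GL_fin n. \<exists>b\<in>GL_fin n. \<exists>js. length js = n \<and> A = a \<odot> diag_mat \<pi> js \<odot> b \<and> S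
      = mset js"
  then obtain a' b' js where js: "a' \<in> GL_fin n" "b' \<in> GL_fin n" "length js = n"
    "A = a' \<odot> diag_mat \<pi> js \<odot> b'" "S = mset js"
    by blast
  have "mset js = mset ks"
  proof (rule mset_eqI_trunc_add)
    show "size (mset js) = size (mset ks)"
      using js(3) assms(3) by simp
    fix l
    have "inverse (real q ^ (\<Sum>k\<in>#mset js. nat (trunc_add k (Some l))))
        = inverse (real q ^ (\<Sum>k\<in>#mset ks. nat (trunc_add k (Some l))))"
      using corner_prob_singular_numbers[OF js(1-3), of
          "Some l"] corner_prob_singular_numbers[OF assms(1-3), of "Some l"]
        js(4) assms(4) by simp
    then show "(\<Sum>k\<in>#mset js. nat (trunc_add k (Some l)))
        = (\<Sum>k\<in>#mset ks. nat (trunc_add k (Some l)))"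
      using q_real_gt_1 by (simp only: inverse_eq_iff_eq power_inject_exp)
  qed
  then show "S = mset ks"
    using js(5) by simp
qed

lemma Sing_decomposition:
  assumes "A \<in> Mat_inf"
  obtains n a b ks where "A \<in> Mat_fin n" "a \<in> GL_fin n" "b \<in> GL_fin n" "length ks = n"
    "A = a \<odot> diag_mat \<pi> ks \<odot> b" "Sing \<pi> A = mset ks"
proof -
  define n where "n = (LEAST n. A \<in> Mat_fin n)"
  have A: "A \<in> Mat_fin n"
    using assms unfolding n_def Mat_inf_eq by (auto intro: LeastI)
  obtain a b ks where *: "a \<in> GL_fin n" "b \<in> GL_fin n" "length ks = n" "A = a \<odot> diag_mat \<pi> ks \<odot> b"
    by (rule singular_number_decomposition[OF A])
  have "Sing \<pi> A = mset ks"
    using Sing_fin_eq[OF *] by (simp add: Sing_def n_def)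
  with A * show ?thesis by (rule that)
qed

end


section \<open>Characteristic functions of invariant measures\<close>

lemma measurable_mat_pairing [measurable]:
  "(\<lambda>M. mat_pairing n A M) \<in> borel_measurable borel"
  unfolding mat_pairing_def
  by (intro borel_measurable_sum borel_measurable_mult_field measurable_inf_mat_entry) simp_all

text \<open>The action carries an inverse on the right. As inversion maps the group onto itself,
  invariance can be handled in the form \<open>g \<odot> M \<odot> h\<close> throughout.\<close>

lemma GL_action_GL_fin:
  assumes "g \<in> GL_fin n" "h \<in> GL_fin n"
  shows "GL_action g (GL_inverse h) M = g \<odot> M \<odot> h"
proof -
  note inv = GL_inverse_GL_fin[OF assms(2)]
  have "GL_inverse (GL_inverse h) = h"
    by (rule GL_inverse_eq[OF inv(1) assms(2) inv(3,2)])
  then show ?thesis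
    by (simp add: GL_action_def)
qed

lemma measurable_GL_mult:
  assumes "g \<in> int_block n" "h \<in> int_block n"
  shows "(\<lambda>M. g \<odot> M \<odot> h) \<in> borel_measurable borel"
proof (rule measurable_inf_mat)
  fix i j
  show "(\<lambda>M. (g \<odot> M \<odot> h) i j) \<in> borel_measurable borel"
  proof -
    have [measurable]: "(\<lambda>M::'a inf_mat. M k l) \<in> borel_measurable borel" for k l
      by (rule measurable_inf_mat_entry) simp
    show ?thesis
      unfolding int_block_mult_left[OF assms(1)] int_block_mult_right[OF assms(2)]
      by (cases "i < n"; cases "j < n") simp_all
  qed
qed

lemma invariant_prob_GL:
  assumes "invariant_prob \<mu>" "g \<in> GL_fin n" "h \<in> GL_fin n"
  shows "distr \<mu> borel (\<lambda>M. g \<odot> M \<odot> h) = \<mu>"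
proof -
  have "g \<in> GL_inf" "GL_inverse h \<in> GL_inf"
    using assms(2) GL_inverse_GL_fin(1)[OF assms(3)] by (auto simp: GL_inf_def)
  then have "distr \<mu> borel (GL_action g (GL_inverse h)) = \<mu>"
    using assms(1) by (simp add: invariant_prob_def)
  moreover have "GL_action g (GL_inverse h) = (\<lambda>M. g \<odot> M \<odot> h)"
    by (rule ext) (rule GL_action_GL_fin[OF assms(2,3)])
  ultimately show ?thesis by simp
qed

lemma GL_action_obtain:
  assumes "g \<in> GL_inf" "h \<in> GL_inf"
  obtains n where "g \<in> GL_fin n" "GL_inverse h \<in> GL_fin n"
proof -
  obtain m k where mk: "g \<in> GL_fin m" "h \<in> GL_fin k"
    using assms by (auto simp: GL_inf_def)
  then have "g \<in> GL_fin (max m k)" "GL_inverse h \<in> GL_fin (max m k)"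
    using GL_fin_mono[of m "max m k"] GL_fin_mono[of k "max m k"] GL_inverse_GL_fin(1)[OF mk(2)]
        by auto
  then show ?thesis by (rule that)
qed

lemma invariant_probI:
  assumes "sets \<mu> = sets borel" "prob_space \<mu>"
    and "\<And>n g h. g \<in> GL_fin n \<Longrightarrow> h \<in> GL_fin n \<Longrightarrow> distr \<mu> borel (\<lambda>M. g \<odot> M \<odot> h) = \<mu>"
  shows "invariant_prob \<mu>"
  unfolding invariant_prob_def
proof (intro conjI ballI assms(1,2))
  fix g h :: "'a inf_mat" assume "g \<in> GL_inf" "h \<in> GL_inf"
  then obtain n where "g \<in> GL_fin n" "GL_inverse h \<in> GL_fin n"
    by (rule GL_action_obtain)
  then have "distr \<mu> borel (\<lambda>M. g \<odot> M \<odot> GL_inverse h) = \<mu>"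
    by (rule assms(3))
  then show "distr \<mu> borel (GL_action g h) = \<mu>"
    unfolding GL_action_def .
qed

lemma norm_integral_le_integral:
  fixes f :: "'b \<Rightarrow> 'c::{banach, second_countable_topology}"
  assumes "f \<in> borel_measurable M" "integrable M g" "AE x in M. norm (f x) \<le> g x"
  shows "norm (\<integral>x. f x \<partial>M) \<le> (\<integral>x. g x \<partial>M)"
proof -
  have "integrable M f"
    using assms(2,1) by (rule Bochner_Integration.integrable_bound) (use assms(3) in \<open>auto elim!:
        eventually_mono\<close>)
  then have "(\<integral>x. norm (f x) \<partial>M) \<le> (\<integral>x. g x \<partial>M)"
    using assms by (intro integral_mono_AE) auto
  then show ?thesis
    using integral_norm_bound[of M f] by linarith
qed

definition rank_one :: "nat \<Rightarrow> 'a \<Rightarrow> (nat \<Rightarrow> 'a) \<Rightarrow> (nat \<Rightarrow> 'a) \<Rightarrow> 'a::nonarch_local_field inf_mat"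
  where "rank_one n c v u = (\<lambda>i j. if i < n \<and> j < n then c * v i * u j else 0)"

definition mat_single :: "nat \<Rightarrow> 'a \<Rightarrow> 'a::nonarch_local_field inf_mat"
  where "mat_single m c = (\<lambda>i j. if i = m \<and> j = m then c else 0)"

definition mat_add :: "'a::nonarch_local_field inf_mat \<Rightarrow> 'a inf_mat \<Rightarrow> 'a inf_mat"  (infixl \<open>\<oplus>\<close> 65)
  where "A \<oplus> B = (\<lambda>i j. A i j + B i j)"

lemma mat_add_apply [simp]: "(A \<oplus> B) i j = A i j + B i j"
  by (simp add: mat_add_def)

lemma rank_one_Mat_fin: "rank_one n c v u \<in> Mat_fin n"
  by (auto simp: rank_one_def Mat_fin_def)

lemma mat_single_Mat_fin: "mat_single m c \<in> Mat_fin (Suc m)"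
  by (auto simp: mat_single_def Mat_fin_def)

lemma mat_add_Mat_fin: "A \<in> Mat_fin n \<Longrightarrow> B \<in> Mat_fin n \<Longrightarrow> A \<oplus> B \<in> Mat_fin n"
  by (auto simp: mat_add_def Mat_fin_def)

lemma mat_pairing_add: "mat_pairing n (A \<oplus> B) M = mat_pairing n A M + mat_pairing n B M"
  by (simp add: mat_pairing_def distrib_right sum.distrib)

lemma mat_pairing_rank_one:
  "mat_pairing n (rank_one n c v u) M = bilinear_form n n (mat_scale c M) u v"
  unfolding mat_pairing_def rank_one_def bilinear_form_def
  by (subst sum.swap) (simp add: mult_ac)

text \<open>One pivot matrix turns \<open>v\<close> into the unit vector at \<open>m\<close>, and
  the transpose of another does the same to \<open>u\<close> from the right. Both act as the
  identity on the corner that carries \<open>B\<close>, so only the rank one summand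
  changes.\<close>

lemma rank_one_to_single:
  assumes B: "B \<in> Mat_fin m"
    and u: "\<And>i. u i \<in> integer_ring" "\<exists>p\<in>{m..<n}. \<not> absv (u p) < 1"
    and v: "\<And>i. v i \<in> integer_ring" "\<exists>p\<in>{m..<n}. \<not> absv (v p) < 1"
  shows "\<exists>a\<in>GL_fin n. \<exists>b\<in>GL_fin n. a \<odot> (B \<oplus> rank_one n c v u) \<odot> b = B \<oplus> mat_single m c"
proof -
  obtain p where p: "m \<le> p" "p < n" "absv (v p) = 1"
    using v(2) v(1)[unfolded integer_ring_iff] by (force simp: not_less intro: antisym)
  obtain a where a: "a \<in> GL_fin n" "\<And>i j. j < m \<Longrightarrow> a i j = mat_one i j"
    "\<And>i. i < n \<Longrightarrow> (\<Sum>k<n. a i k * v k) = mat_one i m"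
    by (rule GL_fin_pivot[of n v m p]) (use v(1) p in auto)
  obtain p' where p': "m \<le> p'" "p' < n" "absv (u p') = 1"
    using u(2) u(1)[unfolded integer_ring_iff] by (force simp: not_less intro: antisym)
  obtain b where b: "b \<in> GL_fin n" "\<And>i j. j < m \<Longrightarrow> b i j = mat_one i j"
    "\<And>i. i < n \<Longrightarrow> (\<Sum>k<n. b i k * u k) = mat_one i m"
    by (rule GL_fin_pivot[of n u m p']) (use u(1) p' in auto)
  have m: "m < n" using p by simp
  note a_mult = int_block_mult_left[OF GL_fin_int_block[OF a(1)]]
  note b_mult = int_block_mult_right[OF GL_fin_int_block[OF GL_fin_transpose[OF b(1)]]]
  have Bz: "m \<le> i \<or> m \<le> j \<Longrightarrow> B i j = 0" for i j
    using B by (auto simp: Mat_fin_def)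
  have left: "(a \<odot> (B \<oplus> rank_one n c v u)) i j = B i j + (if i = m \<and> j < n then c * u j else 0)"
      for i j
  proof (cases "i < n")
    case True
    have "(\<Sum>k<n. a i k * B k j) = (\<Sum>k<n. if k = i then B i j else 0)"
    proof (rule sum.cong[OF refl])
      fix k
      show "a i k * B k j = (if k = i then B i j else 0)"
        using a(2)[of k i] Bz[of k j] by (cases "k < m") (auto simp: mat_one_def)
    qed
    also have "\<dots> = B i j" using True by simp
    finally have "(\<Sum>k<n. a i k * B k j) = B i j" .
    moreover have "(\<Sum>k<n. a i k * rank_one n c v u k j)
        = (if j < n then c * u j * (\<Sum>k<n. a i k * v k) else 0)"
      by (auto simp: rank_one_def sum_distrib_left mult_ac intro!: sum.cong)
    ultimately show ?thesis
      using True a(3)[OF True] by (auto simp: a_mult distrib_left sum.distrib mat_one_def)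
  next
    case False
    then show ?thesis
      using m Bz by (auto simp: a_mult rank_one_def)
  qed
  have "(a \<odot> (B \<oplus> rank_one n c v u) \<odot> mat_transpose b) i j = (B \<oplus> mat_single m c) i j" for i j
  proof (cases "j < n")
    case True
    have "(\<Sum>k<n. B i k * b j k) = (\<Sum>k<n. if k = j then B i j else 0)"
    proof (rule sum.cong[OF refl])
      fix k
      show "B i k * b j k = (if k = j then B i j else 0)"
        using b(2)[of k j] Bz[of i k] by (cases "k < m") (auto simp: mat_one_def)
    qed
    also have "\<dots> = B i j" using True by simp
    finally have "(\<Sum>k<n. B i k * b j k) = B i j" .
    moreover have "(\<Sum>k<n. (if i = m \<and> k < n then c * u k else 0) * b j k)
        = (if i = m then c * (\<Sum>k<n. b j k * u k) else 0)"
      by (auto simp: sum_distrib_left mult_ac intro!: sum.cong)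
    ultimately show ?thesis
      using True b(3)[OF True] by (auto simp: b_mult left mat_single_def distrib_right sum.distrib
          mat_one_def)
  next
    case False
    then show ?thesis
      using m Bz by (auto simp: b_mult left mat_single_def)
  qed
  then have "a \<odot> (B \<oplus> rank_one n c v u) \<odot> mat_transpose b = B \<oplus> mat_single m c"
    by (simp add: fun_eq_iff)
  then show ?thesis
    using a(1) GL_fin_transpose[OF b(1)] by blast
qed

section \<open>Averaging over random rank one perturbations\<close>

context normalized_character
begin

lemma char_fun_eq: "A \<in> Mat_fin n \<Longrightarrow> char_fun \<psi> \<mu> A = (\<integral>M. \<psi> (mat_pairing n A M) \<partial>\<mu>)"
  by (simp add: char_fun_def mat_trace_eq_pairing)

lemma norm_char_fun_le: "prob_space \<mu> \<Longrightarrow> norm (char_fun \<psi> \<mu> A) \<le> 1"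
  unfolding char_fun_def by (rule prob_space.norm_integral_le) auto

lemma char_fun_GL:
  assumes \<mu>: "invariant_prob \<mu>" and A: "A \<in> Mat_fin n" and g: "g \<in> GL_fin n" and h: "h \<in> GL_fin n"
  shows "char_fun \<psi> \<mu> (h \<odot> A \<odot> g) = char_fun \<psi> \<mu> A"
proof -
  note blocks = g[THEN GL_fin_int_block] h[THEN GL_fin_int_block]
  have [measurable]: "(\<lambda>M. g \<odot> M \<odot> h) \<in> borel_measurable \<mu>"
    using measurable_GL_mult[OF blocks] \<mu> by (simp add: invariant_prob_def cong:
        measurable_cong_sets)
  have "char_fun \<psi> \<mu> A = (\<integral>M. \<psi> (mat_pairing n A M) \<partial>distr \<mu> borel (\<lambda>M. g \<odot> M \<odot> h))"
    by (simp add: char_fun_eq[OF A] invariant_prob_GL[OF \<mu> g h])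
  also have "\<dots> = (\<integral>M. \<psi> (mat_pairing n A (g \<odot> M \<odot> h)) \<partial>\<mu>)"
    by (rule integral_distr) measurable
  also have "\<dots> = char_fun \<psi> \<mu> (h \<odot> A \<odot> g)"
    unfolding mat_pairing_shift[OF blocks] by (intro char_fun_eq[symmetric] Mat_fin_mult A blocks)
  finally show ?thesis by simp
qed

text \<open>Read off from the integral representation: an iterated integral of a jointly measurable
  character is measurable in the remaining variable.\<close>

lemma measurable_corner_prob [measurable]:
  "(\<lambda>M. corner_prob n p (mat_scale c M)) \<in> borel_measurable borel"
proof -
  have 1: "(\<lambda>(M, v). \<integral>u. \<psi> (bilinear_form n p (mat_scale c M) u v) \<partial>haar_seq)
      \<in> borel_measurable (borel \<Otimes>\<^sub>M haar_seq)"
    unfolding case_prod_unfold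
    by (rule sigma_finite_measure.borel_measurable_lebesgue_integral[OF
        prob_space_imp_sigma_finite[OF prob_space_haar_seq]])
      measurable
  have "(\<lambda>M. complex_of_real (corner_prob n p (mat_scale c M))) \<in> borel_measurable borel"
    unfolding corner_prob_eq_integral
    using sigma_finite_measure.borel_measurable_lebesgue_integral[OF
        prob_space_imp_sigma_finite[OF prob_space_haar_seq] 1]
    by simp
  then have "(\<lambda>M. Re (complex_of_real (corner_prob n p (mat_scale c M)))) \<in> borel_measurable borel"
    by measurable
  then show ?thesis by simp
qed

text \<open>The integral over \<open>M\<close> is moved innermost so that characteristic functions
  appear. The weight \<open>G\<close> is kept general because it is taken to be a character, the
  constant \<open>1\<close>, and in the proof of ergodicity the limit \<open>corner_limit\<close>
  itself.\<close>

lemma integral_mult_corner_prob: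
  fixes G :: "'a inf_mat \<Rightarrow> complex"
  assumes \<mu>: "prob_space \<mu>" and sets_\<mu> [measurable_cong]: "sets \<mu> = sets borel"
    and [measurable]: "G \<in> borel_measurable borel" and bound: "\<And>M. norm (G M) \<le> 1"
  shows "(\<integral>M. G M * complex_of_real (corner_prob n n (mat_scale c M)) \<partial>\<mu>)
    = (\<integral>v. (\<integral>u. (\<integral>M. G M * \<psi> (mat_pairing n (rank_one n c v u) M) \<partial>\<mu>) \<partial>haar_seq) \<partial>haar_seq)"
proof -
  interpret H: prob_space haar_seq by (rule prob_space_haar_seq)
  let ?F = "\<lambda>M v u. G M * \<psi> (bilinear_form n n (mat_scale c M) u v)"
  have F_bound: "norm (?F M v u) \<le> 1" for M v u
    using bound by (simp add: norm_mult)
  have "(\<integral>M. G M * complex_of_real (corner_prob n n (mat_scale c M)) \<partial>\<mu>)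
      = (\<integral>M. (\<integral>v. (\<integral>u. ?F M v u \<partial>haar_seq) \<partial>haar_seq) \<partial>\<mu>)"
    by (simp add: corner_prob_eq_integral)
  also have "\<dots> = (\<integral>v. (\<integral>M. (\<integral>u. ?F M v u \<partial>haar_seq) \<partial>\<mu>) \<partial>haar_seq)"
  proof (rule bounded_Fubini[OF \<mu> prob_space_haar_seq, where B = 1])
    show "(\<lambda>(M, v). \<integral>u. ?F M v u \<partial>haar_seq) \<in> borel_measurable (\<mu> \<Otimes>\<^sub>M haar_seq)"
      unfolding case_prod_unfold by (rule H.borel_measurable_lebesgue_integral) measurable
    show "norm (\<integral>u. ?F M v u \<partial>haar_seq) \<le> 1" for M v
      by (rule H.norm_integral_le) (simp_all add: F_bound)
  qed
  also have "\<dots> = (\<integral>v. (\<integral>u. (\<integral>M. ?F M v u \<partial>\<mu>) \<partial>haar_seq) \<partial>haar_seq)"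
  proof (rule Bochner_Integration.integral_cong[OF refl])
    fix v :: "nat \<Rightarrow> 'a"
    have [measurable]: "(\<lambda>_. v) \<in> measurable N (PiM UNIV (\<lambda>_. borel))"
        for N :: "('a inf_mat \<times> (nat \<Rightarrow> 'a)) measure"
      by (rule measurable_const) (simp add: space_PiM)
    show "(\<integral>M. (\<integral>u. ?F M v u \<partial>haar_seq) \<partial>\<mu>) = (\<integral>u. (\<integral>M. ?F M v u \<partial>\<mu>) \<partial>haar_seq)"
      by (rule bounded_Fubini[OF \<mu> prob_space_haar_seq, where B = 1]) (simp_all add: F_bound)
  qed
  finally show ?thesis
    by (simp add: mat_pairing_rank_one)
qed

text \<open>
  With high probability \<open>u\<close> and \<open>v\<close> have a unit entry beyond the support of \<open>B\<close>, and then
  \<open>B \<oplus> rank_one n c v u\<close> lies in the same orbit as \<open>B \<oplus> mat_single m c\<close>.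
\<close>

lemma integral_character_corner_prob:
  assumes \<mu>: "invariant_prob \<mu>" and B: "B \<in> Mat_fin m" and mn: "m \<le> n"
  shows "norm ((\<integral>M. \<psi> (mat_pairing m B M) * complex_of_real (corner_prob n n (mat_scale c M)) \<partial>\<mu>)
    - char_fun \<psi> \<mu> (B \<oplus> mat_single m c)) \<le> 4 * inverse (real q ^ (n - m))"
proof -
  have sets_\<mu> [measurable_cong]: "sets \<mu> = sets borel" and prob_\<mu>: "prob_space \<mu>"
    using \<mu> by (auto simp: invariant_prob_def)
  interpret \<mu>: prob_space \<mu> by (rule prob_\<mu>)
  interpret H: prob_space haar_seq by (rule prob_space_haar_seq)
  define F where "F v u = char_fun \<psi> \<mu> (B \<oplus> rank_one n c v u)" for v u
  define \<phi> where "\<phi> = char_fun \<psi> \<mu> (B \<oplus> mat_single m c)"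
  have Bn: "B \<in> Mat_fin n" using B Mat_fin_mono[OF mn] by blast
  have F: "F v u = (\<integral>M. \<psi> (mat_pairing n B M) * \<psi> (bilinear_form n n (mat_scale c M) u v) \<partial>\<mu>)"
      for v u
    unfolding F_def
    by (simp only: char_fun_eq[OF mat_add_Mat_fin[OF Bn rank_one_Mat_fin]] mat_pairing_add
        mat_pairing_rank_one character_add)
  have F_measurable [measurable]: "(\<lambda>(v, u). F v u) \<in> borel_measurable (haar_seq \<Otimes>\<^sub>M haar_seq)"
    unfolding F case_prod_unfold
    by (rule \<mu>.borel_measurable_lebesgue_integral) measurable
  have F_bound: "norm (F v u) \<le> 1" for v u
    unfolding F_def by (rule norm_char_fun_le[OF prob_\<mu>])
  have main: "(\<integral>M. \<psi> (mat_pairing m B M) * complex_of_real (corner_prob n n (mat_scale c M)) \<partial>\<mu>)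
      = (\<integral>v. (\<integral>u. F v u \<partial>haar_seq) \<partial>haar_seq)"
    by (subst integral_mult_corner_prob[OF prob_\<mu> sets_\<mu>])
      (simp_all add: F[abs_def] mat_pairing_mono[OF B mn] mat_pairing_rank_one)
  have [simp]: "measure haar_seq UNIV = 1"
    using H.prob_space by simp
  define bad where "bad = {u::nat \<Rightarrow> 'a. \<forall>i\<in>{m..<n}. absv (u i) < 1}"
  have bad_sets [measurable]: "bad \<in> sets haar_seq"
  proof -
    have "{u \<in> space haar_seq. \<forall>i\<in>{m..<n}. inverse \<pi> * u i \<in> integer_ring} \<in> sets haar_seq"
      by measurable
    then show ?thesis by (simp add: bad_def absv_less_1_iff)
  qed
  have [simp]: "integrable haar_seq (indicat_real bad)"
    by (rule H.integrable_bounded[where B = 1]) simp_all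
  have measure_bad: "measure haar_seq bad = inverse (real q ^ (n - m))"
    unfolding bad_def by (subst measure_nonunits) simp_all
  \<comment> \<open>Two characteristic functions differ by at most \<open>2\<close>, and either
    vector may be the bad one; integrating both indicators produces the constant
    \<open>4\<close>.\<close>
  have diff: "norm (F v u - \<phi>) \<le> 2 * indicator bad v + 2 * indicator bad u"
    if "\<forall>i. v i \<in> integer_ring" "\<forall>i. u i \<in> integer_ring" for v u
  proof (cases "v \<in> bad \<or> u \<in> bad")
    case True
    have "norm (F v u - \<phi>) \<le> 1 + 1"
      unfolding \<phi>_def by (intro norm_triangle_le_diff add_mono F_bound norm_char_fun_le prob_\<mu>)
    then show ?thesis using True by (auto simp: indicator_def)
  next
    case False
    then have "\<exists>p\<in>{m..<n}. \<not> absv (u p) < 1" "\<exists>p\<in>{m..<n}. \<not> absv (v p) < 1"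
      by (auto simp: bad_def)
    then have "\<exists>a\<in>GL_fin n. \<exists>b\<in>GL_fin n. a \<odot> (B \<oplus> rank_one n c v u) \<odot> b = B \<oplus> mat_single m c"
      using that by (intro rank_one_to_single[OF B]) auto
    then obtain a b where "a \<in> GL_fin n" "b \<in> GL_fin n"
      "a \<odot> (B \<oplus> rank_one n c v u) \<odot> b = B \<oplus> mat_single m c"
      by blast
    then have "F v u = \<phi>"
      unfolding F_def \<phi>_def using char_fun_GL[OF \<mu> mat_add_Mat_fin[OF Bn rank_one_Mat_fin]] by metis
    then show ?thesis by simp
  qed
  have inner: "norm (\<integral>u. F v u - \<phi> \<partial>haar_seq)
      \<le> 2 * indicator bad v + 2 * inverse (real q ^ (n - m))"
    if v: "\<forall>i. v i \<in> integer_ring" for v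
  proof -
    have "norm (\<integral>u. F v u - \<phi> \<partial>haar_seq) \<le> (\<integral>u. 2 * indicat_real bad v + 2
        * indicat_real bad u \<partial>haar_seq)"
    proof (rule norm_integral_le_integral)
      show "(\<lambda>u. F v u - \<phi>) \<in> borel_measurable haar_seq"
        by measurable
      show "integrable haar_seq (\<lambda>u. 2 * indicat_real bad v + 2 * indicat_real bad u)"
        by (intro Bochner_Integration.integrable_add integrable_mult_right) simp_all
      show "AE u in haar_seq. norm (F v u - \<phi>) \<le> 2 * indicator bad v + 2 * indicator bad u"
        using AE_haar_seq by eventually_elim (rule diff[OF v])
    qed
    also have "\<dots> = 2 * indicator bad v + 2 * inverse (real q ^ (n - m))"
      by (subst Bochner_Integration.integral_add) (simp_all add: measure_bad)
    finally show ?thesis .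
  qed
  have F_int: "integrable haar_seq (F v)" for v
    by (rule H.integrable_bounded[where B = 1]) (simp_all add: F_bound)
  have FF_int: "integrable haar_seq (\<lambda>v. \<integral>u. F v u \<partial>haar_seq)"
    by (rule H.integrable_bounded[where B = 1]) (auto intro!: H.norm_integral_le F_bound)
  have "(\<integral>v. (\<integral>u. F v u \<partial>haar_seq) \<partial>haar_seq) - \<phi> = (\<integral>v. (\<integral>u. F v u - \<phi> \<partial>haar_seq) \<partial>haar_seq)"
    using F_int FF_int by simp
  also have "norm \<dots> \<le> (\<integral>v. 2 * indicator bad v + 2 * inverse (real q ^ (n - m)) \<partial>haar_seq)"
  proof (rule norm_integral_le_integral)
    show "integrable haar_seq (\<lambda>v. 2 * indicator bad v + 2 * inverse (real q ^ (n - m)))"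
      by (intro Bochner_Integration.integrable_add integrable_mult_right) simp_all
    show "AE v in haar_seq. norm (\<integral>u. F v u - \<phi> \<partial>haar_seq)
        \<le> 2 * indicator bad v + 2 * inverse (real q ^ (n - m))"
      using AE_haar_seq by eventually_elim (rule inner)
  qed measurable
  also have "\<dots> = 4 * inverse (real q ^ (n - m))"
    by (subst Bochner_Integration.integral_add) (simp_all add: measure_bad)
  finally show ?thesis
    unfolding main \<phi>_def .
qed

section \<open>The limit of the corner probabilities\<close>

definition corner_limit :: "'a \<Rightarrow> 'a inf_mat \<Rightarrow> real" where
  "corner_limit c M = lim (\<lambda>n. corner_prob n n (mat_scale c M))"

lemma corner_limit: "(\<lambda>n. corner_prob n n (mat_scale c M)) \<longlonglongrightarrow> corner_limit c M"
proof -
  have "decseq (\<lambda>n. corner_prob n n (mat_scale c M))"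
    by (auto simp: decseq_def corner_prob_antimono)
  then obtain L where "(\<lambda>n. corner_prob n n (mat_scale c M)) \<longlonglongrightarrow> L"
    by (rule decseq_convergent[where B = 0]) (auto simp: corner_prob_bounds)
  then have "convergent (\<lambda>n. corner_prob n n (mat_scale c M))"
    by (rule convergentI)
  then show ?thesis
    by (simp add: corner_limit_def convergent_LIMSEQ_iff)
qed

lemma measurable_corner_limit [measurable]: "corner_limit c \<in> borel_measurable borel"
  unfolding corner_limit_def by measurable

lemma corner_limit_bounds: "0 \<le> corner_limit c M" "corner_limit c M \<le> 1"
  using LIMSEQ_le_const[OF corner_limit] LIMSEQ_le_const2[OF corner_limit] corner_prob_bounds
      by blast+

text \<open>As soon as \<open>n\<close> reaches \<open>m\<close>, both factors lie in
  \<open>GL_fin n\<close> and leave the corner probability unchanged, so the two sequences differ in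
  finitely many terms only.\<close>

lemma corner_limit_GL:
  assumes "g \<in> GL_fin m" "h \<in> GL_fin m"
  shows "corner_limit c (g \<odot> M \<odot> h) = corner_limit c M"
proof -
  have "corner_prob n n (mat_scale c (g \<odot> M \<odot> h)) = corner_prob n n (mat_scale c M)" if "m \<le> n"
      for n
  proof -
    have "g \<in> GL_fin n" "h \<in> GL_fin n"
      using assms GL_fin_mono[OF that] by auto
    then show ?thesis
      by (simp add: mat_scale_mult(1)[OF GL_fin_int_block] mat_scale_mult(2)[OF GL_fin_int_block]
          corner_prob_GL_left corner_prob_GL_right)
  qed
  then have "\<forall>\<^sub>F n in sequentially. corner_prob n n (mat_scale c (g \<odot> M \<odot> h))
      = corner_prob n n (mat_scale c M)"
    by (rule eventually_sequentiallyI)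
  then have "(\<lambda>n. corner_prob n n (mat_scale c M)) \<longlonglongrightarrow> corner_limit c (g \<odot> M \<odot> h)"
    using corner_limit[of c "g \<odot> M \<odot> h"] by (simp add: tendsto_cong)
  then show ?thesis
    using corner_limit LIMSEQ_unique by blast
qed

text \<open>One sequence of integrals has two limits: the left side by dominated convergence, the
  right side by the geometric error bound for rank one perturbations.\<close>

lemma character_corner_limit_integral:
  assumes \<mu>: "invariant_prob \<mu>" and B: "B \<in> Mat_fin m"
  shows "(\<integral>M. \<psi> (mat_pairing m B M) * complex_of_real (corner_limit c M) \<partial>\<mu>)
      = char_fun \<psi> \<mu> (B \<oplus> mat_single m c)"
proof -
  have [measurable_cong]: "sets \<mu> = sets borel" and "prob_space \<mu>"
    using \<mu> by (auto simp: invariant_prob_def)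
  interpret prob_space \<mu> by fact
  let ?I = "\<lambda>n. \<integral>M. \<psi> (mat_pairing m B M) * complex_of_real (corner_prob n n (mat_scale c M)) \<partial>\<mu>"
  have "?I \<longlonglongrightarrow> (\<integral>M. \<psi> (mat_pairing m B M) * complex_of_real (corner_limit c M) \<partial>\<mu>)"
  proof (rule integral_dominated_convergence[where w = "\<lambda>_. 1"])
    show "AE M in \<mu>. (\<lambda>n. \<psi> (mat_pairing m B M) * complex_of_real (corner_prob n n (mat_scale c M)))
        \<longlonglongrightarrow> \<psi> (mat_pairing m B M) * complex_of_real (corner_limit c M)"
      by (intro AE_I2 tendsto_intros corner_limit)
    show "AE M in \<mu>. norm (\<psi> (mat_pairing m B M)
        * complex_of_real (corner_prob n n (mat_scale c M))) \<le> 1" for n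
      using corner_prob_bounds by (simp add: norm_mult)
  qed simp_all
  moreover have "?I \<longlonglongrightarrow> char_fun \<psi> \<mu> (B \<oplus> mat_single m c)"
  proof (rule LIM_zero_cancel, rule Lim_null_comparison)
    show "\<forall>\<^sub>F n in sequentially. norm (?I n - char_fun \<psi> \<mu> (B \<oplus> mat_single m c))
        \<le> 4 * inverse (real q) ^ (n - m)"
      using integral_character_corner_prob[OF \<mu> B]
          by (auto simp: eventually_sequentially power_inverse)
    have "(\<lambda>n. inverse (real q) ^ n) \<longlonglongrightarrow> 0"
      using q_real_gt_1 by (intro LIMSEQ_power_zero) (simp add: inverse_less_1_iff)
    then have "(\<lambda>n. inverse (real q) ^ (n - m)) \<longlonglongrightarrow> 0"
      by (rule filterlim_compose) (rule filterlim_minus_const_nat_at_top)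
    then show "(\<lambda>n. 4 * inverse (real q) ^ (n - m)) \<longlonglongrightarrow> 0"
      by (rule tendsto_mult_right_zero)
  qed
  ultimately show ?thesis
    by (rule LIMSEQ_unique)
qed

lemma char_fun_zero: "prob_space \<mu> \<Longrightarrow> char_fun \<psi> \<mu> (\<lambda>i j. 0) = 1"
proof -
  assume \<mu>: "prob_space \<mu>"
  have "char_fun \<psi> \<mu> (\<lambda>i j. 0) = (\<integral>M. 1 \<partial>\<mu>)"
    by (subst char_fun_eq[of _ 0]) (auto simp: Mat_fin_def mat_pairing_def)
  then show ?thesis
    using prob_space.prob_space[OF \<mu>] by simp
qed

text \<open>Almost sure constancy is assumed instead of ergodicity, so that the result also applies
  to a measure conditioned on an invariant event. A diagonal matrix is assembled entry by entry, and
  each new entry contributes the constant that replaces \<open>corner_limit\<close>.\<close>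

lemma char_fun_product:
  assumes \<mu>: "invariant_prob \<mu>"
    and f: "\<And>l. AE M in \<mu>. corner_limit (neg_power \<pi> l) M = f l"
    and A: "A \<in> Mat_inf"
  shows "char_fun \<psi> \<mu> A = complex_of_real (\<Prod>l\<in>#Sing \<pi> A. f l)"
proof -
  have [measurable_cong]: "sets \<mu> = sets borel" and prob_\<mu>: "prob_space \<mu>"
    using \<mu> by (auto simp: invariant_prob_def)
  have step: "char_fun \<psi> \<mu> (B \<oplus> mat_single m (neg_power \<pi> l))
      = char_fun \<psi> \<mu> B * complex_of_real (f l)"
    if B: "B \<in> Mat_fin m" for B m l
  proof -
    have "char_fun \<psi> \<mu> (B \<oplus> mat_single m (neg_power \<pi> l))
        = (\<integral>M. \<psi> (mat_pairing m B M) * complex_of_real (f l) \<partial>\<mu>)"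
      unfolding character_corner_limit_integral[OF \<mu> B, symmetric]
      by (rule integral_cong_AE) (use f[of l] in \<open>auto elim!: eventually_mono\<close>)
    then show ?thesis
      by (simp add: char_fun_eq[OF B])
  qed
  have diag: "diag_mat \<pi> ks \<in> Mat_fin (length ks)" for ks
    by (auto simp: diag_mat_def Mat_fin_def)
  have char_diag: "char_fun \<psi> \<mu> (diag_mat \<pi> ks) = complex_of_real (\<Prod>l\<in>#mset ks. f l)" for ks
  proof (induction ks rule: rev_induct)
    case Nil
    have "diag_mat \<pi> [] = (\<lambda>i j. 0)"
      by (simp add: diag_mat_def)
    then show ?case
      using char_fun_zero[OF prob_\<mu>] by simp
  next
    case (snoc l ks)
    have "diag_mat \<pi> (ks @ [l]) = diag_mat \<pi> ks \<oplus> mat_single (length ks) (neg_power \<pi> l)"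
      by (auto simp: fun_eq_iff diag_mat_def mat_add_def mat_single_def nth_append)
    then show ?case
      using step[OF diag, of ks l] by (simp only: snoc.IH mset_append image_mset_union
          prod_mset_Un of_real_mult) simp
  qed
  obtain n a b ks where *: "A \<in> Mat_fin n" "a \<in> GL_fin n" "b \<in> GL_fin n" "length ks = n"
    "A = a \<odot> diag_mat \<pi> ks \<odot> b" "Sing \<pi> A = mset ks"
    by (rule Sing_decomposition[OF A])
  have "diag_mat \<pi> ks \<in> Mat_fin n"
    using diag[of ks] by (simp add: *(4))
  then show ?thesis
    using char_fun_GL[OF \<mu> _ *(3,2)] char_diag[of ks] *(5,6) by simp
qed

end


section \<open>Uniqueness of measures\<close>

lemma inf_mat_tendstoI:
  fixes X :: "nat \<Rightarrow> 'a::nonarch_local_field inf_mat"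
  assumes "\<And>i j. (\<lambda>n. X n i j) \<longlonglongrightarrow> M i j"
  shows "X \<longlonglongrightarrow> M"
proof -
  have 1: "(\<lambda>n. f n) \<longlonglongrightarrow> g" if "\<And>i. (\<lambda>n. f n i) \<longlonglongrightarrow> g i"
    for f :: "nat \<Rightarrow> nat \<Rightarrow> 'c::topological_space" and g
  proof -
    have "limitin (product_topology (\<lambda>_. euclidean) UNIV) f g sequentially"
      using that by (simp add: limitin_componentwise)
    then show ?thesis
      by (simp add: euclidean_product_topology)
  qed
  show ?thesis
    by (intro 1 assms)
qed

context normalized_character
begin

text \<open>A coset of the matrices whose \<open>n\<close>-corner is divisible by
  \<open>\<pi> ^ n\<close>. Two such boxes are nested or disjoint, and the boxes around a point form
  a neighbourhood base.\<close>

definition coset_box :: "nat \<Rightarrow> 'a inf_mat \<Rightarrow> 'a inf_mat set" where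
  "coset_box n X = {M. \<forall>i<n. \<forall>j<n. inverse \<pi> ^ n * (M i j - X i j) \<in> integer_ring}"

lemma coset_box_self: "M \<in> coset_box n M"
  by (simp add: coset_box_def)

lemma coset_box_mono:
  assumes "m \<le> n"
  shows "coset_box n X \<subseteq> coset_box m X"
proof
  fix M assume M: "M \<in> coset_box n X"
  have "inverse \<pi> ^ m * (M i j - X i j) \<in> integer_ring" if "i < m" "j < m" for i j
  proof -
    have "\<pi> ^ (n - m) \<in> integer_ring"
      using absv_uniformizer_less_1 by (simp add: integer_ring_iff absv_power power_le_one)
    moreover have "inverse \<pi> ^ n * (M i j - X i j) \<in> integer_ring"
      using M that assms by (simp add: coset_box_def)
    ultimately have "\<pi> ^ (n - m) * (inverse \<pi> ^ n * (M i j - X i j)) \<in> integer_ring"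
      by (rule integer_ring_mult)
    moreover have "\<pi> ^ (n - m) * inverse \<pi> ^ n = inverse \<pi> ^ m"
      using assms by (simp add: power_inverse power_diff field_simps)
    ultimately show ?thesis
      by (simp add: mult.assoc[symmetric])
  qed
  then show "M \<in> coset_box m X"
    by (simp add: coset_box_def)
qed

lemma coset_box_eq:
  assumes "M \<in> coset_box n X"
  shows "coset_box n M = coset_box n X"
proof -
  have "inverse \<pi> ^ n * (N i j - M i j) \<in> integer_ring
      \<longleftrightarrow> inverse \<pi> ^ n * (N i j - X i j) \<in> integer_ring"
    if "i < n" "j < n" for N i j
  proof -
    have M: "inverse \<pi> ^ n * (M i j - X i j) \<in> integer_ring"
      using assms that by (simp add: coset_box_def)
    have eq: "inverse \<pi> ^ n * (N i j - X i j) = inverse \<pi> ^ n * (N i j - M i j) + inverse \<pi> ^ n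
        * (M i j - X i j)"
      by (simp add: algebra_simps)
    show ?thesis
      using M integer_ring_add[OF _ M] integer_ring_diff[OF _ M] unfolding eq
          by (metis add_diff_cancel)
  qed
  then show ?thesis
    by (auto simp: coset_box_def)
qed

lemma open_integer_ring: "open (integer_ring :: 'a set)"
proof -
  have "absv (\<pi> * x) < 1 \<longleftrightarrow> x \<in> integer_ring" for x
    by (simp add: absv_less_1_iff mult.assoc[symmetric])
  moreover have "dist 0 x = absv x" for x :: 'a
    by (simp only: absv_eq_dist dist_commute)
  ultimately have "(integer_ring :: 'a set) = (\<lambda>x. \<pi> * x) -` ball 0 1"
    by (intro set_eqI) (simp only: vimage_eq mem_ball)
  also have "open \<dots>"
    by (intro open_vimage open_ball continuous_intros)
  finally show ?thesis .
qed

lemma open_coset_box: "open (coset_box n X)"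
proof -
  have "continuous_on UNIV (\<lambda>M::'a inf_mat. M i j)" for i j
  proof -
    have 1: "continuous_on UNIV (\<lambda>M::'a inf_mat. M i)"
        and 2: "continuous_on UNIV (\<lambda>x::nat \<Rightarrow> 'a. x j)"
      by (rule continuous_on_product_coordinates)+
    show ?thesis
      by (rule continuous_on_compose2[OF 2 1 subset_UNIV])
  qed
  then have "open ((\<lambda>M. inverse \<pi> ^ n * (M i j - X i j)) -` integer_ring)" for i j
    by (intro open_vimage open_integer_ring continuous_on_mult' continuous_on_diff
        continuous_on_const)
  then have "open (\<Inter>i\<in>{..<n}. \<Inter>j\<in>{..<n}. (\<lambda>M. inverse \<pi> ^ n * (M i j - X i j)) -` integer_ring)"
    by (intro open_INT ballI) auto
  also have "(\<Inter>i\<in>{..<n}. \<Inter>j\<in>{..<n}. (\<lambda>M. inverse \<pi> ^ n * (M i j - X i j)) -` integer_ring)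
      = coset_box n X"
    by (rule set_eqI) (auto simp: coset_box_def)
  finally show ?thesis .
qed

text \<open>Otherwise points outside \<open>U\<close> can be chosen in the shrinking boxes around
  \<open>M\<close>. The entry at \<open>i\<close>, \<open>j\<close> is controlled once
  \<open>n\<close> exceeds both indices, so these points converge to \<open>M\<close> entrywise and
  must enter \<open>U\<close>.\<close>

lemma coset_box_basis:
  assumes U: "open U" "M \<in> U"
  shows "\<exists>n. coset_box n M \<subseteq> U"
proof (rule ccontr)
  assume "\<not> ?thesis"
  then have "\<exists>N. N \<in> coset_box n M \<and> N \<notin> U" for n
    by blast
  then obtain X where X: "\<And>n. X n \<in> coset_box n M" "\<And>n. X n \<notin> U"
    by metis
  have "(\<lambda>n. X n i j) \<longlonglongrightarrow> M i j" for i j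
  proof (rule tendsto_dist_iff[THEN iffD2], rule tendsto_sandwich[OF _ _ tendsto_const])
    show "\<forall>\<^sub>F n in sequentially. dist (X n i j) (M i j) \<le> absv \<pi> ^ n"
      using eventually_gt_at_top[of "max i j"]
    proof eventually_elim
      case (elim n)
      then have "inverse \<pi> ^ n * (X n i j - M i j) \<in> integer_ring"
        using X(1)[of n] by (simp add: coset_box_def)
      then show ?case
        using absv_pos_iff[of \<pi>]
        by (simp add: dist_absv integer_ring_iff absv_mult absv_power absv_inverse absv_divide
            power_inverse divide_simps
            mult.commute del: absv_pos_iff)
    qed
    show "(\<lambda>n. absv \<pi> ^ n) \<longlonglongrightarrow> 0"
      using absv_uniformizer_less_1 by (intro LIMSEQ_power_zero) simp
  qed auto
  then have "X \<longlonglongrightarrow> M"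
    by (rule inf_mat_tendstoI)
  then have "\<forall>\<^sub>F n in sequentially. X n \<in> U"
    using U by (rule topological_tendstoD)
  then show False
    using X(2) by (simp add: eventually_sequentially)
qed

text \<open>Fourier inversion on a box: membership is integrality of finitely many numbers, whose
  indicator is an average of characters. Through \<open>prod_encode\<close> a uniform vector serves
  as a uniform matrix, with its indices transposed to match the trace.\<close>

lemma measure_coset_box:
  assumes \<mu>: "prob_space \<mu>" and sets_\<mu> [measurable_cong]: "sets \<mu> = sets borel"
  shows "complex_of_real (measure \<mu> (coset_box n X))
    = (\<integral>u. \<psi> (\<Sum>k\<in>prod_encode ` ({..<n} \<times> {..<n}). - (inverse \<pi> ^ n * X (fst (prod_decode k)) (snd
        (prod_decode k))) * u k)
        * char_fun \<psi> \<mu> (\<lambda>j i. if i < n \<and> j < n then inverse \<pi> ^ n * u (prod_encode (i, j)) else 0)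
            \<partial>haar_seq)"
proof -
  interpret \<mu>: prob_space \<mu> by fact
  interpret H: prob_space haar_seq by (rule prob_space_haar_seq)
  define J where "J = prod_encode ` ({..<n} \<times> {..<n})"
  define A where "A u = (\<lambda>j i. if i < n \<and> j < n then inverse \<pi> ^ n
      * u (prod_encode (i, j)) else 0)" for u :: "nat \<Rightarrow> 'a"
  have A: "A u \<in> Mat_fin n" for u
    by (auto simp: A_def Mat_fin_def)
  define c where "c u = (\<Sum>k\<in>J. - (inverse \<pi> ^ n * X (fst (prod_decode k)) (snd (prod_decode k)))
      * u k)" for u :: "nat \<Rightarrow> 'a"
  have pairing: "mat_pairing n (A u) M = (\<Sum>k\<in>J. inverse \<pi> ^ n
      * M (fst (prod_decode k)) (snd (prod_decode k)) * u k)" for u M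
  proof -
    have "mat_pairing n (A u) M = (\<Sum>(i, j)\<in>{..<n} \<times> {..<n}. inverse \<pi> ^ n * M i j
        * u (prod_encode (i, j)))"
      unfolding mat_pairing_def
      by (subst sum.swap) (auto simp: A_def sum.cartesian_product mult_ac intro!: sum.cong)
    also have "\<dots> = (\<Sum>k\<in>J. inverse \<pi> ^ n * M (fst (prod_decode k)) (snd (prod_decode k)) * u k)"
      unfolding J_def by (subst sum.reindex) (auto simp: inj_prod_encode case_prod_unfold)
    finally show ?thesis .
  qed
  have comb: "c u + mat_pairing n (A u) M = (\<Sum>k\<in>J. inverse \<pi> ^ n
      * (M (fst (prod_decode k)) (snd (prod_decode k)) - X (fst (prod_decode k)) (snd (prod_decode
          k))) * u k)" for u M
    unfolding pairing c_def by (simp add: sum.distrib[symmetric] algebra_simps)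
  have [measurable]: "(\<lambda>u. c u) \<in> borel_measurable haar_seq"
    unfolding c_def by measurable
  have [measurable]: "(\<lambda>x. fst x i j) \<in> borel_measurable (\<mu> \<Otimes>\<^sub>M haar_seq)" for i j
    by (rule measurable_inf_mat_entry) simp
  have meas: "(\<lambda>x. mat_pairing n (A (snd x)) (fst x)) \<in> borel_measurable (\<mu> \<Otimes>\<^sub>M haar_seq)"
    unfolding pairing by measurable
  have "complex_of_real (measure \<mu> (coset_box n X))
      = (\<integral>M. complex_of_real (indicator (coset_box n X) M) \<partial>\<mu>)"
    using open_coset_box by (simp add: \<mu>.emeasure_eq_measure sets_\<mu>)
  also have "\<dots> = (\<integral>M. (\<integral>u. \<psi> (c u + mat_pairing n (A u) M) \<partial>haar_seq) \<partial>\<mu>)"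
  proof (rule Bochner_Integration.integral_cong[OF refl])
    fix M
    have "M \<in> coset_box n X \<longleftrightarrow> (\<forall>k\<in>J. inverse \<pi> ^ n
        * (M (fst (prod_decode k)) (snd (prod_decode k)) - X (fst (prod_decode k)) (snd
            (prod_decode k))) \<in> integer_ring)"
      by (auto simp: coset_box_def J_def)
    then show "complex_of_real (indicator (coset_box n X) M)
        = (\<integral>u. \<psi> (c u + mat_pairing n (A u) M) \<partial>haar_seq)"
      unfolding comb by (subst integral_character_haar_seq) (auto simp: J_def indicator_def)
  qed
  also have "\<dots> = (\<integral>u. (\<integral>M. \<psi> (c u + mat_pairing n (A u) M) \<partial>\<mu>) \<partial>haar_seq)"
  proof (rule bounded_Fubini[where B = 1])
    note meas[measurable]
    show "(\<lambda>(M, u). \<psi> (c u + mat_pairing n (A u) M)) \<in> borel_measurable (\<mu> \<Otimes>\<^sub>M haar_seq)"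
      unfolding case_prod_unfold by measurable
  qed (auto intro: \<mu> prob_space_haar_seq)
  also have "\<dots> = (\<integral>u. \<psi> (c u) * char_fun \<psi> \<mu> (A u) \<partial>haar_seq)"
    by (simp add: character_add char_fun_eq[OF A])
  finally show ?thesis
    by (simp add: c_def A_def J_def)
qed

lemma char_fun_inject:
  assumes \<mu>: "prob_space \<mu>" "sets \<mu> = sets borel" and \<nu>: "prob_space \<nu>" "sets \<nu> = sets borel"
    and eq: "\<And>A. A \<in> Mat_inf \<Longrightarrow> char_fun \<psi> \<mu> A = char_fun \<psi> \<nu> A"
  shows "\<mu> = \<nu>"
proof -
  interpret \<mu>: prob_space \<mu> by fact
  interpret \<nu>: prob_space \<nu> by fact
  define E where "E = insert {} {coset_box n X | n X. True}"
  have box_E: "coset_box n X \<in> E" for n X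
    by (auto simp: E_def)
  have "(\<lambda>j i. if i < n \<and> j < n then inverse \<pi> ^ n * u (prod_encode (i, j)) else 0) \<in> Mat_inf"
      for n u
    unfolding Mat_inf_eq by (auto simp: Mat_fin_def intro!: exI[of _ n])
  then have "complex_of_real (measure \<mu> (coset_box n X))
      = complex_of_real (measure \<nu> (coset_box n X))" for n X
    unfolding measure_coset_box[OF \<mu>] measure_coset_box[OF \<nu>] by (simp add: eq)
  then have box_meas: "measure \<mu> (coset_box n X) = measure \<nu> (coset_box n X)" for n X
    unfolding of_real_eq_iff .
  have sets: "sets borel = sigma_sets UNIV E"
  proof
    show "sigma_sets UNIV E \<subseteq> sets borel"
    proof (rule sets.sigma_sets_subset[of E borel, simplified])
      show "E \<subseteq> sets borel"
        using open_coset_box by (auto simp: E_def)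
    qed
    have "U \<in> sigma_sets UNIV E" if "open U" for U :: "'a inf_mat set"
    proof -
      define F where "F = {V \<in> E. V \<subseteq> U}"
      have "open V" if "V \<in> F" for V
        using that open_coset_box by (auto simp: F_def E_def)
      then obtain F' where F': "F' \<subseteq> F" "countable F'" "\<Union>F' = \<Union>F"
        using Lindelof[of F] by metis
      have "\<Union>F = U"
      proof
        show "U \<subseteq> \<Union>F"
        proof
          fix M assume "M \<in> U"
          then obtain n where "coset_box n M \<subseteq> U"
            using coset_box_basis[OF \<open>open U\<close>] by blast
          then show "M \<in> \<Union>F"
            using coset_box_self[of M n] box_E[of n M] by (auto simp: F_def)
        qed
      qed (auto simp: F_def)
      moreover have "\<Union>F' \<in> sigma_sets UNIV E"
        using F' by (intro sigma_sets_UNION) (auto simp: F_def)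
      ultimately show ?thesis
        using F'(3) by simp
    qed
    then show "sets borel \<subseteq> sigma_sets UNIV E"
      unfolding sets_borel by (intro sigma_sets_mono) auto
  qed
  \<comment> \<open>Boxes with index \<open>0\<close> impose no condition and are the whole space,
    so a constant sequence of generators exhausts it.\<close>
  show ?thesis
  proof (rule measure_eqI_generator_eq[where E = E and \<Omega> = UNIV
      and A = "\<lambda>_. coset_box 0 undefined"])
    show "Int_stable E"
    proof (rule Int_stableI)
      fix a b assume ab: "a \<in> E" "b \<in> E"
      show "a \<inter> b \<in> E"
      proof (cases "a \<inter> b = {}")
        case True
        then show ?thesis by (simp add: E_def)
      next
        case False
        then obtain M where M: "M \<in> a" "M \<in> b" by blast
        then obtain m n X Y where "a = coset_box m X" "b = coset_box n Y"
          using ab by (auto simp: E_def)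
        then have "a = coset_box m M" "b = coset_box n M"
          using M coset_box_eq by auto
        then have "a \<inter> b = coset_box (max m n) M"
          using coset_box_mono[of m n M] coset_box_mono[of n m M] by (auto simp: max_def)
        then show ?thesis
          by (simp add: box_E)
      qed
    qed
    show "emeasure \<mu> X = emeasure \<nu> X" if "X \<in> E" for X
      using that by (auto simp: E_def \<mu>.emeasure_eq_measure \<nu>.emeasure_eq_measure box_meas)
    show "range (\<lambda>_. coset_box 0 undefined) \<subseteq> E"
      using box_E by blast
  qed (auto simp: \<mu>(2) \<nu>(2) sets coset_box_def)
qed

end


section \<open>Compactness of weakly decreasing sequences\<close>

text \<open>Taking the mean as threshold shows that the variable lies almost surely on one side of
  its own mean; a difference of constant sign with integral 0 vanishes almost surely.\<close>

lemma prob_space_zero_one_const: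
  fixes X :: "'a \<Rightarrow> real"
  assumes "prob_space M" and X: "X \<in> borel_measurable M" "\<And>x. x \<in> space M \<Longrightarrow> \<bar>X x\<bar> \<le> B"
    and zero_one: "\<And>r. measure M {x \<in> space M. X x < r} = 0 \<or> measure M {x \<in> space M. X x < r} = 1"
  shows "AE x in M. X x = (\<integral>x. X x \<partial>M)"
proof -
  interpret prob_space M by fact
  define f where "f = (\<integral>x. X x \<partial>M)"
  have int: "integrable M X"
    using X by (intro integrable_bounded[where B = B]) auto
  consider "AE x in M. f - X x \<ge> 0" | "AE x in M. X x - f \<ge> 0"
  proof (cases "measure M {x \<in> space M. X x < f} = 0")
    case True
    then have "AE x in M. \<not> X x < f"
      using X(1) by (subst (asm) prob_eq_0) simp_all
    then have "AE x in M. X x - f \<ge> 0"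
      by eventually_elim simp
    then show ?thesis by (rule that(2))
  next
    case False
    then have "AE x in M. X x < f"
      using zero_one[of f] X(1) by (subst (asm) prob_eq_1) simp_all
    then have "AE x in M. f - X x \<ge> 0"
      by eventually_elim simp
    then show ?thesis by (rule that(1))
  qed
  then have "AE x in M. X x = f"
  proof cases
    case 1
    have "(\<integral>x. f - X x \<partial>M) = 0"
      using int by (simp add: prob_space f_def)
    then show ?thesis
      using integral_nonneg_eq_0_iff_AE[of M "\<lambda>x. f - X x"] 1 int by (auto elim!: eventually_mono)
  next
    case 2
    have "(\<integral>x. X x - f \<partial>M) = 0"
      using int by (simp add: prob_space f_def)
    then show ?thesis
      using integral_nonneg_eq_0_iff_AE[of M "\<lambda>x. X x - f"] 2 int by (auto elim!: eventually_mono)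
  qed
  then show ?thesis by (simp add: f_def)
qed

text \<open>Of a predicate and its negation at least one holds infinitely often along any given
  sequence; a diagonal subsequence settles countably many predicates at once.\<close>

lemma subseq_decides:
  fixes Q :: "nat \<Rightarrow> nat \<Rightarrow> bool"
  obtains r :: "nat \<Rightarrow> nat" where "strict_mono r"
    "\<forall>k. (\<forall>\<^sub>F n in sequentially. Q k (r n)) \<or> (\<forall>\<^sub>F n in sequentially. \<not> Q k (r n))"
proof -
  interpret subseqs "\<lambda>k s. (\<forall>n. Q k (s n)) \<or> (\<forall>n. \<not> Q k (s n))"
  proof
    fix k and s :: "nat \<Rightarrow> nat" assume "strict_mono s"
    show "\<exists>r'::nat \<Rightarrow> nat. strict_mono r' \<and> ((\<forall>n. Q k ((s \<circ> r') n)) \<or> (\<forall>n. \<not> Q k ((s \<circ> r') n)))"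
    proof (cases "infinite {n. Q k (s n)}")
      case True
      then obtain r :: "nat \<Rightarrow> nat" where "strict_mono r" "\<forall>n. r n \<in> {n. Q k (s n)}"
        using infinite_enumerate by blast
      then show ?thesis
        by (intro exI[of _ r]) simp
    next
      case False
      then have "infinite {n. \<not> Q k (s n)}"
        using finite_Collect_not[of "\<lambda>n. Q k (s n)"] infinite_UNIV_nat by auto
      then obtain r :: "nat \<Rightarrow> nat" where "strict_mono r" "\<forall>n. r n \<in> {n. \<not> Q k (s n)}"
        using infinite_enumerate by blast
      then show ?thesis
        by (intro exI[of _ r]) simp
    qed
  qed
  have "(\<forall>\<^sub>F n in sequentially. Q k (diagseq n)) \<or> (\<forall>\<^sub>F n in sequentially. \<not> Q k (diagseq n))" for k
  proof -
    have "(\<forall>n. Q k ((diagseq \<circ> (+) (Suc k)) n)) \<or> (\<forall>n. \<not> Q k ((diagseq \<circ> (+) (Suc k)) n))"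
      by (rule diagseq_holds) auto
    then have "(\<forall>\<^sub>F n in sequentially. Q k (diagseq (n + Suc k)))
        \<or> (\<forall>\<^sub>F n in sequentially. \<not> Q k (diagseq (n + Suc k)))"
      by (auto simp: add.commute)
    then show ?thesis
      using eventually_sequentially_seg[of "\<lambda>n. Q k (diagseq n)" "Suc k"]
        eventually_sequentially_seg[of "\<lambda>n. \<not> Q k (diagseq n)" "Suc k"] by simp
  qed
  with subseq_diagseq show ?thesis using that by blast
qed

text \<open>The hinge function counts the integer thresholds from \<open>1 - l\<close> on that
  \<open>x\<close> reaches. The upper bound \<open>T\<close> leaves finitely many of them, so once
  each comparison is eventually decided, the hinge function is eventually constant.\<close>

lemma trunc_add_eq_card:
  assumes "x \<le> Some T"
  shows "nat (trunc_add x (Some l)) = card {t \<in> {1 - l..T}. Some t \<le> x}"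
proof (cases x)
  case (Some a)
  have "{t \<in> {1 - l..T}. Some t \<le> x} = {1 - l..a}"
    using assms Some by auto
  then show ?thesis
    using Some by simp
qed simp

lemma trunc_add_nonneg: "0 \<le> trunc_add x y"
  by (cases "(x, y)" rule: trunc_add.cases) auto

lemma trunc_add_Some_eq_0: "\<not> Some (1 - l) \<le> x \<Longrightarrow> trunc_add x (Some l) = 0"
  by (cases x) auto

lemma trunc_add_Some_ge_1: "Some (1 - l) \<le> x \<Longrightarrow> 1 \<le> trunc_add x (Some l)"
  by (cases x) auto

lemma sing_factor_finite:
  assumes "1 < q" "\<And>j. J \<le> j \<Longrightarrow> trunc_add (k j) l = 0"
  shows "sing_factor q k l = inverse (real q ^ (\<Sum>j<J. nat (trunc_add (k j) l)))"
proof -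
  define N where "N = (\<Sum>j<J. nat (trunc_add (k j) l))"
  have "(\<Sum>j. ereal (real_of_int (trunc_add (k j) l)))
      = (\<Sum>j<J. ereal (real_of_int (trunc_add (k j) l)))"
    using assms(2) by (intro suminf_finite) auto
  also have "\<dots> = ereal (real N)"
    by (simp add: trunc_add_nonneg N_def)
  finally have "sing_factor q k l = inverse (exp (real N * ln (real q)))"
    by (simp add: sing_factor_def exp_ereal_def exp_minus mult.commute)
  also have "\<dots> = inverse (real q ^ N)"
    using assms(1) by (simp add: exp_of_nat_mult)
  finally show ?thesis
    by (simp add: N_def)
qed

text \<open>Infinitely many contributions of at least 1 make the series infinite, and
  \<open>exp_ereal\<close> is \<open>0\<close> at minus infinity.\<close>

lemma sing_factor_infinite:
  assumes "1 < q" "\<And>j. 1 \<le> trunc_add (k j) l"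
  shows "sing_factor q k l = 0"
proof -
  have "ereal (real N) \<le> (\<Sum>j. ereal (real_of_int (trunc_add (k j) l)))" for N
  proof -
    have "ereal (real N) = (\<Sum>j<N. ereal 1)"
      by simp
    also have "\<dots> \<le> (\<Sum>j<N. ereal (real_of_int (trunc_add (k j) l)))"
      using assms(2) by (intro sum_mono) simp
    also have "\<dots> \<le> (\<Sum>j. ereal (real_of_int (trunc_add (k j) l)))"
      by (rule suminf_upper) (simp add: trunc_add_nonneg)
    finally show ?thesis .
  qed
  then have "(\<Sum>j. ereal (real_of_int (trunc_add (k j) l))) = \<infinity>"
    by (intro ereal_top) (meson order_trans real_arch_simple ereal_less_eq(3))
  then show ?thesis
    using assms(1) by (simp add: sing_factor_def exp_ereal_def)
qed

text \<open>A downward closed set of integers bounded above is either a ray, encoded by its greatest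
  element, or empty, encoded by \<open>None\<close>. It is used to build an entry of a sequence from
  its comparisons with integers.\<close>

lemma int_greatest:
  fixes P :: "int \<Rightarrow> bool"
  assumes down: "\<And>s t. P t \<Longrightarrow> s \<le> t \<Longrightarrow> P s" and top: "\<And>t. P t \<Longrightarrow> t \<le> T"
  shows "\<exists>x. \<forall>t. Some t \<le> x \<longleftrightarrow> P t"
proof (cases "\<exists>t. P t")
  case True
  then obtain t0 where t0: "P t0" by blast
  have "\<exists>g. P g \<and> \<not> P (g + 1)"
  proof (rule ccontr)
    assume "\<not> ?thesis"
    then have "P t \<Longrightarrow> P (t + 1)" for t by blast
    then have "P (max t0 (T + 1))"
      using int_ge_induct[of t0 "max t0 (T + 1)" P] t0 by simp
    then show False
      using top by fastforce
  qed
  then obtain g where g: "P g" "\<not> P (g + 1)" by blast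
  have "P t \<longleftrightarrow> t \<le> g" for t
    using down[of g t] down[of t "g + 1"] g by fastforce
  then show ?thesis
    by (intro exI[of _ "Some g"]) simp
qed (auto intro: exI[of _ None])

text \<open>The bound \<open>T\<close> prevents entries from escaping to infinity, whereas escape to
  minus infinity is the admissible limit \<open>None\<close>. Each limit entry is read off from the
  comparisons \<open>Some t \<le> K n j\<close> along a subsequence that eventually decides all of
  them.\<close>

lemma Delta_compactness:
  fixes K :: "nat \<Rightarrow> nat \<Rightarrow> int option" and f :: "int \<Rightarrow> real"
  assumes q: "1 < q"
    and K: "\<And>n. antimono (K n)" "\<And>n j. L n \<le> j \<Longrightarrow> K n j = None" "\<And>n j. K n j \<le> Some T"
    and lim: "\<And>l. (\<lambda>n. inverse (real q ^ (\<Sum>j<L n. nat (trunc_add (K n j) (Some l))))) \<longlonglongrightarrow> f l"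
  shows "\<exists>k\<in>Delta. \<forall>l. f l = sing_factor q k (Some l)"
proof -
  obtain r where r: "strict_mono r"
    "\<forall>i. (\<forall>\<^sub>F n in sequentially. case from_nat i of (j, t) \<Rightarrow> Some t \<le> K (r n) j) \<or>
      (\<forall>\<^sub>F n in sequentially. \<not> (case from_nat i of (j, t) \<Rightarrow> Some t \<le> K (r n) j))"
    by (rule subseq_decides[of "\<lambda>i n. case from_nat i of (j :: nat, t :: int) \<Rightarrow> Some t \<le> K n j"])
  define S where "S n l = (\<Sum>j<L (r n). nat (trunc_add (K (r n) j) (Some l)))" for n l
  define P where "P j t \<longleftrightarrow> (\<forall>\<^sub>F n in sequentially. Some t \<le> K (r n) j)" for j t
  have decide: "\<forall>\<^sub>F n in sequentially. Some t \<le> K (r n) j \<longleftrightarrow> P j t" for j t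
  proof (cases "P j t")
    case True
    then show ?thesis by (simp add: P_def)
  next
    case False
    then have "\<forall>\<^sub>F n in sequentially. \<not> Some t \<le> K (r n) j"
      using r(2)[rule_format, of "to_nat (j, t)"] by (simp add: P_def)
    then show ?thesis
      by eventually_elim (simp add: False)
  qed
  have "\<exists>x. \<forall>t. Some t \<le> x \<longleftrightarrow> P j t" for j
  proof (rule int_greatest)
    show "P j s" if "P j t" "s \<le> t" for s t
      using that unfolding P_def by (auto elim!: eventually_mono intro: order_trans[of _ "Some t"])
    show "t \<le> T" if "P j t" for t
    proof -
      have "\<exists>n. Some t \<le> K (r n) j"
        using that eventually_happens unfolding P_def by fastforce
      then have "Some t \<le> Some T"
        using K(3) order_trans by blast
      then show ?thesis by simp
    qed
  qed
  then obtain k where k: "\<And>j t. Some t \<le> k j \<longleftrightarrow> P j t"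
    by metis
  have P_anti: "P i t" if "P j t" "i \<le> j" for i j t
    using that(1) antimonoD[OF K(1) that(2)] unfolding P_def
    by (auto elim!: eventually_mono intro: order_trans)
  have "antimono k"
  proof (rule antimonoI)
    fix i j :: nat assume "i \<le> j"
    show "k j \<le> k i"
    proof (cases "k j")
      case (Some g)
      then have "P j g" using k[of g j] by simp
      then show ?thesis using k[of g i] P_anti \<open>i \<le> j\<close> Some by simp
    qed simp
  qed
  have k_T: "k j \<le> Some T" for j
  proof (cases "k j")
    case (Some g)
    then have "P j g" using k[of g j] by simp
    then obtain n where "Some g \<le> K (r n) j"
      unfolding P_def using eventually_happens by fastforce
    then have "Some g \<le> Some T"
      using K(3)[of "r n" j] by (rule order_trans)
    then show ?thesis using Some by simp
  qed simp
  have trunc: "\<forall>\<^sub>F n in sequentially. nat (trunc_add (K (r n) j) (Some l))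
      = nat (trunc_add (k j) (Some l))" for j l
  proof -
    have "\<forall>\<^sub>F n in sequentially. \<forall>t\<in>{1 - l..T}. Some t \<le> K (r n) j \<longleftrightarrow> P j t"
      using decide by (intro eventually_ball_finite) auto
    then show ?thesis
    proof eventually_elim
      case (elim n)
      then have "{t \<in> {1 - l..T}. Some t \<le> K (r n) j} = {t \<in> {1 - l..T}. Some t \<le> k j}"
        by (auto simp: k)
      then show ?case
        by (simp add: trunc_add_eq_card[OF K(3)] trunc_add_eq_card[OF k_T])
    qed
  qed
  have lim_r: "(\<lambda>n. inverse (real q ^ S n l)) \<longlonglongrightarrow> f l" for l
    using LIMSEQ_subseq_LIMSEQ[OF lim r(1)] by (simp add: o_def S_def)
  \<comment> \<open>The limit passes through the sum over positions in two ways. If position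
    \<open>J\<close> eventually contributes nothing, then by monotonicity neither does any later
    one, and the sum is a finite one of fixed length. Otherwise every position eventually
    contributes at least 1, the sums exceed every bound, and both sides are
    \<open>0\<close>.\<close>
  have "f l = sing_factor q k (Some l)" for l
  proof (cases "\<exists>J. \<not> P J (1 - l)")
    case True
    then obtain J where J: "\<not> P J (1 - l)" by blast
    have "\<forall>\<^sub>F n in sequentially. \<not> Some (1 - l) \<le> K (r n) J"
      using decide[of "1 - l" J] J by (auto elim: eventually_mono)
    moreover have "\<forall>\<^sub>F n in sequentially. \<forall>j\<in>{..<J}. nat (trunc_add (K (r n) j) (Some l))
        = nat (trunc_add (k j) (Some l))"
      using trunc by (intro eventually_ball_finite) auto
    ultimately have "\<forall>\<^sub>F n in sequentially. inverse (real q ^ S n l)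
        = inverse (real q ^ (\<Sum>j<J. nat (trunc_add (k j) (Some l))))"
    proof eventually_elim
      case (elim n)
      have zero: "trunc_add (K (r n) j) (Some l) = 0" if "J \<le> j" for j
        using elim(1) antimonoD[OF K(1) that, of "r n"]
            by (intro trunc_add_Some_eq_0) (auto dest: order_trans)
      have "S n l = (\<Sum>j<max J (L (r n)). nat (trunc_add (K (r n) j) (Some l)))"
        unfolding S_def using K(2)[of "r n"] by (intro sum.mono_neutral_left) auto
      also have "\<dots> = (\<Sum>j<J. nat (trunc_add (K (r n) j) (Some l)))"
        using zero by (intro sum.mono_neutral_right) auto
      also have "\<dots> = (\<Sum>j<J. nat (trunc_add (k j) (Some l)))"
        using elim(2) by (intro sum.cong) auto
      finally show ?case by simp
    qed
    then have "(\<lambda>n. inverse (real q ^ S n l))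
        \<longlonglongrightarrow> inverse (real q ^ (\<Sum>j<J. nat (trunc_add (k j) (Some l))))"
      by (rule tendsto_eventually)
    then have "f l = inverse (real q ^ (\<Sum>j<J. nat (trunc_add (k j) (Some l))))"
      using LIMSEQ_unique[OF lim_r] by blast
    also have "\<dots> = sing_factor q k (Some l)"
    proof (rule sing_factor_finite[OF q, symmetric])
      fix j assume "J \<le> j"
      then have "\<not> Some (1 - l) \<le> k j"
        using J P_anti k by blast
      then show "trunc_add (k j) (Some l) = 0"
        by (rule trunc_add_Some_eq_0)
    qed
    finally show ?thesis .
  next
    case False
    have "f l \<le> inverse (real q) ^ J" for J
    proof (rule LIMSEQ_le_const2[OF lim_r])
      have "\<forall>\<^sub>F n in sequentially. Some (1 - l) \<le> K (r n) J"
        using False by (simp add: P_def)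
      then have "\<forall>\<^sub>F n in sequentially. inverse (real q ^ S n l) \<le> inverse (real q) ^ J"
      proof eventually_elim
        case (elim n)
        then have "J < L (r n)"
          using K(2)[of "r n" J] by (cases "K (r n) J") (auto simp: not_less[symmetric])
        have "J = (\<Sum>j<J. 1)" by simp
        also have "\<dots> \<le> (\<Sum>j<J. nat (trunc_add (K (r n) j) (Some l)))"
        proof (rule sum_mono)
          fix j assume "j \<in> {..<J}"
          then have "Some (1 - l) \<le> K (r n) j"
            using elim antimonoD[OF K(1), of j J "r n"] by (auto intro: order_trans)
          then show "1 \<le> nat (trunc_add (K (r n) j) (Some l))"
            using trunc_add_Some_ge_1 by fastforce
        qed
        also have "\<dots> \<le> S n l"
          unfolding S_def using \<open>J < L (r n)\<close> by (intro sum_mono2) auto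
        finally have "real q ^ J \<le> real q ^ S n l"
          using q by (intro power_increasing) auto
        then have "inverse (real q ^ S n l) \<le> inverse (real q ^ J)"
          using q by (intro le_imp_inverse_le) auto
        then show ?case
          by (simp add: power_inverse)
      qed
      then show "\<exists>N. \<forall>n\<ge>N. inverse (real q ^ S n l) \<le> inverse (real q) ^ J"
        by (simp add: eventually_sequentially)
    qed
    moreover have "(\<lambda>J. inverse (real q) ^ J) \<longlonglongrightarrow> 0"
      using q by (intro LIMSEQ_power_zero) (simp add: inverse_less_1_iff)
    ultimately have "f l \<le> 0"
      by (intro LIMSEQ_le_const) auto
    moreover have "0 \<le> f l"
      by (rule LIMSEQ_le_const[OF lim_r]) auto
    moreover have "sing_factor q k (Some l) = 0"
      using False k trunc_add_Some_ge_1 by (intro sing_factor_infinite q) auto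
    ultimately show ?thesis by simp
  qed
  moreover have "k \<in> Delta"
    using \<open>antimono k\<close> by (simp add: Delta_def)
  ultimately show ?thesis by blast
qed


section \<open>Ergodicity\<close>

text \<open>An invariant set has to equal its images, not merely contain them; the inverse group
  elements provide the missing preimages.\<close>

lemma invariant_setI:
  assumes "\<And>n g h M. g \<in> GL_fin n \<Longrightarrow> h \<in> GL_fin n \<Longrightarrow> F (g \<odot> M \<odot> h) = F M"
  shows "invariant_set {M. P (F M)}"
  unfolding invariant_set_def
proof (intro ballI)
  fix g h :: "'a inf_mat" assume "g \<in> GL_inf" "h \<in> GL_inf"
  then obtain n where gh: "g \<in> GL_fin n" "GL_inverse h \<in> GL_fin n"
    by (rule GL_action_obtain)
  let ?h = "GL_inverse h"
  have inv: "GL_inverse g \<in> GL_fin n" "GL_inverse ?h \<in> GL_fin n"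
    using GL_inverse_GL_fin(1) gh by auto
  show "GL_action g h ` {M. P (F M)} = {M. P (F M)}"
  proof (intro set_eqI iffI)
    fix M assume "M \<in> GL_action g h ` {M. P (F M)}"
    then show "M \<in> {M. P (F M)}"
      using assms[OF gh] by (auto simp: GL_action_def)
  next
    fix M assume M: "M \<in> {M. P (F M)}"
    let ?N = "GL_inverse g \<odot> M \<odot> GL_inverse ?h"
    have "M = GL_inverse (GL_inverse g) \<odot> ?N \<odot> GL_inverse (GL_inverse ?h)"
      by (rule GL_fin_cancel[OF inv refl])
    moreover have "GL_inverse (GL_inverse g) = g" "GL_inverse (GL_inverse ?h) = ?h"
      using GL_inverse_eq[OF inv(1) gh(1)] GL_inverse_eq[OF inv(2) gh(2)]
        GL_inverse_GL_fin(2,3)[OF gh(1)] GL_inverse_GL_fin(2,3)[OF gh(2)] by auto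
    ultimately have "M = GL_action g h ?N"
      by (simp add: GL_action_def)
    moreover have "F ?N = F M"
      by (rule assms[OF inv])
    ultimately show "M \<in> GL_action g h ` {M. P (F M)}"
      using M by (intro image_eqI[of _ _ ?N]) auto
  qed
qed

text \<open>Image measures involve preimages, while invariance of a set is phrased with images;
  injectivity of the action passes from one to the other.\<close>

lemma invariant_set_vimage:
  assumes B: "invariant_set B" and g: "g \<in> GL_fin n" and h: "h \<in> GL_fin n"
  shows "(\<lambda>M. g \<odot> M \<odot> h) -` B = B"
proof -
  have "g \<in> GL_inf" "GL_inverse h \<in> GL_inf"
    using g GL_inverse_GL_fin(1)[OF h] by (auto simp: GL_inf_def)
  then have "GL_action g (GL_inverse h) ` B = B"
    using B by (simp add: invariant_set_def)
  then have img: "(\<lambda>M. g \<odot> M \<odot> h) ` B = B"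
    by (simp add: GL_action_GL_fin[OF g h])
  have inj: "M = N" if "g \<odot> M \<odot> h = g \<odot> N \<odot> h" for M N
    using GL_fin_cancel[OF g h that] GL_fin_cancel[OF g h refl, of N] by simp
  show ?thesis
    using img inj by (auto simp: set_eq_iff image_iff)
qed

lemma invariant_prob_uniform_measure:
  assumes \<mu>: "invariant_prob \<mu>" and B: "B \<in> sets borel" "invariant_set B" "measure \<mu> B \<noteq> 0"
  shows "invariant_prob (uniform_measure \<mu> B)"
proof (rule invariant_probI)
  have [measurable_cong]: "sets \<mu> = sets borel" and prob: "prob_space \<mu>"
    using \<mu> by (auto simp: invariant_prob_def)
  interpret prob_space \<mu> by (rule prob)
  have [measurable]: "B \<in> sets \<mu>" using B by simp
  have pos: "emeasure \<mu> B \<noteq> 0" "emeasure \<mu> B \<noteq> \<infinity>"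
    using B(3) by (auto simp: emeasure_eq_measure)
  show sets: "sets (uniform_measure \<mu> B) = sets borel"
    by (simp add: \<open>sets \<mu> = sets borel\<close>)
  show "prob_space (uniform_measure \<mu> B)"
    by (rule prob_space_uniform_measure[OF pos])
  fix n and g h :: "'a inf_mat" assume gh: "g \<in> GL_fin n" "h \<in> GL_fin n"
  let ?T = "\<lambda>M. g \<odot> M \<odot> h"
  have T [measurable]: "?T \<in> borel_measurable borel"
    by (rule measurable_GL_mult[OF gh[THEN GL_fin_int_block]])
  have space_\<mu>: "space \<mu> = UNIV"
    using sets_eq_imp_space_eq[OF \<open>sets \<mu> = sets borel\<close>] by simp
  show "distr (uniform_measure \<mu> B) borel ?T = uniform_measure \<mu> B"
  proof (rule measure_eqI)
    fix S assume "S \<in> sets (distr (uniform_measure \<mu> B) borel ?T)"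
    then have S [measurable]: "S \<in> sets borel" by simp
    have vim [measurable]: "?T -` S \<in> sets borel"
      using measurable_sets[OF T S] by simp
    have "emeasure (distr (uniform_measure \<mu> B) borel ?T) S
        = emeasure (uniform_measure \<mu> B) (?T -` S)"
      by (subst emeasure_distr) (simp_all add: space_\<mu>)
    also have "\<dots> = emeasure \<mu> (B \<inter> ?T -` S) / emeasure \<mu> B"
      by (subst emeasure_uniform_measure) (simp_all add: vim \<open>sets \<mu> = sets borel\<close> B(1))
    also have "B \<inter> ?T -` S = ?T -` (B \<inter> S)"
      using invariant_set_vimage[OF B(2) gh] by auto
    also have "emeasure \<mu> (?T -` (B \<inter> S)) = emeasure (distr \<mu> borel ?T) (B \<inter> S)"
      using B(1) by (subst emeasure_distr) (simp_all add: space_\<mu>)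
    also have "\<dots> = emeasure \<mu> (B \<inter> S)"
      by (simp only: invariant_prob_GL[OF \<mu> gh])
    also have "\<dots> / emeasure \<mu> B = emeasure (uniform_measure \<mu> B) S"
      by (subst emeasure_uniform_measure) (simp_all add: \<open>sets \<mu> = sets borel\<close> B(1))
    finally show "emeasure (distr (uniform_measure \<mu> B) borel ?T) S
        = emeasure (uniform_measure \<mu> B) S" .
  qed (simp add: \<open>sets \<mu> = sets borel\<close>)
qed

section \<open>From ergodic measures to sequences\<close>

context normalized_character
begin

lemma ergodic_corner_limit_const:
  assumes \<mu>: "\<mu> \<in> ergodic_measures"
  shows "AE M in \<mu>. corner_limit c M = (\<integral>M. corner_limit c M \<partial>\<mu>)"
proof -
  have inv: "invariant_prob \<mu>" and zero_one: "\<And>B. B \<in> sets borel \<Longrightarrow> invariant_set B \<Longrightarrow> measure \<mu> B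
      = 0 \<or> measure \<mu> B = 1"
    using \<mu> by (auto simp: ergodic_measures_def)
  have sets_\<mu> [measurable_cong]: "sets \<mu> = sets borel" and prob: "prob_space \<mu>"
    using inv by (auto simp: invariant_prob_def)
  have space_\<mu>: "space \<mu> = UNIV"
    using sets_eq_imp_space_eq[OF sets_\<mu>] by simp
  show ?thesis
  proof (rule prob_space_zero_one_const[OF prob, where B = 1])
    show "measure \<mu> {M \<in> space \<mu>. corner_limit c M < r}
        = 0 \<or> measure \<mu> {M \<in> space \<mu>. corner_limit c M < r} = 1" for r
    proof (rule zero_one)
      have "{M \<in> space \<mu>. corner_limit c M < r} \<in> sets \<mu>"
        by measurable
      then show "{M \<in> space \<mu>. corner_limit c M < r} \<in> sets borel"
        by (simp add: sets_\<mu>)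
      show "invariant_set {M \<in> space \<mu>. corner_limit c M < r}"
        using invariant_setI[of "corner_limit c" "\<lambda>x. x < r"] corner_limit_GL by (simp add: space_\<mu>)
    qed
    show "corner_limit c \<in> borel_measurable \<mu>"
      by measurable
    show "\<bar>corner_limit c M\<bar> \<le> 1" for M
      using corner_limit_bounds[of c M] by simp
  qed
qed

text \<open>The case of the zero matrix in \<open>character_corner_limit_integral\<close>. It
  identifies the almost sure constants with values at matrices having a single entry, where
  continuity at \<open>0\<close> becomes available.\<close>

lemma corner_limit_integral:
  assumes "invariant_prob \<mu>"
  shows "complex_of_real (\<integral>M. corner_limit c M \<partial>\<mu>) = char_fun \<psi> \<mu> (mat_single 0 c)"
proof -
  have "complex_of_real (\<integral>M. corner_limit c M \<partial>\<mu>)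
      = (\<integral>M. \<psi> (mat_pairing 0 (\<lambda>i j. 0) M) * complex_of_real (corner_limit c M) \<partial>\<mu>)"
    by (simp add: mat_pairing_def)
  also have "\<dots> = char_fun \<psi> \<mu> ((\<lambda>i j. 0) \<oplus> mat_single 0 c)"
    by (rule character_corner_limit_integral[OF assms]) (simp add: Mat_fin_def)
  also have "(\<lambda>i j. 0) \<oplus> mat_single 0 c = mat_single 0 c"
    by (simp add: mat_add_def)
  finally show ?thesis .
qed

lemma char_fun_single: "char_fun \<psi> \<mu> (mat_single 0 c) = (\<integral>M. \<psi> (c * M 0 0) \<partial>\<mu>)"
  by (subst char_fun_eq[OF mat_single_Mat_fin]) (simp add: mat_pairing_def mat_single_def)

lemma corner_limit_0: "corner_limit 0 M = 1"
proof -
  have "corner_prob n n (mat_scale 0 M) = 1" for n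
    using prob_space.prob_space[OF prob_space_haar_seq] by (simp add: corner_prob_def)
  then show ?thesis
    using corner_limit[of 0 M] LIMSEQ_unique[OF _ tendsto_const] by auto
qed

lemma corner_singular_numbers:
  obtains k where "antimono k" "\<And>j. n \<le> j \<Longrightarrow> k j = None"
    "\<And>l. corner_prob n n (mat_scale (neg_power \<pi> l) M)
        = inverse (real q ^ (\<Sum>j<n. nat (trunc_add (k j) l)))"
proof -
  define C where "C = (\<lambda>i j. if i < n \<and> j < n then M i j else 0)"
  have "C \<in> Mat_fin n"
    by (auto simp: C_def Mat_fin_def)
  then obtain a b ks where ab: "a \<in> GL_fin n" "b \<in> GL_fin n" "length ks = n"
      "C = a \<odot> diag_mat \<pi> ks \<odot> b"
    by (rule singular_number_decomposition)
  define xs where "xs = rev (sort ks)"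
  have xs: "mset xs = mset ks" "length xs = n"
    by (simp_all add: xs_def ab(3))
  \<comment> \<open>Padding with \<open>None\<close>, the least element, keeps the sequence weakly
    decreasing.\<close>
  define k where "k j = (if j < n then xs ! j else None)" for j
  have "antimono k"
  proof (rule antimonoI)
    fix i j :: nat assume "i \<le> j"
    have "sorted (rev xs)" by (simp add: xs_def)
    then show "k j \<le> k i"
      using sorted_rev_nth_mono[of xs i j] \<open>i \<le> j\<close> xs(2) by (auto simp: k_def)
  qed
  have k: "corner_prob n n (mat_scale (neg_power \<pi> l) M)
      = inverse (real q ^ (\<Sum>j<n. nat (trunc_add (k j) l)))" for l
  proof -
    have "corner_prob n n (mat_scale (neg_power \<pi> l) M)
        = corner_prob n n (mat_scale (neg_power \<pi> l) C)"
      by (rule corner_prob_cong) (simp add: C_def)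
    also have "\<dots> = inverse (real q ^ (\<Sum>k\<in>#mset ks. nat (trunc_add k l)))"
      unfolding ab(4) by (rule corner_prob_singular_numbers[OF ab(1-3)])
    also have "(\<Sum>k\<in>#mset ks. nat (trunc_add k l)) = (\<Sum>k\<in>#mset xs. nat (trunc_add k l))"
      by (simp add: xs)
    also have "\<dots> = (\<Sum>j<n. nat (trunc_add (k j) l))"
      by (simp add: sum_mset_sum_list sum_list_sum_nth atLeast0LessThan xs(2) k_def flip: mset_map)
    finally show ?thesis .
  qed
  show ?thesis
    by (rule that[OF \<open>antimono k\<close> _ k]) (simp add: k_def)
qed

lemma ergodic_char_fun:
  assumes \<mu>: "\<mu> \<in> ergodic_measures"
  shows "\<exists>k\<in>Delta. \<forall>A\<in>Mat_inf. char_fun \<psi> \<mu> A = phi \<pi> k A"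
proof -
  have inv: "invariant_prob \<mu>"
    using \<mu> by (auto simp: ergodic_measures_def)
  have sets_\<mu> [measurable_cong]: "sets \<mu> = sets borel" and prob: "prob_space \<mu>"
    using inv by (auto simp: invariant_prob_def)
  interpret prob_space \<mu> by (rule prob)
  define f where "f l = (\<integral>M. corner_limit (neg_power \<pi> l) M \<partial>\<mu>)" for l
  have f: "AE M in \<mu>. corner_limit (neg_power \<pi> l) M = f l" for l
    unfolding f_def by (rule ergodic_corner_limit_const[OF \<mu>])
  \<comment> \<open>There are countably many scales \<open>l\<close>, so a single matrix
    \<open>M\<close> realises all the constants at once.\<close>
  then have "AE M in \<mu>. \<forall>l. corner_limit (neg_power \<pi> l) M = f l"
    unfolding AE_all_countable by blast
  then obtain M where M: "\<And>l. corner_limit (neg_power \<pi> l) M = f l"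
    using eventually_happens'[OF ae_filter_bot] by blast
  have "\<exists>k. antimono k \<and> (\<forall>j\<ge>n. k j = None) \<and>
      (\<forall>l. corner_prob n n (mat_scale (neg_power \<pi> l) M) = inverse (real q ^ (\<Sum>j<n. nat (trunc_add
          (k j) l))))" for n
    by (rule corner_singular_numbers[of n M]) blast
  then obtain K where K: "\<And>n. antimono (K n)" "\<And>n j. n \<le> j \<Longrightarrow> K n j = None"
    "\<And>n l. corner_prob n n (mat_scale (neg_power \<pi> l) M)
        = inverse (real q ^ (\<Sum>j<n. nat (trunc_add (K n j) l)))"
    by metis
  have lim: "(\<lambda>n. inverse (real q ^ (\<Sum>j<n. nat (trunc_add (K n j) l)))) \<longlonglongrightarrow> f l" for l
    using corner_limit[of "neg_power \<pi> l" M] by (simp add: K(3) M)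
  \<comment> \<open>Continuity of the characteristic function at \<open>0\<close> makes
    \<open>f\<close> close to \<open>1\<close> at very negative scales; this is the source of the
    uniform upper bound on the singular numbers.\<close>
  have "(\<lambda>n. complex_of_real (f (Some (- int n)))) \<longlonglongrightarrow> (\<integral>M. 1 \<partial>\<mu>)"
    unfolding f_def corner_limit_integral[OF inv] char_fun_single
  proof (rule integral_dominated_convergence[where w = "\<lambda>_. 1"])
    have [measurable]: "(\<lambda>M. M 0 0) \<in> borel_measurable \<mu>"
      by (rule measurable_inf_mat_entry) measurable
    show "(\<lambda>M. \<psi> (neg_power \<pi> (Some (- int n)) * M 0 0)) \<in> borel_measurable \<mu>" for n
      by measurable
    have "(\<lambda>n. absv \<pi> ^ n) \<longlonglongrightarrow> 0"
      using absv_uniformizer_less_1 by (intro LIMSEQ_power_zero) simp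
    then have "(\<lambda>n. absv (\<pi> ^ n)) \<longlonglongrightarrow> 0"
      by (simp add: absv_power)
    then have pow: "(\<lambda>n. \<pi> ^ n) \<longlonglongrightarrow> 0"
      unfolding absv_eq_dist by (rule tendsto_dist_iff[THEN iffD2])
    have "(\<lambda>n. \<pi> ^ n * M 0 0) \<longlonglongrightarrow> 0 * M 0 0" for M :: "'a inf_mat"
      by (intro tendsto_intros pow)
    then have "(\<lambda>n. \<psi> (\<pi> ^ n * M 0 0)) \<longlonglongrightarrow> \<psi> (0 * M 0 0)" for M :: "'a inf_mat"
      by (rule continuous_on_tendsto_compose[OF continuous_character]) simp_all
    then show "AE M in \<mu>. (\<lambda>n. \<psi> (neg_power \<pi> (Some (- int n)) * M 0 0)) \<longlonglongrightarrow> 1"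
      by simp
  qed simp_all
  then have "(\<lambda>n. complex_of_real (f (Some (- int n)))) \<longlonglongrightarrow> complex_of_real 1"
    by (simp add: prob_space)
  then have "(\<lambda>n. f (Some (- int n))) \<longlonglongrightarrow> 1"
    unfolding tendsto_of_real_iff .
  then have "\<forall>\<^sub>F n in sequentially. 1 / 2 < f (Some (- int n))"
    by (rule order_tendstoD) simp
  then obtain T where T: "1 / 2 < f (Some (- int T))"
    by (auto simp: eventually_sequentially)
  \<comment> \<open>A singular number above \<open>T\<close> would make some corner probability at
    scale \<open>- T\<close> at most \<open>1 / q\<close>, hence at most one half; but these
    probabilities decrease to \<open>f (Some (- int T))\<close>, which exceeds one half.\<close>
  have K_le: "K n j \<le> Some (int T)" for n j
  proof (rule ccontr)
    assume contra: "\<not> ?thesis"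
    then have "j < n"
      using K(2)[of n j] by (cases "K n j") (auto simp: not_less[symmetric])
    define s where "s = (\<Sum>j<n. nat (trunc_add (K n j) (Some (- int T))))"
    have "1 \<le> nat (trunc_add (K n j) (Some (- int T)))"
      using contra by (cases "K n j") auto
    also have "\<dots> \<le> s"
      unfolding s_def using \<open>j < n\<close> by (intro member_le_sum) auto
    finally have "real q ^ 1 \<le> real q ^ s"
      using q_real_gt_1 by (intro power_increasing) auto
    moreover have "2 \<le> real q"
      using q_gt_1 by simp
    ultimately have "2 \<le> real q ^ s"
      by (simp only: power_one_right)
    moreover have "f (Some (- int T)) \<le> inverse (real q ^ s)"
    proof -
      have "decseq (\<lambda>n. corner_prob n n (mat_scale (neg_power \<pi> (Some (- int T))) M))"
        by (auto simp: decseq_def corner_prob_antimono)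
      from decseq_ge[OF this corner_limit] show ?thesis
        by (simp only: M K(3) s_def)
    qed
    ultimately show False
      using T le_imp_inverse_le[of 2 "real q ^ s"] by simp
  qed
  obtain k where k: "k \<in> Delta" "\<And>l. f (Some l) = sing_factor q k (Some l)"
    using Delta_compactness[where K = K and L = "\<lambda>n. n"
        and f = "\<lambda>l. f (Some l)", OF q_gt_1 K(1,2) K_le lim]
    by blast
  have "f None = 1"
    by (simp add: f_def corner_limit_0 prob_space)
  moreover have "sing_factor q k None = 1"
    using sing_factor_finite[OF q_gt_1, of 0 k None] by simp
  ultimately have f_eq: "f = sing_factor q k"
    using k(2) by (intro ext) (metis not_Some_eq)
  have "char_fun \<psi> \<mu> A = phi \<pi> k A" if "A \<in> Mat_inf" for A
    unfolding phi_def f_eq[symmetric] by (rule char_fun_product[OF inv f that])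
  then show ?thesis
    using k(1) by blast
qed

section \<open>From multiplicative characteristic functions to ergodicity\<close>

lemma multiplicative_imp_corner_limit_const:
  assumes \<mu>: "invariant_prob \<mu>"
    and mult: "\<And>n B. B \<in> Mat_fin n \<Longrightarrow> char_fun \<psi> \<mu> (B \<oplus> mat_single n c)
        = char_fun \<psi> \<mu> B * complex_of_real f"
  shows "AE M in \<mu>. corner_limit c M = f"
proof -
  have sets_\<mu> [measurable_cong]: "sets \<mu> = sets borel" and prob: "prob_space \<mu>"
    using \<mu> by (auto simp: invariant_prob_def)
  interpret prob_space \<mu> by (rule prob)
  let ?X = "corner_limit c" and ?H = "\<lambda>n M. corner_prob n n (mat_scale c M)"
  have X_int: "integrable \<mu> ?X" "integrable \<mu> (\<lambda>M. ?X M * ?X M)"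
    using corner_limit_bounds[of c] by (auto intro!: integrable_bounded[where B = 1] simp:
        abs_mult mult_le_one)
  have "char_fun \<psi> \<mu> (mat_single 0 c) = char_fun \<psi> \<mu> ((\<lambda>i j. 0) \<oplus> mat_single 0 c)"
    by (simp add: mat_add_def)
  also have "\<dots> = complex_of_real f"
    by (subst mult) (simp_all add: Mat_fin_def char_fun_zero[OF prob])
  finally have X_mean: "(\<integral>M. ?X M \<partial>\<mu>) = f"
    using corner_limit_integral[OF \<mu>, of c] by simp
  \<comment> \<open>One factor is already the limit and stays as the weight, the other is still at
    level \<open>n\<close> and expands into rank one characters. Inside that average
    \<open>character_corner_limit_integral\<close> and multiplicativity apply; only afterwards does
    \<open>n\<close> tend to infinity.\<close>
  have XH: "(\<integral>M. ?X M * ?H n M \<partial>\<mu>) = f * (\<integral>M. ?H n M \<partial>\<mu>)" for n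
  proof -
    have "complex_of_real (\<integral>M. ?X M * ?H n M \<partial>\<mu>)
        = (\<integral>M. complex_of_real (?X M) * complex_of_real (?H n M) \<partial>\<mu>)"
      by (simp flip: of_real_mult)
    also have "\<dots> = (\<integral>v. (\<integral>u. (\<integral>M. complex_of_real (?X M)
        * \<psi> (mat_pairing n (rank_one n c v u) M) \<partial>\<mu>) \<partial>haar_seq) \<partial>haar_seq)"
      using corner_limit_bounds[of c] by (intro integral_mult_corner_prob[OF prob sets_\<mu>]) simp_all
    also have "\<dots> = (\<integral>v. (\<integral>u. complex_of_real f * char_fun \<psi> \<mu> (rank_one n c v u) \<partial>haar_seq)
        \<partial>haar_seq)"
      using character_corner_limit_integral[OF \<mu> rank_one_Mat_fin, of n c _ _ c]
      by (simp add: mult[OF rank_one_Mat_fin] mult.commute)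
    also have "\<dots> = complex_of_real f * (\<integral>v. (\<integral>u. (\<integral>M. 1
        * \<psi> (mat_pairing n (rank_one n c v u) M) \<partial>\<mu>) \<partial>haar_seq) \<partial>haar_seq)"
      by (simp add: char_fun_eq[OF rank_one_Mat_fin])
    also have "(\<integral>v. (\<integral>u. (\<integral>M. 1 * \<psi> (mat_pairing n (rank_one n c v u) M) \<partial>\<mu>) \<partial>haar_seq) \<partial>haar_seq)
        = (\<integral>M. 1 * complex_of_real (?H n M) \<partial>\<mu>)"
      by (rule integral_mult_corner_prob[OF prob sets_\<mu>, symmetric]) simp_all
    also have "\<dots> = complex_of_real (\<integral>M. ?H n M \<partial>\<mu>)"
      by simp
    finally show ?thesis
      unfolding of_real_mult[symmetric] of_real_eq_iff .
  qed
  have "(\<lambda>n. \<integral>M. ?X M * ?H n M \<partial>\<mu>) \<longlonglongrightarrow> (\<integral>M. ?X M * ?X M \<partial>\<mu>)"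
    using corner_limit_bounds[of c] corner_prob_bounds
    by (intro integral_dominated_convergence[where w = "\<lambda>_. 1"])
      (auto intro!: tendsto_intros corner_limit AE_I2 simp: abs_mult mult_le_one)
  moreover have "(\<lambda>n. \<integral>M. ?H n M \<partial>\<mu>) \<longlonglongrightarrow> (\<integral>M. ?X M \<partial>\<mu>)"
    using corner_prob_bounds
    by (intro integral_dominated_convergence[where w = "\<lambda>_. 1"]) (auto intro!: corner_limit AE_I2)
  then have "(\<lambda>n. f * (\<integral>M. ?H n M \<partial>\<mu>)) \<longlonglongrightarrow> f * f"
    unfolding X_mean by (intro tendsto_intros)
  ultimately have X_square: "(\<integral>M. ?X M * ?X M \<partial>\<mu>) = f * f"
    unfolding XH by (rule LIMSEQ_unique)
  have int: "integrable \<mu> (\<lambda>M. (?X M - f)\<^sup>2)"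
    using X_int by (simp add: power2_eq_square algebra_simps)
  have "(\<integral>M. (?X M - f)\<^sup>2 \<partial>\<mu>) = 0"
    using X_int by (simp add: power2_eq_square algebra_simps X_mean X_square prob_space)
  then have "AE M in \<mu>. (?X M - f)\<^sup>2 = 0"
    using integral_nonneg_eq_0_iff_AE[OF int] by simp
  then show ?thesis
    by eventually_elim simp
qed

lemma multiplicative_imp_ergodic:
  assumes \<mu>: "invariant_prob \<mu>"
    and mult: "\<And>n B l. B \<in> Mat_fin n \<Longrightarrow>
      char_fun \<psi> \<mu> (B \<oplus> mat_single n (neg_power \<pi> l)) = char_fun \<psi> \<mu> B * complex_of_real (f l)"
  shows "\<mu> \<in> ergodic_measures"
proof -
  have sets_\<mu> [measurable_cong]: "sets \<mu> = sets borel" and prob: "prob_space \<mu>"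
    using \<mu> by (auto simp: invariant_prob_def)
  interpret prob_space \<mu> by (rule prob)
  have f: "AE M in \<mu>. corner_limit (neg_power \<pi> l) M = f l" for l
    using mult by (intro multiplicative_imp_corner_limit_const[OF \<mu>])
  have "measure \<mu> B = 1" if B: "B \<in> sets borel" "invariant_set B" "measure \<mu> B \<noteq> 0" for B
  proof -
    define \<nu> where "\<nu> = uniform_measure \<mu> B"
    have \<nu>: "invariant_prob \<nu>"
      unfolding \<nu>_def by (rule invariant_prob_uniform_measure[OF \<mu> B])
    have pos: "emeasure \<mu> B \<noteq> 0"
      using B(3) by (simp add: emeasure_eq_measure)
    \<comment> \<open>Events of full measure keep full measure under conditioning, so the same
      constants serve for \<open>\<nu>\<close>.\<close>
    have \<nu>_f: "AE M in \<nu>. corner_limit (neg_power \<pi> l) M = f l" for l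
      unfolding \<nu>_def using f[of l] B(1) by (intro AE_uniform_measureI) (auto simp: sets_\<mu> elim:
          eventually_mono)
    have "char_fun \<psi> \<mu> A = char_fun \<psi> \<nu> A" if "A \<in> Mat_inf" for A
      using char_fun_product[OF \<mu> f that] char_fun_product[OF \<nu> \<nu>_f that] by simp
    then have "\<mu> = \<nu>"
      using \<mu> \<nu> by (intro char_fun_inject) (auto simp: invariant_prob_def)
    moreover have "emeasure \<nu> B = 1"
      unfolding \<nu>_def using pos B(1) by (subst emeasure_uniform_measure) (simp_all add: sets_\<mu>
          emeasure_eq_measure ennreal_divide_self)
    ultimately show ?thesis
      by (simp add: measure_def)
  qed
  then show ?thesis
    using \<mu> unfolding ergodic_measures_def by blast
qed

end


section \<open>Random matrices\<close>

lemma trunc_add_commute: "trunc_add k l = trunc_add l k"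
  by (cases "(k, l)" rule: trunc_add.cases) (auto simp: add.commute)

lemma integral_entries_mult:
  assumes "g \<in> int_block n" "\<And>i j. A i j \<in> integer_ring"
  shows "(g \<odot> A) i j \<in> integer_ring" "(A \<odot> g) i j \<in> integer_ring"
  unfolding int_block_mult_left[OF assms(1)] int_block_mult_right[OF assms(1)]
  using int_blockD(1)[OF assms(1)] assms(2) by (auto intro!: integer_ring_sum integer_ring_mult)

lemma integral_entries_GL_iff:
  assumes "a \<in> GL_fin n" "b \<in> GL_fin n"
  shows "(\<forall>i j. (a \<odot> A \<odot> b) i j \<in> integer_ring) \<longleftrightarrow> (\<forall>i j. A i j \<in> integer_ring)"
proof
  note blocks = GL_inverse_GL_fin(1)[OF assms(1), THEN GL_fin_int_block] GL_inverse_GL_fin(1)[OF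
      assms(2), THEN GL_fin_int_block]
  assume "\<forall>i j. (a \<odot> A \<odot> b) i j \<in> integer_ring"
  then have "(GL_inverse a \<odot> (a \<odot> A \<odot> b) \<odot> GL_inverse b) i j \<in> integer_ring" for i j
    by (intro integral_entries_mult(2)[OF blocks(2)] integral_entries_mult(1)[OF blocks(1)]) simp
  then show "\<forall>i j. A i j \<in> integer_ring"
    by (simp add: GL_fin_cancel[OF assms refl, symmetric])
next
  assume "\<forall>i j. A i j \<in> integer_ring"
  then have "(a \<odot> A \<odot> b) i j \<in> integer_ring" for i j
    by (intro integral_entries_mult(2)[OF GL_fin_int_block[OF assms(2)]]
        integral_entries_mult(1)[OF GL_fin_int_block[OF assms(1)]]) simp
  then show "\<forall>i j. (a \<odot> A \<odot> b) i j \<in> integer_ring"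
    by simp
qed

text \<open>Position \<open>n\<close> is the first one outside the block in which \<open>a\<close>
  and \<open>b\<close> differ from the identity. This permits appending a singular number without
  changing the outer factors.\<close>

lemma mat_add_single_GL:
  assumes "a \<in> GL_fin n" "b \<in> GL_fin n"
  shows "a \<odot> (D \<oplus> mat_single n c) \<odot> b = (a \<odot> D \<odot> b) \<oplus> mat_single n c"
proof (intro ext)
  note blocks = assms[THEN GL_fin_int_block]
  have left: "(a \<odot> (D \<oplus> mat_single n c)) i j = (a \<odot> D) i j + mat_single n c i j" for i j
    by (auto simp: int_block_mult_left[OF blocks(1)] mat_single_def distrib_left intro!: sum.cong)
  fix i j
  show "(a \<odot> (D \<oplus> mat_single n c) \<odot> b) i j = ((a \<odot> D \<odot> b) \<oplus> mat_single n c) i j"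
    unfolding mat_add_apply int_block_mult_right[OF blocks(2)] left
    by (auto simp: mat_single_def distrib_right intro!: sum.cong)
qed

context normalized_character
begin

definition clip :: "'a \<Rightarrow> 'a" where "clip x = (if x \<in> integer_ring then x else 0)"

lemma clip_in [simp]: "clip x \<in> integer_ring"
  by (simp add: clip_def)

lemma measurable_clip [measurable]: "clip \<in> borel_measurable borel"
  unfolding clip_def by measurable

text \<open>
  The random matrix is \<open>\<Sum>j. c j * X j \<otimes> Y j + z * Z\<close> with independent uniform integral vectors
  \<open>X j\<close>, \<open>Y j\<close> and an independent uniform integral matrix \<open>Z\<close>; clipping makes the series
  converge surely and not only almost surely.
\<close>

lemma random_matrix_exists:
  assumes c: "c \<longlonglongrightarrow> 0"
  shows "\<exists>\<mu>. prob_space \<mu> \<and> sets \<mu> = sets borel \<and> (\<forall>n A. A \<in> Mat_fin n \<longrightarrow>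
    (\<lambda>J. (if \<forall>i j. z * A i j \<in> integer_ring then 1 else 0)
        * complex_of_real (\<Prod>j<J. corner_prob n n (mat_scale (c j) A))) \<longlonglongrightarrow> char_fun \<psi> \<mu> A)"
proof -
  define B where "B = haar_seq \<Otimes>\<^sub>M haar_seq"
  have prob_B: "prob_space B"
    unfolding B_def by (intro prob_space_pair prob_space_haar_seq)
  define \<Omega> where "\<Omega> = PiM UNIV (\<lambda>_::nat. B) \<Otimes>\<^sub>M haar_seq"
  have prob_PB: "prob_space (PiM UNIV (\<lambda>_::nat. B))"
    by (intro prob_space_PiM prob_B)
  have prob_\<Omega>: "prob_space \<Omega>"
    unfolding \<Omega>_def by (intro prob_space_pair prob_PB prob_space_haar_seq)
  interpret prob_space \<Omega> by (rule prob_\<Omega>)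
  define X where "X b i = clip (fst b i)" for b :: "(nat \<Rightarrow> 'a) \<times> (nat \<Rightarrow> 'a)" and i :: nat
  define Y where "Y b i = clip (snd b i)" for b :: "(nat \<Rightarrow> 'a) \<times> (nat \<Rightarrow> 'a)" and i :: nat
  have X_meas: "(\<lambda>b. X b i) \<in> borel_measurable B" and Y_meas: "(\<lambda>b. Y b i) \<in> borel_measurable B"
      for i
    unfolding X_def Y_def B_def by measurable
  have XPi: "X \<in> measurable B (PiM UNIV (\<lambda>_. borel))"
      and YPi: "Y \<in> measurable B (PiM UNIV (\<lambda>_. borel))"
    using X_meas Y_meas by (auto intro!: measurable_PiM_single' simp: space_PiM)
  define P where "P J \<omega> i l = (\<Sum>j<J. c j * (X (fst \<omega> j) i * Y (fst \<omega> j) l)) + z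
      * snd \<omega> (prod_encode (i, l))"
    for J and \<omega> :: "(nat \<Rightarrow> (nat \<Rightarrow> 'a) \<times> (nat \<Rightarrow> 'a)) \<times> (nat \<Rightarrow> 'a)" and i l
  define R where "R \<omega> i l = (\<Sum>j. c j * (X (fst \<omega> j) i * Y (fst \<omega> j) l)) + z
      * snd \<omega> (prod_encode (i, l))"
    for \<omega> :: "(nat \<Rightarrow> (nat \<Rightarrow> 'a) \<times> (nat \<Rightarrow> 'a)) \<times> (nat \<Rightarrow> 'a)" and i l
  have P_R: "(\<lambda>J. P J \<omega> i l) \<longlonglongrightarrow> R \<omega> i l" for \<omega> i l
  proof -
    have "(\<lambda>j. absv (c j * (X (fst \<omega> j) i * Y (fst \<omega> j) l))) \<longlonglongrightarrow> 0"
    proof (rule tendsto_sandwich[OF _ _ tendsto_const])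
      show "\<forall>\<^sub>F j in sequentially. absv (c j * (X (fst \<omega> j) i * Y (fst \<omega> j) l)) \<le> absv (c j)"
      proof (intro always_eventually allI)
        fix j
        have "X (fst \<omega> j) i * Y (fst \<omega> j) l \<in> integer_ring"
          by (intro integer_ring_mult) (simp_all add: X_def Y_def)
        then show "absv (c j * (X (fst \<omega> j) i * Y (fst \<omega> j) l)) \<le> absv (c j)"
          by (simp add: integer_ring_iff absv_mult[of "c j"] mult_left_le)
      qed
      show "(\<lambda>j. absv (c j)) \<longlonglongrightarrow> 0"
        using c tendsto_dist_iff[of c 0] by (simp add: absv_eq_dist)
    qed simp
    then have "(\<lambda>j. c j * (X (fst \<omega> j) i * Y (fst \<omega> j) l)) \<longlonglongrightarrow> 0"
      unfolding absv_eq_dist by (rule tendsto_dist_iff[THEN iffD2])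
    then have "summable (\<lambda>j. c j * (X (fst \<omega> j) i * Y (fst \<omega> j) l))"
      by (rule summable_of_tendsto_0)
    then have "(\<lambda>j. c j * (X (fst \<omega> j) i * Y (fst \<omega> j) l))
        sums (\<Sum>j. c j * (X (fst \<omega> j) i * Y (fst \<omega> j) l))"
      by (rule summable_sums)
    then show ?thesis
      unfolding P_def R_def sums_def by (intro tendsto_add tendsto_const)
  qed
  have comp: "(\<lambda>\<omega>. fst \<omega> j) \<in> measurable \<Omega> B" for j
    unfolding \<Omega>_def by measurable
  have [measurable]: "(\<lambda>\<omega>. X (fst \<omega> j) i) \<in> borel_measurable \<Omega>"
      "(\<lambda>\<omega>. Y (fst \<omega> j) i) \<in> borel_measurable \<Omega>" for i j
    using measurable_compose[OF comp X_meas] measurable_compose[OF comp Y_meas] by simp_all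
  have [measurable]: "(\<lambda>\<omega>. snd \<omega> i) \<in> borel_measurable \<Omega>" for i
    unfolding \<Omega>_def by measurable
  have P_meas: "(\<lambda>\<omega>. P J \<omega> i l) \<in> borel_measurable \<Omega>" for J i l
    unfolding P_def by measurable
  have P_meas' [measurable]: "P J \<in> borel_measurable \<Omega>" for J
    by (rule measurable_inf_mat) (rule P_meas)
  have R_meas [measurable]: "R \<in> borel_measurable \<Omega>"
    by (rule measurable_inf_mat, rule borel_measurable_LIMSEQ_metric) (rule P_meas, rule P_R)
  define \<mu> where "\<mu> = distr \<Omega> borel R"
  have clip_meas [measurable]: "(\<lambda>u::nat \<Rightarrow> 'a. (\<lambda>i. clip (u i)))
      \<in> measurable (PiM UNIV (\<lambda>_. borel)) (PiM UNIV (\<lambda>_. borel))"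
    by (rule measurable_PiM_single') (auto simp: space_PiM)
  \<comment> \<open>Uniform vectors are almost surely integral, so clipping alters them on a null
    set only and leaves all integrals unchanged.\<close>
  have clip_AE: "AE u in haar_seq. (\<lambda>i. clip (u i)) = u"
    using AE_haar_seq by eventually_elim (simp add: clip_def)
  have "distr haar_seq haar_seq (\<lambda>u i. clip (u i)) = distr haar_seq haar_seq (\<lambda>u. u)"
    using clip_AE by (intro distr_cong_AE) simp_all
  then have clip_distr: "distr haar_seq haar_seq (\<lambda>u i. clip (u i)) = haar_seq"
    by simp
  have clip_int: "(\<integral>u. g (\<lambda>i. clip (u i)) \<partial>haar_seq) = (\<integral>u. g u \<partial>haar_seq)"
    if [measurable]: "g \<in> borel_measurable haar_seq" for g :: "(nat \<Rightarrow> 'a) \<Rightarrow> complex"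
    by (subst (2) clip_distr[symmetric]) (simp add: integral_distr)
  \<comment> \<open>One product of independent uniform vectors has a corner probability as its
    characteristic function. The trace pairs \<open>Y\<close> with the rows and \<open>X\<close>
    with the columns of \<open>A\<close>.\<close>
  have block: "(\<integral>b. \<psi> (bilinear_form n n A (Y b) (X b)) \<partial>B) = complex_of_real (corner_prob n n A)"
      for n A
  proof -
    have "(\<integral>b. \<psi> (bilinear_form n n A (Y b) (X b)) \<partial>B)
        = (\<integral>v. (\<integral>u. \<psi> (bilinear_form n n A (\<lambda>i. clip (u i)) (\<lambda>i. clip (v i))) \<partial>haar_seq) \<partial>haar_seq)"
      unfolding B_def X_def Y_def
      by (rule bounded_integral_fst[symmetric, where B = 1]) (auto simp: prob_space_haar_seq)
    also have "\<dots> = (\<integral>v. (\<integral>u. \<psi> (bilinear_form n n A u (\<lambda>i. clip (v i))) \<partial>haar_seq) \<partial>haar_seq)"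
    proof (rule Bochner_Integration.integral_cong[OF refl])
      fix v :: "nat \<Rightarrow> 'a"
      have [measurable]: "(\<lambda>_. v) \<in> measurable N (PiM UNIV (\<lambda>_. borel))"
          for N :: "(nat \<Rightarrow> 'a) measure"
        by (rule measurable_const) (simp add: space_PiM)
      show "(\<integral>u. \<psi> (bilinear_form n n A (\<lambda>i. clip (u i)) (\<lambda>i. clip (v i))) \<partial>haar_seq)
          = (\<integral>u. \<psi> (bilinear_form n n A u (\<lambda>i. clip (v i))) \<partial>haar_seq)"
        by (rule clip_int) measurable
    qed
    also have "\<dots> = (\<integral>v. (\<integral>u. \<psi> (bilinear_form n n A u v) \<partial>haar_seq) \<partial>haar_seq)"
      by (rule clip_int, rule bounded_integral_measurable[where B = 1]) (auto simp:
          prob_space_haar_seq)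
    finally show ?thesis
      by (simp add: corner_prob_eq_integral)
  qed
  \<comment> \<open>Independence turns the partial sum into a product; the uniform matrix scaled by
    \<open>z\<close> contributes the indicator that \<open>z\<close> times \<open>A\<close> is
    integral.\<close>
  have char_P: "(\<integral>\<omega>. \<psi> (mat_pairing n A (P J \<omega>)) \<partial>\<Omega>)
      = (if \<forall>i j. z * A i j \<in> integer_ring then 1 else 0) * complex_of_real (\<Prod>j<J. corner_prob n n
          (mat_scale (c j) A))"
    if A: "A \<in> Mat_fin n" for n A J
  proof -
    define I where "I = prod_encode ` ({..<n} \<times> {..<n})"
    define w where "w k = z * A (snd (prod_decode k)) (fst (prod_decode k))" for k
    have pairing: "mat_pairing n A (P J \<omega>)
        = (\<Sum>j<J. bilinear_form n n (mat_scale (c j) A) (Y (fst \<omega> j)) (X (fst \<omega> j))) + (\<Sum>k\<in>I. w k *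
            snd \<omega> k)" for \<omega>
    proof -
      have "mat_pairing n A (P J \<omega>)
          = (\<Sum>i<n. \<Sum>k<n. (\<Sum>j<J. A i k * (c j * (X (fst \<omega> j) k * Y (fst \<omega> j) i))))
            + (\<Sum>i<n. \<Sum>k<n. A i k * (z * snd \<omega> (prod_encode (k, i))))"
        by (simp add: mat_pairing_def P_def distrib_left sum.distrib sum_distrib_left)
      also have "(\<Sum>i<n. \<Sum>k<n. (\<Sum>j<J. A i k * (c j * (X (fst \<omega> j) k * Y (fst \<omega> j) i))))
          = (\<Sum>i<n. \<Sum>j<J. \<Sum>k<n. A i k * (c j * (X (fst \<omega> j) k * Y (fst \<omega> j) i)))"
        by (intro sum.cong refl sum.swap)
      also have "\<dots> = (\<Sum>j<J. \<Sum>i<n. \<Sum>k<n. A i k * (c j * (X (fst \<omega> j) k * Y (fst \<omega> j) i)))"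
        by (rule sum.swap)
      also have "\<dots> = (\<Sum>j<J. bilinear_form n n (mat_scale (c j) A) (Y (fst \<omega> j)) (X (fst \<omega> j)))"
        by (simp add: bilinear_form_def mult_ac)
      also have "(\<Sum>i<n. \<Sum>k<n. A i k * (z * snd \<omega> (prod_encode (k, i))))
          = (\<Sum>(k, i)\<in>{..<n} \<times> {..<n}. z * A i k * snd \<omega> (prod_encode (k, i)))"
        by (subst sum.swap) (simp add: sum.cartesian_product mult_ac)
      also have "\<dots> = (\<Sum>k\<in>I. w k * snd \<omega> k)"
        unfolding I_def w_def by (subst sum.reindex) (auto simp: inj_prod_encode case_prod_unfold)
      finally show ?thesis .
    qed
    have bil [measurable]: "(\<lambda>b. \<psi> (bilinear_form n n (mat_scale (c j) A) (Y b) (X b)))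
        \<in> borel_measurable B" for j
      using XPi YPi by measurable
    have "(\<integral>\<omega>. \<psi> (mat_pairing n A (P J \<omega>)) \<partial>\<Omega>)
        = (\<integral>\<omega>. (\<Prod>j<J. \<psi> (bilinear_form n n (mat_scale (c j) A) (Y (fst \<omega> j)) (X (fst \<omega> j)))) * \<psi>
            (\<Sum>k\<in>I. w k * snd \<omega> k) \<partial>\<Omega>)"
      by (simp only: pairing character_add character_sum[of _ "{..<J}"])
    also have "\<dots> = (\<integral>b. (\<integral>u. (\<Prod>j<J. \<psi> (bilinear_form n n (mat_scale (c j) A) (Y (b j)) (X (b j))))
        * \<psi> (\<Sum>k\<in>I. w k * u k) \<partial>haar_seq)
        \<partial>PiM UNIV (\<lambda>_. B))"
      unfolding \<Omega>_def
      by (rule bounded_integral_fst[symmetric, where B = 1])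
        (auto simp: prob_space_haar_seq prob_PB norm_mult simp flip: prod_norm)
    also have "\<dots> = (\<Prod>j<J. \<integral>b. \<psi> (bilinear_form n n (mat_scale (c j) A) (Y b) (X b)) \<partial>B)
        * (\<integral>u. \<psi> (\<Sum>k\<in>I. w k * u k) \<partial>haar_seq)"
    proof -
      have "(\<integral>b. (\<Prod>j<J. \<psi> (bilinear_form n n (mat_scale (c j) A) (Y (b j)) (X (b j)))) \<partial>PiM UNIV
          (\<lambda>_. B))
          = (\<Prod>j<J. \<integral>b. \<psi> (bilinear_form n n (mat_scale (c j) A) (Y b) (X b)) \<partial>B)"
        by (rule integral_PiM_prod[OF prob_B, where B = 1]) (use bil in simp_all)
      then show ?thesis by simp
    qed
    also have "(\<integral>u. \<psi> (\<Sum>k\<in>I. w k * u k) \<partial>haar_seq)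
        = (if \<forall>i j. z * A i j \<in> integer_ring then 1 else 0)"
    proof -
      have "(\<forall>k\<in>I. w k \<in> integer_ring) \<longleftrightarrow> (\<forall>i j. z * A i j \<in> integer_ring)"
      proof
        assume *: "\<forall>k\<in>I. w k \<in> integer_ring"
        show "\<forall>i j. z * A i j \<in> integer_ring"
        proof (intro allI)
          fix i j
          show "z * A i j \<in> integer_ring"
          proof (cases "i < n \<and> j < n")
            case True
            then show ?thesis
              using *[rule_format, of "prod_encode (j, i)"] by (simp add: I_def w_def)
          next
            case False
            then show ?thesis using A by (auto simp: Mat_fin_def)
          qed
        qed
      qed (simp add: w_def)
      then show ?thesis
        by (subst integral_character_haar_seq) (simp_all add: I_def)
    qed
    finally show ?thesis
      unfolding block of_real_prod by (simp only: mult.commute)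
  qed
  have "(\<lambda>J. \<integral>\<omega>. \<psi> (mat_pairing n A (P J \<omega>)) \<partial>\<Omega>) \<longlonglongrightarrow> char_fun \<psi> \<mu> A" if A: "A \<in> Mat_fin n" for n A
  proof -
    have "char_fun \<psi> \<mu> A = (\<integral>\<omega>. \<psi> (mat_pairing n A (R \<omega>)) \<partial>\<Omega>)"
      unfolding char_fun_eq[OF A] \<mu>_def by (rule integral_distr) measurable
    moreover have "(\<lambda>J. \<integral>\<omega>. \<psi> (mat_pairing n A (P J \<omega>)) \<partial>\<Omega>) \<longlonglongrightarrow> (\<integral>\<omega>. \<psi> (mat_pairing n A (R \<omega>)) \<partial>\<Omega>)"
    proof (rule integral_dominated_convergence[where w = "\<lambda>_. 1"])
      have "(\<lambda>J. mat_pairing n A (P J \<omega>)) \<longlonglongrightarrow> mat_pairing n A (R \<omega>)" for \<omega>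
        unfolding mat_pairing_def by (intro tendsto_intros P_R)
      then have "(\<lambda>J. \<psi> (mat_pairing n A (P J \<omega>))) \<longlonglongrightarrow> \<psi> (mat_pairing n A (R \<omega>))" for \<omega>
        by (rule continuous_on_tendsto_compose[OF continuous_character]) simp_all
      then show "AE \<omega> in \<Omega>. (\<lambda>J. \<psi> (mat_pairing n A (P J \<omega>))) \<longlonglongrightarrow> \<psi> (mat_pairing n A (R \<omega>))"
        by simp
    qed simp_all
    ultimately show ?thesis by simp
  qed
  moreover have "prob_space \<mu>"
    unfolding \<mu>_def by (rule prob_space_distr) measurable
  moreover have "sets \<mu> = sets borel"
    by (simp add: \<mu>_def)
  ultimately show ?thesis
    unfolding char_P[symmetric] by (intro exI[of _ \<mu>]) (auto simp: char_P)
qed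

section \<open>Realising a given sequence\<close>

lemma neg_power_mult_integral_iff:
  "neg_power \<pi> k * neg_power \<pi> l \<in> integer_ring \<longleftrightarrow> trunc_add k l = 0"
proof (cases "(k, l)" rule: trunc_add.cases)
  case (1 a b)
  then have "neg_power \<pi> k * neg_power \<pi> l = \<pi> powi (- (a + b))"
    by (simp flip: power_int_add)
  then show ?thesis
    using uniformizer_power_int_in_integer_ring_iff[of "- (a + b)"] 1 by auto
qed auto

lemma absv_neg_power_le:
  assumes "k \<le> Some t"
  shows "absv (neg_power \<pi> k) \<le> real q powi t"
  using assms q_real_gt_1
  by (cases k) (auto simp: absv_uniformizer_power_int intro: power_int_increasing)

text \<open>
  A weakly decreasing sequence is split into a part \<open>k'\<close> tending to \<open>-\<infinity>\<close> and the value \<open>x\<close> at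
  which it stabilises (\<open>-\<infinity>\<close> if there is none); \<open>x\<close> becomes the scale of the matrix \<open>Z\<close>.
\<close>

lemma Delta_split:
  assumes "k \<in> Delta"
  obtains k' x where "(\<lambda>j. neg_power \<pi> (k' j)) \<longlonglongrightarrow> 0"
    "\<forall>l. trunc_add x l = 0 \<longrightarrow>
      (\<forall>j. trunc_add (k' j) l = trunc_add (k j) l) \<and> (\<forall>\<^sub>F j in sequentially. trunc_add (k j) l = 0)"
    "\<forall>l. trunc_add x l \<noteq> 0 \<longrightarrow> (\<forall>j. 1 \<le> trunc_add (k j) l)"
proof (cases "\<exists>t. \<forall>j. Some t \<le> k j")
  case False
  have anti: "antimono k"
    using assms by (simp add: Delta_def)
  have ev: "\<forall>\<^sub>F j in sequentially. \<not> Some t \<le> k j" for t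
  proof -
    obtain J where "\<not> Some t \<le> k J"
      using False by blast
    then have "\<not> Some t \<le> k j" if "J \<le> j" for j
      using antimonoD[OF anti that] order_trans by blast
    then show ?thesis
      by (auto simp: eventually_sequentially)
  qed
  have "(\<lambda>j. absv (neg_power \<pi> (k j))) \<longlonglongrightarrow> 0"
  proof (rule order_tendstoI)
    fix e :: real assume "0 < e"
    then obtain n where n: "inverse (real q) ^ n < e"
      using real_arch_pow_inv[of e "inverse (real q)"] q_real_gt_1
          by (auto simp: inverse_less_1_iff)
    show "\<forall>\<^sub>F j in sequentially. absv (neg_power \<pi> (k j)) < e"
      using ev[of "- int n"]
    proof eventually_elim
      case (elim j)
      then have "k j \<le> Some (- int n)" by (cases "k j") auto
      then have "absv (neg_power \<pi> (k j)) \<le> real q powi (- int n)"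
        by (rule absv_neg_power_le)
      also have "\<dots> = inverse (real q) ^ n"
        by (simp add: power_int_minus power_inverse)
      finally show ?case using n by simp
    qed
  qed (auto intro!: always_eventually intro: less_le_trans)
  then have "(\<lambda>j. neg_power \<pi> (k j)) \<longlonglongrightarrow> 0"
    unfolding absv_eq_dist by (rule tendsto_dist_iff[THEN iffD2])
  moreover have "\<forall>\<^sub>F j in sequentially. trunc_add (k j) l = 0" for l
  proof (cases l)
    case (Some b)
    show ?thesis
      using ev[of "1 - b"] unfolding Some by eventually_elim (rule trunc_add_Some_eq_0)
  qed (simp add: trunc_add_commute[of _ None])
  ultimately show ?thesis
    using that[of k None] by simp
next
  case True
  then obtain t where t: "\<And>j. Some t \<le> k j" by blast
  have anti: "antimono k"
    using assms by (simp add: Delta_def)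
  obtain T where T: "k 0 = Some T"
    using t[of 0] by (cases "k 0") auto
  have "\<exists>x. \<forall>s. Some s \<le> x \<longleftrightarrow> (\<forall>j. Some s \<le> k j)"
  proof (rule int_greatest)
    show "\<forall>j. Some r \<le> k j" if "\<forall>j. Some s \<le> k j" "r \<le> s" for r s
      using that order_trans[of "Some r" "Some s"] by auto
    show "s \<le> T" if "\<forall>j. Some s \<le> k j" for s
      using that[rule_format, of 0] T by simp
  qed
  then obtain x where x: "\<And>s. Some s \<le> x \<longleftrightarrow> (\<forall>j. Some s \<le> k j)" by blast
  obtain g where g: "x = Some g"
    using x[of t] t by (cases x) auto
  have g_le: "Some g \<le> k j" for j
    using x[of g] g by simp
  have "\<not> (\<forall>j. Some (g + 1) \<le> k j)"
    using x[of "g + 1"] g by simp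
  then obtain J where J: "\<not> Some (g + 1) \<le> k J" by blast
  have k_eq: "k j = Some g" if "J \<le> j" for j
    using g_le[of j] J antimonoD[OF anti that] by (cases "k j"; cases "k J") auto
  \<comment> \<open>The constant tail with value \<open>g\<close> is cut off. Whenever
    \<open>trunc_add x l = 0\<close>, so that the uniform matrix does not make the value vanish, the
    entries cut off contribute nothing.\<close>
  define k' where "k' j = (if j < J then k j else None)" for j
  have "\<forall>\<^sub>F j in sequentially. neg_power \<pi> (k' j) = 0"
    by (auto simp: k'_def eventually_sequentially intro: exI[of _ J])
  then have "(\<lambda>j. neg_power \<pi> (k' j)) \<longlonglongrightarrow> 0"
    by (rule tendsto_eventually)
  moreover have "(\<forall>j. trunc_add (k' j) l = trunc_add (k j) l)
      \<and> (\<forall>\<^sub>F j in sequentially. trunc_add (k j) l = 0)"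
    if "trunc_add x l = 0" for l
    using that k_eq by (auto simp: k'_def g eventually_sequentially intro: exI[of _ J])
  moreover have "\<forall>j. 1 \<le> trunc_add (k j) l" if l: "trunc_add x l \<noteq> 0" for l
  proof
    fix j
    show "1 \<le> trunc_add (k j) l"
      using l g_le[of j] g by (cases l; cases "k j") (auto split: if_splits)
  qed
  ultimately show ?thesis
    using that[of k' x] by blast
qed

text \<open>Phrased for every factorisation of any size \<open>n\<close>, while \<open>Sing\<close>
  refers to the least size. Invariance of the measure is derived from this formula, and
  multiplicativity compares factorisations of sizes \<open>n\<close> and
  \<open>Suc n\<close>.\<close>

lemma measure_with_char_fun_exists:
  assumes k: "k \<in> Delta"
  obtains \<mu> where "prob_space \<mu>" "sets \<mu> = sets borel"
    "\<And>n a b ks. a \<in> GL_fin n \<Longrightarrow> b \<in> GL_fin n \<Longrightarrow> length ks = n \<Longrightarrow>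
      char_fun \<psi> \<mu> (a \<odot> diag_mat \<pi> ks \<odot> b) = complex_of_real (\<Prod>l\<in>#mset ks. sing_factor q k l)"
proof -
  obtain k' x where k': "(\<lambda>j. neg_power \<pi> (k' j)) \<longlonglongrightarrow> 0"
    and zero: "\<forall>l. trunc_add x l = 0 \<longrightarrow>
      (\<forall>j. trunc_add (k' j) l = trunc_add (k j) l) \<and> (\<forall>\<^sub>F j in sequentially. trunc_add (k j) l = 0)"
    and pos: "\<forall>l. trunc_add x l \<noteq> 0 \<longrightarrow> (\<forall>j. 1 \<le> trunc_add (k j) l)"
    by (rule Delta_split[OF k])
  obtain \<mu> where \<mu>: "prob_space \<mu>" "sets \<mu> = sets borel"
    and lim: "\<And>n A. A \<in> Mat_fin n \<Longrightarrow> (\<lambda>J. (if \<forall>i j. neg_power \<pi> x * A i j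
        \<in> integer_ring then 1 else 0)
        * complex_of_real (\<Prod>j<J. corner_prob n n (mat_scale (neg_power \<pi> (k' j)) A))) \<longlonglongrightarrow> char_fun \<psi>
            \<mu> A"
    using random_matrix_exists[OF k', of "neg_power \<pi> x"] by blast
  have "char_fun \<psi> \<mu> (a \<odot> diag_mat \<pi> ks \<odot> b) = complex_of_real (\<Prod>l\<in>#mset ks. sing_factor q k l)"
    if ab: "a \<in> GL_fin n" "b \<in> GL_fin n" "length ks = n" for n a b ks
  proof -
    define A where "A = a \<odot> diag_mat \<pi> ks \<odot> b"
    note blocks = ab(1,2)[THEN GL_fin_int_block]
    have A: "A \<in> Mat_fin n"
      unfolding A_def using ab(3) by (intro Mat_fin_mult blocks) (auto simp: diag_mat_def
          Mat_fin_def)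
    have "(\<forall>i j. neg_power \<pi> x * A i j \<in> integer_ring)
        \<longleftrightarrow> (\<forall>i j. mat_scale (neg_power \<pi> x) A i j \<in> integer_ring)"
      by simp
    also have "mat_scale (neg_power \<pi> x) A = a \<odot> mat_scale (neg_power \<pi> x) (diag_mat \<pi> ks) \<odot> b"
      unfolding A_def by (simp only: mat_scale_mult(2)[OF blocks(2)] mat_scale_mult(1)[OF
          blocks(1)])
    also have "(\<forall>i j. (a \<odot> mat_scale (neg_power \<pi> x) (diag_mat \<pi> ks) \<odot> b) i j \<in> integer_ring)
        \<longleftrightarrow> (\<forall>i j. mat_scale (neg_power \<pi> x) (diag_mat \<pi> ks) i j \<in> integer_ring)"
      by (rule integral_entries_GL_iff[OF ab(1,2)])
    also have "\<dots> \<longleftrightarrow> (\<forall>l\<in>set ks. trunc_add x l = 0)"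
      unfolding neg_power_mult_integral_iff[symmetric] by (force simp: diag_mat_def in_set_conv_nth)
    finally have integral: "(\<forall>i j. neg_power \<pi> x * A i j \<in> integer_ring)
        \<longleftrightarrow> (\<forall>l\<in>set ks. trunc_add x l = 0)" .
    \<comment> \<open>If the indicator is \<open>1\<close>, then from some position on the entries
      of \<open>k\<close> contribute nothing to any \<open>l\<close> in \<open>ks\<close>, and the
      products are eventually constant. If it is \<open>0\<close>, every entry of \<open>k\<close>
      contributes at least 1 for some such \<open>l\<close>, so the corresponding
      \<open>sing_factor\<close> vanishes as well.\<close>
    show ?thesis
    proof (cases "\<forall>l\<in>set ks. trunc_add x l = 0")
      case True
      have "\<forall>\<^sub>F j in sequentially. \<forall>l\<in>set ks. trunc_add (k j) l = 0"
        using True zero by (intro eventually_ball_finite) auto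
      then obtain J where J: "\<And>j l. J \<le> j \<Longrightarrow> l \<in> set ks \<Longrightarrow> trunc_add (k j) l = 0"
        by (auto simp: eventually_sequentially)
      have "(\<Prod>j<N. corner_prob n n (mat_scale (neg_power \<pi> (k' j)) A))
          = (\<Prod>l\<in>#mset ks. sing_factor q k l)"
        if "J \<le> N" for N
      proof -
        have "(\<Prod>j<N. corner_prob n n (mat_scale (neg_power \<pi> (k' j)) A))
            = (\<Prod>j<N. inverse (real q ^ (\<Sum>l\<leftarrow>ks. nat (trunc_add (k j) l))))"
        proof (rule prod.cong[OF refl])
          fix j
          have "(\<Sum>l\<in>#mset ks. nat (trunc_add l (k' j))) = (\<Sum>l\<leftarrow>ks. nat (trunc_add (k j) l))"
          proof -
            have "(\<Sum>l\<in>#mset ks. nat (trunc_add l (k' j)))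
                = sum_list (map (\<lambda>l. nat (trunc_add l (k' j))) ks)"
              by (simp add: sum_mset_sum_list flip: mset_map)
            also have "\<dots> = (\<Sum>l\<leftarrow>ks. nat (trunc_add (k j) l))"
              using True zero by (intro arg_cong[where f = sum_list] map_cong refl) (simp add:
                  trunc_add_commute[of _ "k' j"])
            finally show ?thesis .
          qed
          then show "corner_prob n n (mat_scale (neg_power \<pi> (k' j)) A)
              = inverse (real q ^ (\<Sum>l\<leftarrow>ks. nat (trunc_add (k j) l)))"
            unfolding A_def using corner_prob_singular_numbers[OF ab, of "k' j"] by simp
        qed
        also have "\<dots> = (\<Prod>l\<leftarrow>ks. inverse (real q ^ (\<Sum>j<N. nat (trunc_add (k j) l))))"
          by (induction ks) (simp_all add: power_add prod.distrib power_sum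
              prod_inversef[symmetric])
        also have "\<dots> = (\<Prod>l\<leftarrow>ks. sing_factor q k l)"
        proof (intro arg_cong[where f = prod_list] map_cong refl)
          fix l assume "l \<in> set ks"
          then show "inverse (real q ^ (\<Sum>j<N. nat (trunc_add (k j) l))) = sing_factor q k l"
            using J that by (intro sing_factor_finite[OF q_gt_1, symmetric]) auto
        qed
        finally show ?thesis
          by (simp add: prod_mset_prod_list flip: mset_map)
      qed
      then have "\<forall>\<^sub>F N in sequentially. (if \<forall>i j. neg_power \<pi> x * A i j
          \<in> integer_ring then 1 else 0)
          * complex_of_real (\<Prod>j<N. corner_prob n n (mat_scale (neg_power \<pi> (k' j)) A))
          = complex_of_real (\<Prod>l\<in>#mset ks. sing_factor q k l)"
        using True unfolding integral eventually_sequentially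
            by (auto intro!: exI[of _ J] simp del: of_real_prod)
      then have "(\<lambda>N. (if \<forall>i j. neg_power \<pi> x * A i j \<in> integer_ring then 1 else 0)
          * complex_of_real (\<Prod>j<N. corner_prob n n (mat_scale (neg_power \<pi> (k' j)) A)))
          \<longlonglongrightarrow> complex_of_real (\<Prod>l\<in>#mset ks. sing_factor q k l)"
        by (rule tendsto_eventually)
      then show ?thesis
        unfolding A_def[symmetric] using LIMSEQ_unique[OF lim[OF A]] by blast
    next
      case False
      then obtain l where l: "l \<in> set ks" "trunc_add x l \<noteq> 0" by blast
      then have "sing_factor q k l = 0"
        using pos l(2) by (intro sing_factor_infinite[OF q_gt_1]) auto
      then have "(\<Prod>l\<in>#mset ks. sing_factor q k l) = 0"
        using l(1) by (simp add: prod_mset_zero_iff)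
      moreover have "(\<lambda>J::nat. 0) \<longlonglongrightarrow> char_fun \<psi> \<mu> A"
        using lim[OF A] False unfolding integral by simp
      then have "char_fun \<psi> \<mu> A = 0"
        using LIMSEQ_unique[OF _ tendsto_const] by blast
      ultimately show ?thesis
        by (simp add: A_def)
    qed
  qed
  with \<mu> show ?thesis by (rule that)
qed

text \<open>The characteristic function depends on the singular numbers alone, so it does not change
  under multiplication by integral invertible matrices, and uniqueness of measures makes the measure
  itself invariant. Appending one diagonal entry then exhibits multiplicativity.\<close>

lemma ergodic_measure_exists:
  assumes k: "k \<in> Delta"
  shows "\<exists>\<mu>\<in>ergodic_measures. \<forall>A\<in>Mat_inf. char_fun \<psi> \<mu> A = phi \<pi> k A"
proof -
  obtain \<mu> where \<mu>: "prob_space \<mu>" and sets_\<mu> [measurable_cong]: "sets \<mu> = sets borel"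
    and char: "\<And>n a b ks. a \<in> GL_fin n \<Longrightarrow> b \<in> GL_fin n \<Longrightarrow> length ks = n \<Longrightarrow>
      char_fun \<psi> \<mu> (a \<odot> diag_mat \<pi> ks \<odot> b) = complex_of_real (\<Prod>l\<in>#mset ks. sing_factor q k l)"
    using measure_with_char_fun_exists[OF k] by blast
  have char_GL: "char_fun \<psi> \<mu> (h \<odot> A \<odot> g) = char_fun \<psi> \<mu> A"
    if A: "A \<in> Mat_fin n" and g: "g \<in> GL_fin n" and h: "h \<in> GL_fin n" for A g h n
  proof -
    obtain a b ks where ab: "a \<in> GL_fin n" "b \<in> GL_fin n" "length ks = n"
        "A = a \<odot> diag_mat \<pi> ks \<odot> b"
      by (rule singular_number_decomposition[OF A])
    note blocks = ab(1,2)[THEN GL_fin_int_block] g[THEN GL_fin_int_block] h[THEN GL_fin_int_block]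
    have "h \<odot> A \<odot> g = (h \<odot> a) \<odot> diag_mat \<pi> ks \<odot> (b \<odot> g)"
      unfolding ab(4)
      by (simp only: int_block_assoc_middle[OF blocks(4) blocks(2), symmetric]
          int_block_assoc_right[OF blocks(2) blocks(3)] int_block_assoc_left[OF blocks(4)
              blocks(1)])
    then show ?thesis
      using char[OF ab(1-3)] char[OF GL_fin_mult[OF h ab(1)] GL_fin_mult[OF ab(2) g] ab(3)] ab(4)
          by simp
  qed
  have inv: "invariant_prob \<mu>"
  proof (rule invariant_probI[OF sets_\<mu> \<mu>])
    fix n and g h :: "'a inf_mat" assume gh: "g \<in> GL_fin n" "h \<in> GL_fin n"
    have [measurable]: "(\<lambda>M. g \<odot> M \<odot> h) \<in> borel_measurable borel"
      by (rule measurable_GL_mult[OF gh[THEN GL_fin_int_block]])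
    show "distr \<mu> borel (\<lambda>M. g \<odot> M \<odot> h) = \<mu>"
    proof (rule char_fun_inject[OF _ _ \<mu> sets_\<mu>])
      show "prob_space (distr \<mu> borel (\<lambda>M. g \<odot> M \<odot> h))"
        by (rule prob_space.prob_space_distr[OF \<mu>]) measurable
      fix A :: "'a inf_mat" assume "A \<in> Mat_inf"
      then obtain m where "A \<in> Mat_fin m"
        by (auto simp: Mat_inf_eq)
      define N where "N = max m n"
      have A: "A \<in> Mat_fin N" and gh': "g \<in> GL_fin N" "h \<in> GL_fin N"
        using Mat_fin_mono[of m N] GL_fin_mono[of n N] gh \<open>A \<in> Mat_fin m\<close> by (auto simp: N_def)
      note blocks = gh'[THEN GL_fin_int_block]
      have "char_fun \<psi> (distr \<mu> borel (\<lambda>M. g \<odot> M \<odot> h)) A = (\<integral>M. \<psi> (mat_pairing N A (g \<odot> M \<odot> h)) \<partial>\<mu>)"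
        unfolding char_fun_eq[OF A] by (rule integral_distr) measurable
      also have "\<dots> = char_fun \<psi> \<mu> (h \<odot> A \<odot> g)"
        unfolding mat_pairing_shift[OF blocks]
            by (intro char_fun_eq[symmetric] Mat_fin_mult A blocks)
      also have "\<dots> = char_fun \<psi> \<mu> A"
        by (rule char_GL[OF A gh'])
      finally show "char_fun \<psi> (distr \<mu> borel (\<lambda>M. g \<odot> M \<odot> h)) A = char_fun \<psi> \<mu> A" .
    qed simp
  qed
  have "char_fun \<psi> \<mu> (B \<oplus> mat_single n (neg_power \<pi> l))
      = char_fun \<psi> \<mu> B * complex_of_real (sing_factor q k l)"
    if B: "B \<in> Mat_fin n" for n B l
  proof -
    obtain a b ks where ab: "a \<in> GL_fin n" "b \<in> GL_fin n" "length ks = n"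
        "B = a \<odot> diag_mat \<pi> ks \<odot> b"
      by (rule singular_number_decomposition[OF B])
    have "diag_mat \<pi> ks \<oplus> mat_single n (neg_power \<pi> l) = diag_mat \<pi> (ks @ [l])"
      using ab(3) by (auto simp: fun_eq_iff diag_mat_def mat_single_def nth_append)
    then have "B \<oplus> mat_single n (neg_power \<pi> l) = a \<odot> diag_mat \<pi> (ks @ [l]) \<odot> b"
      using mat_add_single_GL[OF ab(1,2)] ab(4) by metis
    moreover have "a \<in> GL_fin (Suc n)" "b \<in> GL_fin (Suc n)"
      using GL_fin_mono[of n "Suc n"] ab(1,2) by auto
    ultimately show ?thesis
      using char[of a "Suc n" b "ks @ [l]"] char[OF ab(1-3)] ab(3,4) by (simp add: mult.commute)
  qed
  then have "\<mu> \<in> ergodic_measures"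
    by (rule multiplicative_imp_ergodic[OF inv])
  moreover have "char_fun \<psi> \<mu> A = phi \<pi> k A" if A: "A \<in> Mat_inf" for A
  proof -
    obtain n a b ks where "A \<in> Mat_fin n" "a \<in> GL_fin n" "b \<in> GL_fin n" "length ks = n"
      "A = a \<odot> diag_mat \<pi> ks \<odot> b" "Sing \<pi> A = mset ks"
      by (rule Sing_decomposition[OF A])
    then show ?thesis
      using char[of a n b ks] by (simp add: phi_def)
  qed
  ultimately show ?thesis by blast
qed

text \<open>Both families are restricted because their defining formulas also produce values outside
  \<open>Mat_inf\<close>, where these carry no meaning.\<close>

lemma characteristic_functions_eq:
  "(\<lambda>\<mu>. restrict (char_fun \<psi> \<mu>) Mat_inf) ` ergodic_measures
      = (\<lambda>k. restrict (phi \<pi> k) Mat_inf) ` Delta"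
proof (intro equalityI subsetI)
  fix \<phi> assume "\<phi> \<in> (\<lambda>\<mu>. restrict (char_fun \<psi> \<mu>) Mat_inf) ` ergodic_measures"
  then obtain \<mu> where \<mu>: "\<mu> \<in> ergodic_measures" "\<phi> = restrict (char_fun \<psi> \<mu>) Mat_inf"
    by blast
  then obtain k where "k \<in> Delta" "\<forall>A\<in>Mat_inf. char_fun \<psi> \<mu> A = phi \<pi> k A"
    using ergodic_char_fun by blast
  then show "\<phi> \<in> (\<lambda>k. restrict (phi \<pi> k) Mat_inf) ` Delta"
    unfolding \<mu>(2) by (intro image_eqI[of _ _ k] restrict_ext) auto
next
  fix \<phi> assume "\<phi> \<in> (\<lambda>k. restrict (phi \<pi> k) Mat_inf) ` Delta"
  then obtain k where k: "k \<in> Delta" "\<phi> = restrict (phi \<pi> k) Mat_inf"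
    by blast
  then obtain \<mu> where "\<mu> \<in> ergodic_measures" "\<forall>A\<in>Mat_inf. char_fun \<psi> \<mu> A = phi \<pi> k A"
    using ergodic_measure_exists by blast
  then show "\<phi> \<in> (\<lambda>\<mu>. restrict (char_fun \<psi> \<mu>) Mat_inf) ` ergodic_measures"
    unfolding k(2) by (intro image_eqI[of _ _ \<mu>] restrict_ext) auto
qed

end

theorem theorem1p8:
  fixes \<pi> :: "'a::nonarch_local_field" and \<psi> :: "'a \<Rightarrow> complex"
  assumes "uniformizer \<pi>"
    and "absv \<pi> = inverse (real (residue_card \<pi>))"
    and "additive_character \<psi>"
    and "\<forall>x\<in>integer_ring. \<psi> x = 1"
    and "\<not> \<psi> constant_on ((\<lambda>x. inverse \<pi> * x) ` integer_ring)"
  shows "(\<lambda>\<mu>. restrict (char_fun \<psi> \<mu>) Mat_inf) ` ergodic_measures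
       = (\<lambda>k. restrict (phi \<pi> k) Mat_inf) ` Delta"
proof -
  interpret normalized_character \<pi> \<psi>
    using assms by unfold_locales
  show ?thesis
    by (rule characteristic_functions_eq)
qed

end
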